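(* Assume that for every $(y,b)\in\mathcal{A}_{\rm frame}$ with $y'\cdot b'=0$ a.e. in $(0,L)$ and every $\sigma>0$ there exists $(y_\sigma,b_\sigma)\in[C^\infty([0,L];\mathbb{R}^3)]^2\cap\mathcal{A}_{\rm frame}$ with $$\|y-y_\sigma\|_{H^2(0,L)}+\|b-b_\sigma\|_{H^1(0,L)}\le\sigma\quad\text{and}\quad y_\sigma'\cdot b_\sigma'=0\ \text{ in }(0,L).$$ Let $\delta=\delta(h)>0$, $\varepsilon_1=\varepsilon_1(h)>0$ and $\varepsilon_2=\varepsilon_2(h)>0$ satisfy $(\delta,\varepsilon_1,\varepsilon_2)\to0$ and $$h^2\varepsilon_1^{-1}+h^2\varepsilon_2^{-1}\to0\quad\text{as }h\to0.$$ Then the constrained functionals $E_{\delta,\varepsilon,h}$ are $\Gamma$-convergent to the constrained functional $E$ as $h\to0$ (with respect to weak convergence in $V$).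
   Context: Let $L>0$, $V=H^2(0,L;\mathbb{R}^3)\times H^1(0,L;\mathbb{R}^3)$, and let $L_{\rm bc}$ be a bounded linear operator on $V$ that depends only on the boundary values (at $0$ and $L$) of $y$, $y'$ and $b$; $\ell_{\rm bc}$ is given data. Set $$\mathcal{A}_{\rm frame}=\{(y,b)\in V:\ [y',b,y'\times b]\in SO(3)\text{ a.e. in }(0,L),\ L_{\rm bc}[y,b]=\ell_{\rm bc}\}.$$ Define $\overline{Q}(\alpha,\beta)=(\alpha^2+\beta^2)^2/\alpha^2$ if $|\alpha|>|\beta|$, and $\overline{Q}(\alpha,\beta)=4\beta^2$ if $|\alpha|\le|\beta|$. The continuous constrained functional is $E:V\to[0,\infty]$, $E[y,b]=\int_0^L\overline{Q}(|y''|,|b'|)\,dx$ if $(y,b)\in\mathcal{A}_{\rm frame}$ and $y'\cdot b'=0$ a.e., and $E[y,b]=+\infty$ otherwise. Regularized modulus: for every $\delta>0$ a function $|\cdot|_\delta\in C^2(\mathbb{R};\mathbb{R}_{\ge0})$ is given such that, with constants $c_0,c_1,c_2,c_{\rm uni}>0$ independent of $\delta$, $|x|_\delta\ge c_0\delta$, $\big|(|\cdot|_\delta)'\big|\le c_1$, $\big|(|\cdot|_\delta)''\big|\le c_2\delta^{-1}$, and $\big||x|_\delta-|x|\big|\le c_{\rm uni}\delta$ for all $x\in\mathbb{R}$. Set $$\psi_\delta(\alpha^2,\beta^2)=|\alpha^2-\beta^2|_\delta+\frac{4\beta^4}{\alpha^2+\beta^2+|\alpha^2-\beta^2|_\delta}.$$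 Discretization: $\mathcal{T}_h$ is a quasiuniform family (minimal element length $\ge c\,h$) of partitions $0=x_0<x_1<\dots<x_N=L$ of $(0,L)$ with maximal element length $h$. $\mathcal{S}^{p,k}(\mathcal{T}_h)$ is the space of $C^k$ functions on $[0,L]$ that are polynomials of degree at most $p$ on each element. $V_h=\mathcal{S}^{3,1}(\mathcal{T}_h)^3\times\mathcal{S}^{1,0}(\mathcal{T}_h)^3\subset V$. A pair $(y_h,b_h)\in V_h$ is called discrete admissible if $|y_h'(x_j)|=|b_h(x_j)|=1$ for $j=0,\dots,N$ and $L_{\rm bc}[y_h,b_h]=\ell_{\rm bc}$. For such pairs, with $\varepsilon=(\varepsilon_1,\varepsilon_2)$, $$E_{\delta,\varepsilon,h}[y_h,b_h]=\frac12\int_0^L|y_h''|^2+5|b_h'|^2+\psi_\delta(|y_h''|^2,|b_h'|^2)\,dx+\frac1{2\varepsilon_1}\int_0^L(y_h'\cdot b_h)^2dx+\frac1{2\varepsilon_2}\int_0^L(y_h'\cdot b_h')^2dx,$$ and $E_{\delta,\varepsilon,h}=+\infty$ on all other elements of $V$. $\Gamma$-convergence of $F_h$ to $F$ on $V$ means: (a) $F[y,b]\le\liminf F_h[y_h,b_h]$ whenever $(y_h,b_h)\rightharpoonup(y,b)$ weakly in $V$; (b) for each $(y,b)\in V$ there are $(y_h,b_h)\rightharpoonup(y,b)$ in $V$ with $F_h[y_h,b_h]\to F[y,b]$. *)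

theory Defs
  imports "HOL-Analysis.Analysis" "HOL-Computational_Algebra.Polynomial"
begin

section \<open>Sobolev spaces on an interval\<close>

text \<open>Elements of function spaces on \<open>(0,L)\<close> are represented by total functions on the reals;
  only their values on \<open>[0,L]\<close> matter.\<close>

abbreviation Om :: "real \<Rightarrow> real measure" where
  "Om L \<equiv> lebesgue_on {0<..<L}"

definition L2 :: "real \<Rightarrow> (real \<Rightarrow> 'a::euclidean_space) set" where
  "L2 L = {g. g \<in> borel_measurable (Om L) \<and> integrable (Om L) (\<lambda>x. (norm (g x))\<^sup>2)}"

definition L2_norm :: "real \<Rightarrow> (real \<Rightarrow> 'a::euclidean_space) \<Rightarrow> real" where
  "L2_norm L g = sqrt (LINT x|Om L. (norm (g x))\<^sup>2)"

text \<open>The test functions are those in \<open>C\<^sup>1\<^sub>c(0,L)\<close>, as in Brezis' treatment of Sobolev spaces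
  in one dimension.\<close>

definition test_functions :: "real \<Rightarrow> (real \<Rightarrow> real) set" where
  "test_functions L = {\<phi>. (\<forall>x. \<phi> differentiable at x) \<and> continuous_on UNIV (deriv \<phi>) \<and>
     (\<exists>a b. 0 < a \<and> b < L \<and> (\<forall>x. x \<notin> {a..b} \<longrightarrow> \<phi> x = 0))}"

definition weak_derivative ::
  "real \<Rightarrow> (real \<Rightarrow> 'a::euclidean_space) \<Rightarrow> (real \<Rightarrow> 'a) \<Rightarrow> bool" where
  "weak_derivative L u g \<longleftrightarrow> (\<forall>\<phi>\<in>test_functions L.
     (LINT x|Om L. deriv \<phi> x *\<^sub>R u x) = - (LINT x|Om L. \<phi> x *\<^sub>R g x))"

text \<open>A class in \<open>H\<^sup>1(0,L)\<close> is represented by its unique representative that is continuous on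
  \<open>[0,L]\<close>, so that point values and boundary values make sense.\<close>

definition H1 :: "real \<Rightarrow> (real \<Rightarrow> 'a::euclidean_space) set" where
  "H1 L = {u. continuous_on {0..L} u \<and> (\<exists>g\<in>L2 L. weak_derivative L u g)}"

definition H2 :: "real \<Rightarrow> (real \<Rightarrow> 'a::euclidean_space) set" where
  "H2 L = {u. continuous_on {0..L} u \<and> (\<exists>z\<in>H1 L. weak_derivative L u z)}"

text \<open>The weak derivative of a function in \<open>H\<^sup>1\<close>, determined almost everywhere on \<open>(0,L)\<close>.\<close>

definition wderiv :: "real \<Rightarrow> (real \<Rightarrow> 'a::euclidean_space) \<Rightarrow> real \<Rightarrow> 'a" where
  "wderiv L u = (SOME g. g \<in> L2 L \<and> weak_derivative L u g)"

text \<open>The continuous representative of the weak derivative, determined everywhere on \<open>[0,L]\<close>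
  whenever it exists, in particular for functions in \<open>H\<^sup>2\<close>.\<close>

definition cderiv :: "real \<Rightarrow> (real \<Rightarrow> 'a::euclidean_space) \<Rightarrow> real \<Rightarrow> 'a" where
  "cderiv L u = (SOME z. continuous_on {0..L} z \<and> weak_derivative L u z)"

definition H1_norm :: "real \<Rightarrow> (real \<Rightarrow> 'a::euclidean_space) \<Rightarrow> real" where
  "H1_norm L u = sqrt ((L2_norm L u)\<^sup>2 + (L2_norm L (wderiv L u))\<^sup>2)"

definition H2_norm :: "real \<Rightarrow> (real \<Rightarrow> 'a::euclidean_space) \<Rightarrow> real" where
  "H2_norm L u = sqrt ((L2_norm L u)\<^sup>2 + (L2_norm L (cderiv L u))\<^sup>2
     + (L2_norm L (wderiv L (cderiv L u)))\<^sup>2)"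


section \<open>The space V and its weak topology\<close>

type_synonym curve = "real \<Rightarrow> real^3"

definition V :: "real \<Rightarrow> (curve \<times> curve) set" where
  "V L = H2 L \<times> H1 L"

definition V_norm :: "real \<Rightarrow> curve \<times> curve \<Rightarrow> real" where
  "V_norm L = (\<lambda>(y, b). H2_norm L y + H1_norm L b)"

text \<open>Boundedness with respect to the norm of \<open>V\<close> forces such a \<open>T\<close> to ignore the values of its
  arguments outside \<open>[0,L]\<close>.\<close>

definition bounded_linear_on_V ::
  "real \<Rightarrow> (curve \<times> curve \<Rightarrow> 'w::real_normed_vector) \<Rightarrow> bool" where
  "bounded_linear_on_V L T \<longleftrightarrow>
     (\<forall>y b z c. (y, b) \<in> V L \<longrightarrow> (z, c) \<in> V L \<longrightarrow>
        T (\<lambda>x. y x + z x, \<lambda>x. b x + c x) = T (y, b) + T (z, c)) \<and>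
     (\<forall>r y b. (y, b) \<in> V L \<longrightarrow> T (\<lambda>x. r *\<^sub>R y x, \<lambda>x. r *\<^sub>R b x) = r *\<^sub>R T (y, b)) \<and>
     (\<exists>C. \<forall>u\<in>V L. norm (T u) \<le> C * V_norm L u)"

definition weakly_converges ::
  "real \<Rightarrow> ('i \<Rightarrow> curve \<times> curve) \<Rightarrow> curve \<times> curve \<Rightarrow> 'i filter \<Rightarrow> bool" where
  "weakly_converges L U u F \<longleftrightarrow>
     (\<forall>f :: curve \<times> curve \<Rightarrow> real. bounded_linear_on_V L f \<longrightarrow> ((\<lambda>i. f (U i)) \<longlongrightarrow> f u) F)"

text \<open>The limit is \<open>h \<rightarrow> 0\<close> along an index set \<open>H\<close> of mesh sizes.\<close>

definition Gamma_converges ::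
  "real \<Rightarrow> real set \<Rightarrow> (real \<Rightarrow> curve \<times> curve \<Rightarrow> ennreal) \<Rightarrow> (curve \<times> curve \<Rightarrow> ennreal) \<Rightarrow> bool"
  where
  "Gamma_converges L H Fh F \<longleftrightarrow>
     (\<forall>u\<in>V L. \<forall>U. (\<forall>h\<in>H. U h \<in> V L) \<longrightarrow> weakly_converges L U u (at 0 within H) \<longrightarrow>
        F u \<le> Liminf (at 0 within H) (\<lambda>h. Fh h (U h))) \<and>
     (\<forall>u\<in>V L. \<exists>U. (\<forall>h\<in>H. U h \<in> V L) \<and> weakly_converges L U u (at 0 within H) \<and>
        ((\<lambda>h. Fh h (U h)) \<longlongrightarrow> F u) (at 0 within H))"


section \<open>The continuous functional\<close>

definition depends_only_on_boundary_values :: "real \<Rightarrow> (curve \<times> curve \<Rightarrow> 'w) \<Rightarrow> bool" where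
  "depends_only_on_boundary_values L T \<longleftrightarrow>
     (\<forall>y b z c. (y, b) \<in> V L \<longrightarrow> (z, c) \<in> V L \<longrightarrow>
        (\<forall>x\<in>{0, L}. y x = z x \<and> cderiv L y x = cderiv L z x \<and> b x = c x) \<longrightarrow>
        T (y, b) = T (z, c))"

text \<open>\<^const>\<open>vector\<close> lists rows, whence the transposition: \<open>p\<close>, \<open>q\<close>, \<open>p \<times> q\<close> are the columns.\<close>

definition frame_matrix :: "real^3 \<Rightarrow> real^3 \<Rightarrow> real^3^3" where
  "frame_matrix p q = transpose (vector [p, q, cross3 p q])"

definition A_frame ::
  "real \<Rightarrow> (curve \<times> curve \<Rightarrow> 'w) \<Rightarrow> 'w \<Rightarrow> (curve \<times> curve) set" where
  "A_frame L Lbc lbc = {(y, b). (y, b) \<in> V L \<and>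
     (AE x in Om L. rotation_matrix (frame_matrix (cderiv L y x) (b x))) \<and>
     Lbc (y, b) = lbc}"

definition Qbar :: "real \<Rightarrow> real \<Rightarrow> real" where
  "Qbar \<alpha> \<beta> = (if \<bar>\<alpha>\<bar> > \<bar>\<beta>\<bar> then (\<alpha>\<^sup>2 + \<beta>\<^sup>2)\<^sup>2 / \<alpha>\<^sup>2 else 4 * \<beta>\<^sup>2)"

definition E_cont ::
  "real \<Rightarrow> (curve \<times> curve \<Rightarrow> 'w) \<Rightarrow> 'w \<Rightarrow> curve \<times> curve \<Rightarrow> ennreal" where
  "E_cont L Lbc lbc = (\<lambda>(y, b).
     if (y, b) \<in> A_frame L Lbc lbc \<and> (AE x in Om L. cderiv L y x \<bullet> wderiv L b x = 0)
     then (\<integral>\<^sup>+x. ennreal (Qbar (norm (wderiv L (cderiv L y) x)) (norm (wderiv L b x))) \<partial>Om L)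
     else \<infinity>)"


section \<open>The discretized and regularized functional\<close>

text \<open>\<open>C\<^sup>k([0,L])\<close>, with one-sided derivatives at the end points; \<open>D i\<close> is the \<open>i\<close>-th derivative.\<close>

definition Ck :: "nat \<Rightarrow> real \<Rightarrow> (real \<Rightarrow> 'a::real_normed_vector) set" where
  "Ck k L = {f. \<exists>D. (\<forall>x\<in>{0..L}. D 0 x = f x) \<and> (\<forall>i\<le>k. continuous_on {0..L} (D i)) \<and>
     (\<forall>i<k. \<forall>x\<in>{0..L}. (D i has_vector_derivative D (Suc i) x) (at x within {0..L}))}"

definition Cinf :: "real \<Rightarrow> (real \<Rightarrow> 'a::real_normed_vector) set" where
  "Cinf L = (\<Inter>k. Ck k L)"

definition partition_with_mesh :: "real \<Rightarrow> real \<Rightarrow> nat \<Rightarrow> (nat \<Rightarrow> real) \<Rightarrow> bool" where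
  "partition_with_mesh L h N X \<longleftrightarrow> 0 < N \<and> X 0 = 0 \<and> X N = L \<and> (\<forall>j<N. X j < X (Suc j)) \<and>
     Max ((\<lambda>j. X (Suc j) - X j) ` {..<N}) = h"

definition quasiuniform_family ::
  "real \<Rightarrow> real set \<Rightarrow> (real \<Rightarrow> nat) \<Rightarrow> (real \<Rightarrow> nat \<Rightarrow> real) \<Rightarrow> bool" where
  "quasiuniform_family L H N X \<longleftrightarrow>
     (\<forall>h\<in>H. partition_with_mesh L h (N h) (X h)) \<and>
     (\<exists>c>0. \<forall>h\<in>H. \<forall>j<N h. c * h \<le> X h (Suc j) - X h j)"

definition spline_space :: "nat \<Rightarrow> nat \<Rightarrow> real \<Rightarrow> nat \<Rightarrow> (nat \<Rightarrow> real) \<Rightarrow> (real \<Rightarrow> real) set" where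
  "spline_space p k L N X = {f \<in> Ck k L.
     \<forall>j<N. \<exists>q. degree q \<le> p \<and> (\<forall>x\<in>{X j..X (Suc j)}. f x = poly q x)}"

definition V_discrete :: "real \<Rightarrow> nat \<Rightarrow> (nat \<Rightarrow> real) \<Rightarrow> (curve \<times> curve) set" where
  "V_discrete L N X = {(y, b).
     (\<forall>i. (\<lambda>x. y x $ i) \<in> spline_space 3 1 L N X) \<and>
     (\<forall>i. (\<lambda>x. b x $ i) \<in> spline_space 1 0 L N X)}"

definition discrete_admissible ::
  "real \<Rightarrow> (curve \<times> curve \<Rightarrow> 'w) \<Rightarrow> 'w \<Rightarrow> nat \<Rightarrow> (nat \<Rightarrow> real) \<Rightarrow> (curve \<times> curve) set" where
  "discrete_admissible L Lbc lbc N X = {(y, b). (y, b) \<in> V_discrete L N X \<and>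
     (\<forall>j\<le>N. norm (cderiv L y (X j)) = 1 \<and> norm (b (X j)) = 1) \<and> Lbc (y, b) = lbc}"

definition regularized_modulus ::
  "real \<Rightarrow> real \<Rightarrow> real \<Rightarrow> real \<Rightarrow> (real \<Rightarrow> real \<Rightarrow> real) \<Rightarrow> bool" where
  "regularized_modulus c0 c1 c2 cuni m \<longleftrightarrow> (\<forall>\<delta>>0.
     (\<forall>x. m \<delta> differentiable at x) \<and> (\<forall>x. deriv (m \<delta>) differentiable at x) \<and>
     continuous_on UNIV (deriv (deriv (m \<delta>))) \<and>
     (\<forall>x. m \<delta> x \<ge> 0 \<and> m \<delta> x \<ge> c0 * \<delta> \<and> \<bar>deriv (m \<delta>) x\<bar> \<le> c1 \<and>
        \<bar>deriv (deriv (m \<delta>)) x\<bar> \<le> c2 / \<delta> \<and> \<bar>m \<delta> x - \<bar>x\<bar>\<bar> \<le> cuni * \<delta>))"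

text \<open>The arguments \<open>A\<close>, \<open>B\<close> stand for the squares \<open>\<alpha>\<^sup>2\<close>, \<open>\<beta>\<^sup>2\<close>.\<close>

definition psi :: "(real \<Rightarrow> real \<Rightarrow> real) \<Rightarrow> real \<Rightarrow> real \<Rightarrow> real \<Rightarrow> real" where
  "psi m \<delta> A B = m \<delta> (A - B) + 4 * B\<^sup>2 / (A + B + m \<delta> (A - B))"

definition E_disc ::
  "real \<Rightarrow> (curve \<times> curve \<Rightarrow> 'w) \<Rightarrow> 'w \<Rightarrow> (real \<Rightarrow> real \<Rightarrow> real) \<Rightarrow> real \<Rightarrow> real \<Rightarrow> real \<Rightarrow>
   nat \<Rightarrow> (nat \<Rightarrow> real) \<Rightarrow> curve \<times> curve \<Rightarrow> ennreal" where
  "E_disc L Lbc lbc m \<delta> \<epsilon>1 \<epsilon>2 N X = (\<lambda>(y, b).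
     if (y, b) \<in> discrete_admissible L Lbc lbc N X then
       ennreal (1 / 2) * (\<integral>\<^sup>+x. ennreal
          ((norm (wderiv L (cderiv L y) x))\<^sup>2 + 5 * (norm (wderiv L b x))\<^sup>2
           + psi m \<delta> ((norm (wderiv L (cderiv L y) x))\<^sup>2) ((norm (wderiv L b x))\<^sup>2)) \<partial>Om L)
       + ennreal (1 / (2 * \<epsilon>1)) * (\<integral>\<^sup>+x. ennreal ((cderiv L y x \<bullet> b x)\<^sup>2) \<partial>Om L)
       + ennreal (1 / (2 * \<epsilon>2)) * (\<integral>\<^sup>+x. ennreal ((cderiv L y x \<bullet> wderiv L b x)\<^sup>2) \<partial>Om L)
     else \<infinity>)"

end

(* Lower bound: along a sequence of bounded energy, evaluation of y' and b at a point and the L2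
   pairings with y'' and b' are continuous on V, so y', b converge pointwise and y'', b' weakly in L2.
   Hoelder continuity carries the unit length from the nodes to all of [0,L] as h -> 0; dominated
   convergence and weak-strong convergence turn the penalty terms into the exact constraints. The
   regularised density differs from the convex C1 function Qbar by O(delta), and Qbar is weakly lower
   semicontinuous by its subgradient inequality. The boundary operator factors through finitely many
   boundary values, hence is weakly continuous.

   Upper bound: for smooth admissible (y, b) take the cubic Hermite interpolant of y and the piecewise
   linear interpolant of b. They are exact at the nodes and O(h)-accurate in y', y'', b, b', so the
   penalty terms are O(h^2/eps1 + h^2/eps2). Density and a diagonal choice give the general case. Where
   the limit energy is infinite, the lower bound makes the constant sequence a recovery sequence. *)
theory Submission
  imports Defs
begin

section \<open>Square-integrable functions on an interval\<close>

text \<open>Derivatives are picked by \<open>SOME\<close>, so most statements about them hold only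
  almost everywhere and are transported through uniqueness. The tool is the primitive of an L2
  function: it yields the Hoelder bound, the continuous representative and, as half-lines generate
  the Borel sets, uniqueness itself. In the lower bound the delicate constraint is the twist, since
  it pairs y_n' with b_n', which converges only weakly. Testing with \<phi> y', where \<phi> = y' .
  b', turns the limit of the pairing into the integral of \<phi>^2. Lower semicontinuity needs
  convexity in both vectors jointly, hence a subgradient of (p, q) -> Qbar(|p|, |q|); its linear
  growth puts it into L2, so it is a legitimate test function. In the upper bound the interpolation
  constant depends on third derivatives of y and second derivatives of b, and the density assumption
  does not control these along the approximations. So h tends to 0 with the approximation fixed, and
  the approximation improves only afterwards, as slowly in h as this dependence demands.\<close>

locale bounded_interval =
  fixes L :: real
  assumes L_pos: "0 < L"
begin

section \<open>Integrability and the space \<open>L2\<close> on a bounded interval\<close>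

lemma Om_finite [simp, intro]: "finite_measure (Om L)"
  by (rule finite_measure_lebesgue_on) simp

lemma measure_Om [simp]: "measure (Om L) (space (Om L)) = L"
  using L_pos by (simp add: measure_restrict_space)

lemma AE_Om_I: "(\<And>x. x \<in> {0<..<L} \<Longrightarrow> P x) \<Longrightarrow> AE x in Om L. P x"
  by (rule AE_I2) auto

lemma integrable_Om_bounded:
  fixes f :: "real \<Rightarrow> 'a::euclidean_space"
  assumes "f \<in> borel_measurable (Om L)" "\<And>x. x \<in> {0<..<L} \<Longrightarrow> norm (f x) \<le> B"
  shows "integrable (Om L) f"
  by (rule finite_measure.integrable_const_bound[OF Om_finite AE_Om_I[OF assms(2)] assms(1)])

lemma measurable_Om_continuous:
  fixes f :: "real \<Rightarrow> 'a::euclidean_space"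
  assumes "continuous_on {0..L} f"
  shows "f \<in> borel_measurable (Om L)"
proof (rule continuous_imp_measurable_on_sets_lebesgue)
  show "continuous_on {0<..<L} f"
    using assms by (rule continuous_on_subset) auto
qed auto

lemma continuous_bound:
  fixes f :: "real \<Rightarrow> 'a::euclidean_space"
  assumes "continuous_on {0..L} f"
  obtains B where "B \<ge> 0" "\<And>x. x \<in> {0..L} \<Longrightarrow> norm (f x) \<le> B"
proof -
  have "bounded (f ` {0..L})"
    using assms compact_continuous_image compact_imp_bounded by blast
  then obtain B where B: "\<forall>x\<in>{0..L}. norm (f x) \<le> B"
    by (auto simp: bounded_iff)
  have "0 \<le> B" using B[rule_format, of 0] L_pos norm_ge_zero[of "f 0"]
    by (simp only: atLeastAtMost_iff) linarith
  with B that show ?thesis by blast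
qed

lemma integrable_Om_continuous:
  fixes f :: "real \<Rightarrow> 'a::euclidean_space"
  assumes "continuous_on {0..L} f"
  shows "integrable (Om L) f"
proof -
  obtain B where "\<And>x. x \<in> {0..L} \<Longrightarrow> norm (f x) \<le> B"
    using assms continuous_bound by blast
  then show ?thesis
    by (intro integrable_Om_bounded[where B=B] measurable_Om_continuous assms) auto
qed

lemma L2_measurable [measurable_dest]: "g \<in> L2 L \<Longrightarrow> g \<in> borel_measurable (Om L)"
  by (simp add: L2_def)

lemma L2_integrable_square: "g \<in> L2 L \<Longrightarrow> integrable (Om L) (\<lambda>x. (norm (g x))\<^sup>2)"
  by (simp add: L2_def)

lemma L2_bounded:
  fixes f :: "real \<Rightarrow> 'a::euclidean_space"
  assumes [measurable]: "f \<in> borel_measurable (Om L)" and B: "\<And>x. x \<in> {0<..<L} \<Longrightarrow> norm (f x) \<le> B"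
  shows "f \<in> L2 L"
proof -
  have "integrable (Om L) (\<lambda>x. (norm (f x))\<^sup>2)"
    using B by (intro integrable_Om_bounded[where B="B\<^sup>2"]) (auto intro!: power_mono)
  then show ?thesis by (simp add: L2_def)
qed

lemma L2_continuous:
  fixes f :: "real \<Rightarrow> 'a::euclidean_space"
  assumes "continuous_on {0..L} f"
  shows "f \<in> L2 L"
proof -
  obtain B where "\<And>x. x \<in> {0..L} \<Longrightarrow> norm (f x) \<le> B"
    using assms continuous_bound by blast
  then show ?thesis
    by (intro L2_bounded[where B=B] measurable_Om_continuous assms) auto
qed

lemma L2_norm_product_integrable:
  fixes f :: "real \<Rightarrow> 'a::euclidean_space" and g :: "real \<Rightarrow> 'b::euclidean_space"
  assumes f: "f \<in> L2 L" and g: "g \<in> L2 L"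
  shows "integrable (Om L) (\<lambda>x. norm (f x) * norm (g x))"
proof (rule Bochner_Integration.integrable_bound)
  show "integrable (Om L) (\<lambda>x. (norm (f x))\<^sup>2 + (norm (g x))\<^sup>2)"
    using f g by (intro Bochner_Integration.integrable_add L2_integrable_square)
  show "(\<lambda>x. norm (f x) * norm (g x)) \<in> borel_measurable (Om L)"
    using f[THEN L2_measurable] g[THEN L2_measurable] by measurable
  have "norm (norm a * norm b) \<le> norm ((norm a)\<^sup>2 + (norm b)\<^sup>2)" for a :: 'a and b :: 'b
  proof -
    have "0 \<le> norm a * norm b" "2 * (norm a * norm b) \<le> (norm a)\<^sup>2 + (norm b)\<^sup>2"
      using sum_squares_bound[of "norm a" "norm b"] by (simp_all add: mult.assoc)
    then have "norm a * norm b \<le> (norm a)\<^sup>2 + (norm b)\<^sup>2" by linarith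
    then show ?thesis by simp
  qed
  then show "AE x in Om L. norm (norm (f x) * norm (g x)) \<le> norm ((norm (f x))\<^sup>2 + (norm (g x))\<^sup>2)"
    by simp
qed

lemma L2_inner_integrable:
  fixes f g :: "real \<Rightarrow> 'a::euclidean_space"
  assumes f: "f \<in> L2 L" and g: "g \<in> L2 L"
  shows "integrable (Om L) (\<lambda>x. f x \<bullet> g x)"
  using L2_norm_product_integrable[OF f g]
  by (rule Bochner_Integration.integrable_bound)
     (use f[THEN L2_measurable] g[THEN L2_measurable] in \<open>simp_all add: Cauchy_Schwarz_ineq2\<close>)

lemma L2_const: "(\<lambda>x. c) \<in> L2 L"
  by (rule L2_continuous) auto

lemma L2_integrable:
  fixes f :: "real \<Rightarrow> 'a::euclidean_space"
  assumes f: "f \<in> L2 L"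
  shows "integrable (Om L) f"
  using L2_norm_product_integrable[OF f L2_const[of "1::real"]]
  by (rule Bochner_Integration.integrable_bound) (use f[THEN L2_measurable] in simp_all)

lemma L2_add:
  fixes f g :: "real \<Rightarrow> 'a::euclidean_space"
  assumes f: "f \<in> L2 L" and g: "g \<in> L2 L"
  shows "(\<lambda>x. f x + g x) \<in> L2 L"
proof -
  have "integrable (Om L) (\<lambda>x. f x \<bullet> f x + 2 * (f x \<bullet> g x) + g x \<bullet> g x)"
    using f g by (intro Bochner_Integration.integrable_add integrable_mult_right L2_inner_integrable)
  moreover have "f x \<bullet> f x + 2 * (f x \<bullet> g x) + g x \<bullet> g x = (norm (f x + g x))\<^sup>2" for x
    by (simp add: power2_norm_eq_inner inner_add inner_commute)
  ultimately show ?thesis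
    using f[THEN L2_measurable] g[THEN L2_measurable] unfolding L2_def by simp
qed

lemma L2_scaleR:
  fixes f :: "real \<Rightarrow> 'a::euclidean_space"
  assumes f: "f \<in> L2 L"
  shows "(\<lambda>x. r *\<^sub>R f x) \<in> L2 L"
proof -
  have "integrable (Om L) (\<lambda>x. r\<^sup>2 * (norm (f x))\<^sup>2)"
    using f by (intro integrable_mult_right L2_integrable_square)
  moreover have "r\<^sup>2 * (norm (f x))\<^sup>2 = (norm (r *\<^sub>R f x))\<^sup>2" for x
    by (simp add: power_mult_distrib)
  ultimately show ?thesis using f[THEN L2_measurable] unfolding L2_def by simp
qed

lemma L2_diff:
  fixes f g :: "real \<Rightarrow> 'a::euclidean_space"
  assumes f: "f \<in> L2 L" and g: "g \<in> L2 L"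
  shows "(\<lambda>x. f x - g x) \<in> L2 L"
  using L2_add[OF f L2_scaleR[OF g, of "-1"]] by simp

lemma L2_norm_nonneg [simp]: "0 \<le> L2_norm L f"
  by (simp add: L2_norm_def)

lemma L2_norm_power2: "(L2_norm L f)\<^sup>2 = (LINT x|Om L. (norm (f x))\<^sup>2)"
  by (simp add: L2_norm_def)

lemma L2_norm_cong_AE:
  fixes f g :: "real \<Rightarrow> 'a::euclidean_space"
  assumes "f \<in> L2 L" "g \<in> L2 L" "AE x in Om L. f x = g x"
  shows "L2_norm L f = L2_norm L g"
proof -
  note [measurable] = assms(1,2)[THEN L2_measurable]
  have "(LINT x|Om L. (norm (f x))\<^sup>2) = (LINT x|Om L. (norm (g x))\<^sup>2)"
    using assms(3) by (intro integral_cong_AE) auto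
  then show ?thesis by (simp add: L2_norm_def)
qed

text \<open>The extended nonnegative form of the inequality, brought back to the reals:
  integrability of the product makes the left side a real number, and a square root is taken at the
  end.\<close>

lemma L2_Cauchy_Schwarz_norm:
  fixes f :: "real \<Rightarrow> 'a::euclidean_space" and g :: "real \<Rightarrow> 'b::euclidean_space"
  assumes f: "f \<in> L2 L" and g: "g \<in> L2 L"
  shows "(LINT x|Om L. norm (f x) * norm (g x)) \<le> L2_norm L f * L2_norm L g"
proof -
  note [measurable] = f[THEN L2_measurable] g[THEN L2_measurable]
  let ?P = "LINT x|Om L. norm (f x) * norm (g x)"
  have P0: "0 \<le> ?P" by simp
  have eqs: "(\<integral>\<^sup>+x. ennreal (norm (f x)) * ennreal (norm (g x)) \<partial>Om L) = ennreal ?P"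
    using nn_integral_eq_integral[OF L2_norm_product_integrable[OF f g]]
    by (simp add: ennreal_mult)
  have sq: "(\<integral>\<^sup>+x. (ennreal (norm (k x)))\<^sup>2 \<partial>Om L) = ennreal ((L2_norm L k)\<^sup>2)"
    if "k \<in> L2 L" for k :: "real \<Rightarrow> 'c::euclidean_space"
    using nn_integral_eq_integral[OF L2_integrable_square[OF that]]
    by (simp add: ennreal_power L2_norm_power2)
  have "(ennreal ?P)\<^sup>2 \<le> ennreal ((L2_norm L f)\<^sup>2) * ennreal ((L2_norm L g)\<^sup>2)"
    using Cauchy_Schwarz_nn_integral[of "\<lambda>x. ennreal (norm (f x))" "Om L" "\<lambda>x. ennreal (norm (g x))"]
    unfolding eqs sq[OF f] sq[OF g] by simp
  then have "ennreal (?P\<^sup>2) \<le> ennreal ((L2_norm L f * L2_norm L g)\<^sup>2)"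
    using P0 by (simp add: ennreal_power power_mult_distrib flip: ennreal_mult)
  then have "?P\<^sup>2 \<le> (L2_norm L f * L2_norm L g)\<^sup>2"
    by simp
  then show ?thesis by (rule power2_le_imp_le) simp
qed

lemma L2_Cauchy_Schwarz:
  fixes f g :: "real \<Rightarrow> 'a::euclidean_space"
  assumes f: "f \<in> L2 L" and g: "g \<in> L2 L"
  shows "\<bar>LINT x|Om L. f x \<bullet> g x\<bar> \<le> L2_norm L f * L2_norm L g"
proof -
  have "\<bar>LINT x|Om L. f x \<bullet> g x\<bar> \<le> (LINT x|Om L. \<bar>f x \<bullet> g x\<bar>)"
    by (rule integral_abs_bound)
  also have "\<dots> \<le> (LINT x|Om L. norm (f x) * norm (g x))"
    using f g
    by (intro integral_mono L2_norm_product_integrable integrable_abs L2_inner_integrable)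
       (auto simp: Cauchy_Schwarz_ineq2)
  also have "\<dots> \<le> L2_norm L f * L2_norm L g"
    by (rule L2_Cauchy_Schwarz_norm[OF f g])
  finally show ?thesis .
qed

text \<open>The measure lives on \<open>(0,L)\<close>, so this is the integral over \<open>(0,x)\<close> for \<open>x \<in> [0,L]\<close>.\<close>

definition primitive :: "(real \<Rightarrow> 'a::euclidean_space) \<Rightarrow> real \<Rightarrow> 'a" where
  "primitive g x = (LINT t|Om L. indicat_real {..<x} t *\<^sub>R g t)"

section \<open>Primitives as indicator integrals and their Hoelder bound\<close>

lemma integrable_indicator_Om:
  fixes g :: "real \<Rightarrow> 'a::euclidean_space"
  assumes g: "integrable (Om L) g" and A: "A \<in> sets borel"
  shows "integrable (Om L) (\<lambda>t. indicat_real A t *\<^sub>R g t)"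
proof -
  have [measurable]: "(indicat_real A) \<in> borel_measurable (Om L)"
    using A by (simp add: measurable_restrict_space1 measurable_completion)
  show ?thesis
    by (rule Bochner_Integration.integrable_bound[OF g])
       (use borel_measurable_integrable[OF g] in \<open>auto simp: indicator_def[abs_def, symmetric] split: split_indicator\<close>)
qed

text \<open>Bridge from the Lebesgue integral over (0,L) to the gauge integral over [s,t], where the
  fundamental theorem of calculus is available. Within (0,L) the set \<open>A\<close> may differ
  from the open interval at \<open>s\<close> and \<open>t\<close>, so one lemma serves
  \<open>{..<x}\<close>, \<open>{t<..}\<close> and \<open>{s..<t}\<close>.\<close>

lemma integral_indicator_Om:
  fixes g :: "real \<Rightarrow> 'a::euclidean_space"
  assumes g: "integrable (Om L) g" and A: "A \<in> sets borel"
    and st: "0 \<le> s" "s \<le> t" "t \<le> L" "A \<inter> {0<..<L} - {s,t} = {s<..<t}"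
  shows "(g has_integral (LINT x|Om L. indicat_real A x *\<^sub>R g x)) {s..t}"
proof -
  have "((\<lambda>x. indicat_real A x *\<^sub>R g x) has_integral (LINT x|Om L. indicat_real A x *\<^sub>R g x)) {0<..<L}"
    by (rule has_integral_integral_lebesgue_on) (use integrable_indicator_Om[OF g A] in auto)
  moreover have "(\<lambda>x. indicat_real A x *\<^sub>R g x) = (\<lambda>x. if x \<in> A then g x else 0)"
    by (auto simp: indicator_def)
  ultimately have *: "(g has_integral (LINT x|Om L. indicat_real A x *\<^sub>R g x)) (A \<inter> {0<..<L})"
    by (simp add: has_integral_restrict_Int)
  have "(g has_integral (LINT x|Om L. indicat_real A x *\<^sub>R g x)) {s<..<t}"
  proof (rule iffD1[OF has_integral_spike_set_eq *])
    have sub: "A \<inter> {0<..<L} - {s<..<t} \<subseteq> {s,t}" "{s<..<t} - A \<inter> {0<..<L} \<subseteq> {s,t}"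
      using st(4) by blast+
    show "negligible {x \<in> A \<inter> {0<..<L} - {s<..<t}. g x \<noteq> 0}"
      by (rule negligible_subset[of "{s,t}"]) (use sub(1) in auto)
    show "negligible {x \<in> {s<..<t} - A \<inter> {0<..<L}. g x \<noteq> 0}"
      by (rule negligible_subset[of "{s,t}"]) (use sub(2) in auto)
  qed
  then show ?thesis by (simp add: has_integral_Icc_iff_Ioo)
qed

lemma primitive_has_integral:
  fixes g :: "real \<Rightarrow> 'a::euclidean_space"
  assumes "integrable (Om L) g" "0 \<le> x" "x \<le> L"
  shows "(g has_integral primitive g x) {0..x}"
  unfolding primitive_def by (rule integral_indicator_Om) (use assms in auto)

lemma primitive_continuous:
  fixes g :: "real \<Rightarrow> 'a::euclidean_space"
  assumes "integrable (Om L) g"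
  shows "continuous_on {0..L} (primitive g)"
proof -
  have "g integrable_on {0..L}"
    using primitive_has_integral[OF assms, of L] L_pos by auto
  then have "continuous_on {0..L} (\<lambda>x. integral {0..x} g)"
    by (rule indefinite_integral_continuous_1)
  then show ?thesis
    by (rule continuous_on_eq)
       (use assms primitive_has_integral in \<open>auto intro!: integral_unique\<close>)
qed

lemma primitive_0 [simp]: "primitive g 0 = 0"
proof -
  have "primitive g 0 = (LINT t|Om L. 0)"
    unfolding primitive_def by (rule Bochner_Integration.integral_cong) auto
  then show ?thesis by simp
qed

lemma primitive_diff:
  fixes g :: "real \<Rightarrow> 'a::euclidean_space"
  assumes g: "integrable (Om L) g" and "s \<le> t"
  shows "primitive g t - primitive g s = (LINT x|Om L. indicat_real {s..<t} x *\<^sub>R g x)"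
proof -
  have "primitive g t - primitive g s
    = (LINT x|Om L. indicat_real {..<t} x *\<^sub>R g x - indicat_real {..<s} x *\<^sub>R g x)"
    unfolding primitive_def
    by (rule Bochner_Integration.integral_diff[symmetric]) (use g in \<open>auto intro: integrable_indicator_Om\<close>)
  also have "\<dots> = (LINT x|Om L. indicat_real {s..<t} x *\<^sub>R g x)"
    by (rule Bochner_Integration.integral_cong) (use assms in \<open>auto simp: indicator_def\<close>)
  finally show ?thesis .
qed

text \<open>Cauchy-Schwarz against the indicator of [s,t), whose L2 norm is the square root of the
  length.\<close>

lemma primitive_Hoelder:
  fixes g :: "real \<Rightarrow> 'a::euclidean_space"
  assumes g: "g \<in> L2 L" and st: "0 \<le> s" "s \<le> t" "t \<le> L"
  shows "norm (primitive g t - primitive g s) \<le> sqrt (t - s) * L2_norm L g"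
proof -
  let ?i = "indicat_real {s..<t}"
  have [measurable]: "?i \<in> borel_measurable (Om L)"
    by (simp add: measurable_restrict_space1 measurable_completion)
  have i: "?i \<in> L2 L"
    by (rule L2_bounded[where B=1]) (auto simp: indicator_def)
  have "(LINT x|Om L. (norm (?i x))\<^sup>2) = (LINT x|Om L. ?i x *\<^sub>R (1::real))"
    by (rule Bochner_Integration.integral_cong) (auto simp: indicator_def)
  moreover have "((\<lambda>x. 1::real) has_integral (LINT x|Om L. ?i x *\<^sub>R (1::real))) {s..t}"
    by (rule integral_indicator_Om) (use st L2_const[THEN L2_integrable] in auto)
  moreover have "((\<lambda>x. 1::real) has_integral (t - s)) {s..t}"
    using has_integral_const_real[of "1::real" s t] st by simp
  ultimately have "(LINT x|Om L. (norm (?i x))\<^sup>2) = t - s"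
    using has_integral_unique by metis
  then have n: "L2_norm L ?i = sqrt (t - s)" by (simp add: L2_norm_def)
  have "norm (primitive g t - primitive g s) \<le> (LINT x|Om L. norm (?i x *\<^sub>R g x))"
    using primitive_diff[OF L2_integrable[OF g] st(2)] integral_norm_bound by metis
  also have "\<dots> = (LINT x|Om L. norm (?i x) * norm (g x))" by simp
  also have "\<dots> \<le> sqrt (t - s) * L2_norm L g"
    using L2_Cauchy_Schwarz_norm[OF i g] n by simp
  finally show ?thesis .
qed

section \<open>Weak derivatives and primitives\<close>

lemma test_function_props:
  assumes "\<phi> \<in> test_functions L"
  shows "continuous_on UNIV (deriv \<phi>)" "continuous_on UNIV \<phi>" "\<phi> 0 = 0" "\<phi> L = 0"
    "\<And>s t. s \<le> t \<Longrightarrow> (deriv \<phi> has_integral \<phi> t - \<phi> s) {s..t}"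
proof -
  have d: "\<And>x. \<phi> differentiable at x" and "continuous_on UNIV (deriv \<phi>)"
    using assms by (auto simp: test_functions_def)
  obtain a b where ab: "0 < a" "b < L" "\<And>x. x \<notin> {a..b} \<Longrightarrow> \<phi> x = 0"
    using assms by (auto simp: test_functions_def)
  show "continuous_on UNIV (deriv \<phi>)" by fact
  have D: "(\<phi> has_real_derivative deriv \<phi> x) (at x)" for x
    using d DERIV_deriv_iff_real_differentiable by blast
  show "continuous_on UNIV \<phi>"
    using D DERIV_continuous_on by (metis DERIV_isCont continuous_at_imp_continuous_on)
  show "\<phi> 0 = 0" "\<phi> L = 0" using ab by auto
  show "(deriv \<phi> has_integral \<phi> t - \<phi> s) {s..t}" if "s \<le> t" for s t
    using that D
    by (intro fundamental_theorem_of_calculus)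
       (auto simp: has_real_derivative_iff_has_vector_derivative intro: has_vector_derivative_at_within)
qed

text \<open>The inner integral that Fubini produces below: only the value at t survives, because
  \<phi> vanishes at L.\<close>

lemma integral_indicator_deriv_test:
  assumes \<phi>: "\<phi> \<in> test_functions L" and t: "t \<in> {0<..<L}"
  shows "(LINT x|Om L. indicat_real {t<..} x * deriv \<phi> x) = - \<phi> t"
proof -
  note p = test_function_props[OF \<phi>]
  have "integrable (Om L) (deriv \<phi>)"
    by (rule integrable_Om_continuous) (rule continuous_on_subset[OF p(1)], simp)
  then have "(deriv \<phi> has_integral (LINT x|Om L. indicat_real {t<..} x *\<^sub>R deriv \<phi> x)) {t..L}"
    by (rule integral_indicator_Om) (use t in auto)
  moreover have "(deriv \<phi> has_integral \<phi> L - \<phi> t) {t..L}"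
    using t by (intro p(5)) auto
  ultimately have "(LINT x|Om L. indicat_real {t<..} x *\<^sub>R deriv \<phi> x) = \<phi> L - \<phi> t"
    by (rule has_integral_unique)
  then show ?thesis using p(4) by simp
qed

text \<open>Fubini on the triangle t < x: inserting the integral for the primitive and swapping the
  order leaves the integral of \<open>deriv \<phi>\<close> over (t,L), which is -\<phi>(t). No
  pointwise derivative of the primitive is used. The constant \<open>c\<close> drops out since
  \<phi> vanishes at both ends.\<close>

lemma weak_derivative_primitive:
  fixes g :: "real \<Rightarrow> 'a::euclidean_space"
  assumes g: "integrable (Om L) g" and u: "\<And>x. x \<in> {0..L} \<Longrightarrow> u x = c + primitive g x"
  shows "weak_derivative L u g"
  unfolding weak_derivative_def
proof
  fix \<phi> assume \<phi>: "\<phi> \<in> test_functions L"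
  note p = test_function_props[OF \<phi>]
  have d\<phi>: "continuous_on {0..L} (deriv \<phi>)" and c\<phi>: "continuous_on {0..L} \<phi>"
    using p(1,2) continuous_on_subset by blast+
  obtain B where B: "B \<ge> 0" "\<And>x. x \<in> {0..L} \<Longrightarrow> norm (deriv \<phi> x) \<le> B"
    using continuous_bound[OF d\<phi>] by blast
  note [measurable] = borel_measurable_integrable[OF g] measurable_Om_continuous[OF d\<phi>]
    measurable_Om_continuous[OF c\<phi>]
  interpret M: finite_measure "Om L" by simp
  interpret P: pair_sigma_finite "Om L" "Om L" by standard
  \<comment> \<open>The integrand on the square, cut off to t < x. It is dominated by
    \<open>B * norm (g t)\<close>, which gives joint integrability.\<close>
  define k :: "real \<Rightarrow> real \<Rightarrow> 'a" where
    "k t x = (deriv \<phi> x * (if t < x then 1 else 0)) *\<^sub>R g t" for t x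
  have [measurable]: "(\<lambda>x. x) \<in> borel_measurable (Om L)"
    by (rule measurable_Om_continuous) simp
  have km: "case_prod k \<in> borel_measurable (Om L \<Otimes>\<^sub>M Om L)"
    unfolding k_def by measurable
  have km': "k t \<in> borel_measurable (Om L)" for t
    unfolding k_def by measurable
  have kb: "norm (k t x) \<le> B * norm (g t)" if "x \<in> {0<..<L}" for t x
    using B(2)[of x] that B(1) by (auto simp: k_def intro!: mult_right_mono)
  have kx: "integrable (Om L) (k t)" if "t \<in> {0<..<L}" for t
    using kb by (intro integrable_Om_bounded[where B="B * norm (g t)"] km') auto
  have kint: "integrable (Om L \<Otimes>\<^sub>M Om L) (case_prod k)"
  proof (rule P.Fubini_integrable[OF km])
    have m: "(\<lambda>t. LINT x|Om L. norm (case_prod k (t, x))) \<in> borel_measurable (Om L)"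
      using km by measurable
    show "integrable (Om L) (\<lambda>t. LINT x|Om L. norm (case_prod k (t, x)))"
    proof (rule Bochner_Integration.integrable_bound[OF _ m])
      show "integrable (Om L) (\<lambda>t. L * B * norm (g t))"
        using g by simp
      show "AE t in Om L. norm (LINT x|Om L. norm (case_prod k (t, x))) \<le> norm (L * B * norm (g t))"
      proof (rule AE_Om_I)
        fix t assume t: "t \<in> {0<..<L}"
        have "(LINT x|Om L. norm (k t x)) \<le> (LINT x|Om L. B * norm (g t))"
          using kb kx[OF t] by (intro integral_mono) (auto intro: L2_integrable[OF L2_const])
        also have "\<dots> = L * B * norm (g t)" using measure_Om by simp
        finally show "norm (LINT x|Om L. norm (case_prod k (t, x))) \<le> norm (L * B * norm (g t))"
          by (simp add: abs_of_nonneg)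
      qed
    qed
    show "AE t in Om L. integrable (Om L) (\<lambda>x. case_prod k (t, x))"
      using kx by (intro AE_Om_I) simp
  qed
  have "(LINT x|Om L. deriv \<phi> x *\<^sub>R u x) = (LINT x|Om L. deriv \<phi> x *\<^sub>R c + (LINT t|Om L. k t x))"
  proof (rule Bochner_Integration.integral_cong)
    fix x assume "x \<in> space (Om L)"
    then have "u x = c + primitive g x" using u by auto
    moreover have "(LINT t|Om L. k t x) = deriv \<phi> x *\<^sub>R primitive g x"
      unfolding primitive_def
      by (subst integral_scaleR_right[symmetric])
         (auto simp: k_def intro!: Bochner_Integration.integral_cong)
    ultimately show "deriv \<phi> x *\<^sub>R u x = deriv \<phi> x *\<^sub>R c + (LINT t|Om L. k t x)"
      by (simp add: scaleR_add_right)
  qed simp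
  also have "\<dots> = (LINT x|Om L. deriv \<phi> x *\<^sub>R c) + (LINT x|Om L. LINT t|Om L. k t x)"
    by (rule Bochner_Integration.integral_add)
       (use integrable_Om_continuous[OF d\<phi>] P.integrable_snd[OF kint] in auto)
  also have "(LINT x|Om L. deriv \<phi> x *\<^sub>R c) = 0"
  proof -
    have "(deriv \<phi> has_integral integral\<^sup>L (Om L) (deriv \<phi>)) {0<..<L}"
      by (rule has_integral_integral_lebesgue_on) (use integrable_Om_continuous[OF d\<phi>] in auto)
    moreover have "(deriv \<phi> has_integral \<phi> L - \<phi> 0) {0..L}"
      using L_pos by (intro p(5)) auto
    then have "(deriv \<phi> has_integral \<phi> L - \<phi> 0) {0<..<L}"
      by (simp only: has_integral_Icc_iff_Ioo)
    ultimately have "integral\<^sup>L (Om L) (deriv \<phi>) = \<phi> L - \<phi> 0"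
      by (rule has_integral_unique)
    then show ?thesis using integrable_Om_continuous[OF d\<phi>] p(3,4) by simp
  qed
  also have "(LINT x|Om L. LINT t|Om L. k t x) = (LINT t|Om L. LINT x|Om L. k t x)"
    by (rule P.Fubini_integral[OF kint])
  also have "\<dots> = (LINT t|Om L. - (\<phi> t *\<^sub>R g t))"
  proof (rule Bochner_Integration.integral_cong)
    fix t assume "t \<in> space (Om L)"
    then have t: "t \<in> {0<..<L}" by simp
    have "integrable (Om L) (\<lambda>x. indicat_real {t<..} x *\<^sub>R deriv \<phi> x)"
      by (rule integrable_indicator_Om) (use integrable_Om_continuous[OF d\<phi>] in auto)
    then have "(LINT x|Om L. (indicat_real {t<..} x * deriv \<phi> x) *\<^sub>R g t)
        = (LINT x|Om L. indicat_real {t<..} x * deriv \<phi> x) *\<^sub>R g t"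
      by (intro integral_scaleR_left) simp
    moreover have "k t = (\<lambda>x. (indicat_real {t<..} x * deriv \<phi> x) *\<^sub>R g t)"
      by (auto simp: k_def fun_eq_iff)
    ultimately have "(LINT x|Om L. k t x) = (LINT x|Om L. indicat_real {t<..} x * deriv \<phi> x) *\<^sub>R g t"
      by simp
    then show "(LINT x|Om L. k t x) = - (\<phi> t *\<^sub>R g t)"
      using integral_indicator_deriv_test[OF \<phi> t] by simp
  qed simp
  finally show "(LINT x|Om L. deriv \<phi> x *\<^sub>R u x) = - (LINT x|Om L. \<phi> x *\<^sub>R g x)"
    by simp
qed

text \<open>If \<open>\<eta>\<close> is a cutoff supported in \<open>[a,b]\<close> and \<open>c\<close> the \<open>\<eta>\<close>-weighted mean of \<open>w\<close>, then
  \<open>\<eta> (w - c)\<close> has mean zero, hence is the derivative of a test function; testing with it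
  gives \<open>\<integral> \<eta> (w - c)\<^sup>2 = 0\<close>.\<close>

lemma du_Bois_Reymond_aux:
  fixes w :: "real \<Rightarrow> real"
  assumes w: "continuous_on {0..L} w" and wd: "weak_derivative L w (\<lambda>_. 0)" and ab: "0 < a" "a < b" "b < L"
  obtains c where "\<And>x. x \<in> {a<..<b} \<Longrightarrow> w x = c"
proof -
  \<comment> \<open>Continuous and positive exactly on (a,b). This is smooth enough: the test
    function is a primitive of a multiple of \<eta>, and test functions are only C1.\<close>
  define \<eta> where "\<eta> x = max 0 ((x - a) * (b - x))" for x :: real
  have \<eta>c: "continuous_on A \<eta>" for A
    unfolding \<eta>_def by (intro continuous_intros)
  have \<eta>0: "\<eta> x = 0" if "x \<notin> {a<..<b}" for x
  proof -
    have "x \<le> a \<and> x \<le> b \<or> a \<le> x \<and> b \<le> x" using that ab by auto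
    then have "(x - a) * (b - x) \<le> 0"
      by (auto intro: mult_nonpos_nonneg mult_nonneg_nonpos)
    then show ?thesis by (simp add: \<eta>_def)
  qed
  have \<eta>p: "\<eta> x > 0" if "x \<in> {a<..<b}" for x
    using that by (auto simp: \<eta>_def)
  have \<eta>n: "\<eta> x \<ge> 0" for x by (simp add: \<eta>_def)
  have wab: "continuous_on {a..b} w"
    using w ab by (auto elim: continuous_on_subset)
  have int\<eta>: "integral {a..b} \<eta> > 0"
  proof -
    have "integral {a..b} \<eta> \<noteq> 0"
      using integral_eq_0_iff[of a b \<eta>] \<eta>c \<eta>n ab \<eta>p[of "(a+b)/2"] by force
    moreover have "integral {a..b} \<eta> \<ge> 0"
      by (rule Henstock_Kurzweil_Integration.integral_nonneg[OF integrable_continuous_real[OF \<eta>c]]) (rule \<eta>n)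
    ultimately show ?thesis by simp
  qed
  define c where "c = integral {a..b} (\<lambda>x. \<eta> x * w x) / integral {a..b} \<eta>"
  \<comment> \<open>\<open>w\<close> is continuous only on [0,L], while a test function must be
    differentiable on the whole line; hence the argument is clamped to [a,b].\<close>
  define w' where "w' x = w (min b (max a x))" for x
  have w'c: "continuous_on A w'" for A
    unfolding w'_def using ab
    by (intro continuous_on_compose2[OF wab]) (auto intro!: continuous_intros)
  define \<psi> where "\<psi> x = \<eta> x * (w' x - c)" for x
  have \<psi>c: "continuous_on A \<psi>" for A
    unfolding \<psi>_def by (intro continuous_intros \<eta>c w'c)
  have \<psi>0: "\<psi> x = 0" if "x \<notin> {a<..<b}" for x
    using \<eta>0[OF that] by (simp add: \<psi>_def)
  have \<psi>w: "\<psi> x = \<eta> x * (w x - c)" for x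
    using \<eta>0[of x] by (cases "x \<in> {a<..<b}") (auto simp: \<psi>_def w'_def)
  have int\<psi>: "integral {a..b} \<psi> = 0"
  proof -
    have "integral {a..b} \<psi> = integral {a..b} (\<lambda>x. \<eta> x * w x - c * \<eta> x)"
      by (intro integral_cong) (simp add: \<psi>w algebra_simps)
    also have "\<dots> = integral {a..b} (\<lambda>x. \<eta> x * w x) - c * integral {a..b} \<eta>"
      by (subst Henstock_Kurzweil_Integration.integral_diff)
         (auto intro!: integrable_continuous_real continuous_intros \<eta>c wab)
    also have "\<dots> = 0" using int\<eta> by (simp add: c_def)
    finally show ?thesis .
  qed
  \<comment> \<open>Integrating from 0 or from a is the same, as \<psi> vanishes in between;
    vanishing beyond b is the mean-zero property of \<psi>.\<close>
  define \<phi> where "\<phi> x = (if x < 0 then 0 else integral {0..x} \<psi>)" for x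
  have \<psi>int: "\<psi> integrable_on {s..t}" for s t
    by (rule integrable_continuous_real[OF \<psi>c])
  have out: "\<phi> x = 0" if "x \<notin> {a..b}" for x
  proof (cases "x < a")
    case True
    have "integral {0..x} \<psi> = integral {0..x} (\<lambda>_. 0)"
      by (rule integral_cong) (use True \<psi>0 in auto)
    then show ?thesis by (simp add: \<phi>_def)
  next
    case False
    then have x: "b < x" "0 \<le> x" using that ab by auto
    have "integral {0..x} \<psi> = integral {0..a} \<psi> + (integral {a..b} \<psi> + integral {b..x} \<psi>)"
      using x ab \<psi>int by (simp add: Henstock_Kurzweil_Integration.integral_combine)
    also have "integral {0..a} \<psi> = integral {0..a} (\<lambda>_. 0)"
      by (rule integral_cong) (use \<psi>0 in auto)
    also have "integral {b..x} \<psi> = integral {b..x} (\<lambda>_. 0)"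
      by (rule integral_cong) (use \<psi>0 in auto)
    finally show ?thesis using int\<psi> x by (simp add: \<phi>_def)
  qed
  \<comment> \<open>Left of a the function is locally 0; from a on the point is positive, and the
    derivative of the indefinite integral applies.\<close>
  have D: "(\<phi> has_real_derivative \<psi> x) (at x)" for x
  proof (cases "x < a")
    case True
    have "(\<phi> has_real_derivative 0) (at x)"
      by (rule DERIV_cong_ev[THEN iffD2, OF refl _ refl DERIV_const[of 0]])
         (use True out in \<open>auto intro!: eventually_mono[OF order_tendstoD(2)[OF tendsto_ident_at]] simp: eventually_nhds intro!: exI[of _ "{..<a}"]\<close>)
    then show ?thesis using \<psi>0[of x] True by simp
  next
    case False
    have "((\<lambda>x. integral {0..x} \<psi>) has_real_derivative \<psi> x) (at x within {0..x+1})"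
      using integral_has_real_derivative[OF \<psi>c[of "{0..x+1}"], of x] False ab by auto
    then have "((\<lambda>x. integral {0..x} \<psi>) has_real_derivative \<psi> x) (at x)"
      using False ab at_within_Icc_at[of 0 x "x+1"] by simp
    then show ?thesis
      by (rule DERIV_cong_ev[THEN iffD2, OF refl _ refl, rotated])
         (use False ab in \<open>auto simp: eventually_nhds \<phi>_def intro!: exI[of _ "{0<..}"]\<close>)
  qed
  then have dd: "deriv \<phi> = \<psi>" by (auto intro: DERIV_imp_deriv)
  have "\<phi> \<in> test_functions L"
    unfolding test_functions_def mem_Collect_eq dd
    using D \<psi>c out ab by (auto simp: real_differentiable_def)
  then have "(LINT x|Om L. \<psi> x * w x) = 0"
    using wd unfolding weak_derivative_def by (fastforce simp: dd)
  moreover have "continuous_on {0..L} (\<lambda>x. \<psi> x * w x)"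
    by (intro continuous_intros \<psi>c w)
  then have "((\<lambda>x. \<psi> x * w x) has_integral (LINT x|Om L. \<psi> x * w x)) {0<..<L}"
    by (intro has_integral_integral_lebesgue_on integrable_Om_continuous) auto
  ultimately have h0: "((\<lambda>x. \<psi> x * w x) has_integral 0) {0<..<L}" by simp
  have h1: "((\<lambda>x. \<psi> x * w x) has_integral 0) {a..b}"
  proof (rule iffD1[OF has_integral_spike_set_eq h0])
    show "negligible {x \<in> {0<..<L} - {a..b}. \<psi> x * w x \<noteq> 0}"
      by (rule negligible_subset[of "{}"]) (use \<psi>0 in \<open>force+\<close>)
    show "negligible {x \<in> {a..b} - {0<..<L}. \<psi> x * w x \<noteq> 0}"
      by (rule negligible_subset[of "{}"]) (use ab in auto)
  qed
  have h2: "(\<psi> has_integral 0) {a..b}"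
    using int\<psi> \<psi>int by (metis integrable_integral)
  have "((\<lambda>x. \<psi> x * w x - \<psi> x * c) has_integral 0 - 0 * c) {a..b}"
    by (intro has_integral_diff h1 has_integral_mult_left h2)
  then have "((\<lambda>x. \<eta> x * (w x - c)\<^sup>2) has_integral 0) {a..b}"
    by (simp add: \<psi>w power2_eq_square algebra_simps)
  then have "integral {a..b} (\<lambda>x. \<eta> x * (w x - c)\<^sup>2) = 0" by (rule integral_unique)
  then have z: "\<forall>x\<in>{a..b}. \<eta> x * (w x - c)\<^sup>2 = 0"
    by (subst (asm) integral_eq_0_iff) (use ab \<eta>n in \<open>auto intro!: continuous_intros \<eta>c wab\<close>)
  have "w x = c" if "x \<in> {a<..<b}" for x
  proof -
    have "\<eta> x * (w x - c)\<^sup>2 = 0" using z that by auto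
    then show ?thesis using \<eta>p[OF that] by simp
  qed
  then show ?thesis by (rule that)
qed

section \<open>Weak derivatives determine the function up to a constant and are unique\<close>

lemma test_integrable:
  fixes f :: "real \<Rightarrow> real" and k :: "real \<Rightarrow> 'a::euclidean_space"
  assumes f: "continuous_on UNIV f" and k: "integrable (Om L) k"
  shows "integrable (Om L) (\<lambda>x. f x *\<^sub>R k x)"
proof -
  have fc: "continuous_on {0..L} f" using f continuous_on_subset by blast
  obtain B where B: "B \<ge> 0" "\<And>x. x \<in> {0..L} \<Longrightarrow> norm (f x) \<le> B"
    using continuous_bound[OF fc] by blast
  note [measurable] = measurable_Om_continuous[OF fc] borel_measurable_integrable[OF k]
  show ?thesis
    by (rule Bochner_Integration.integrable_bound[of _ "\<lambda>x. B *\<^sub>R k x"])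
       (use k B in \<open>auto intro!: AE_Om_I mult_right_mono\<close>)
qed

lemma weak_derivative_inner:
  fixes u g :: "real \<Rightarrow> 'a::euclidean_space"
  assumes u: "integrable (Om L) u" and g: "integrable (Om L) g" and wd: "weak_derivative L u g"
  shows "weak_derivative L (\<lambda>x. u x \<bullet> e) (\<lambda>x. g x \<bullet> e)"
  unfolding weak_derivative_def
proof
  fix \<phi> assume \<phi>: "\<phi> \<in> test_functions L"
  note p = test_function_props[OF \<phi>]
  note i = test_integrable[OF p(1) u] test_integrable[OF p(2) g]
  have "(LINT x|Om L. deriv \<phi> x *\<^sub>R u x) \<bullet> e = - (LINT x|Om L. \<phi> x *\<^sub>R g x) \<bullet> e"
    using wd \<phi> by (simp add: weak_derivative_def)
  then show "(LINT x|Om L. deriv \<phi> x *\<^sub>R (u x \<bullet> e)) = - (LINT x|Om L. \<phi> x *\<^sub>R (g x \<bullet> e))"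
    using integral_inner_left[OF i(1), of e] integral_inner_left[OF i(2), of e]
    by simp
qed


text \<open>Every point of (0,L) shares a compactly contained interval with L/2, so all local
  constants equal the value there; continuity adds the end points.\<close>

lemma continuous_weak_derivative_0_const:
  fixes w :: "real \<Rightarrow> real"
  assumes w: "continuous_on {0..L} w" and wd: "weak_derivative L w (\<lambda>_. 0)" and x: "x \<in> {0..L}"
  shows "w x = w (L / 2)"
proof -
  have "w y = w (L / 2)" if y: "y \<in> {0<..<L}" for y
  proof -
    define a where "a = min y (L / 2) / 2"
    define b where "b = (max y (L / 2) + L) / 2"
    have ab: "0 < a" "a < b" "b < L" "y \<in> {a<..<b}" "L / 2 \<in> {a<..<b}"
      using y L_pos by (auto simp: a_def b_def min_def max_def field_simps split: if_splits)
    obtain c where "\<And>x. x \<in> {a<..<b} \<Longrightarrow> w x = c"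
      using du_Bois_Reymond_aux[OF w wd ab(1-3)] by blast
    then show ?thesis using ab(4,5) by metis
  qed
  note const = this
  have cl: "closure {0<..<L} = {0..L}" using L_pos by simp
  show ?thesis
    by (rule continuous_constant_on_closure[of "{0<..<L}", OF _ const, unfolded cl]) (use w x in auto)
qed

lemma weak_derivative_add:
  fixes u v f g :: "real \<Rightarrow> 'a::euclidean_space"
  assumes "integrable (Om L) u" "integrable (Om L) v" "integrable (Om L) f" "integrable (Om L) g"
    and "weak_derivative L u f" "weak_derivative L v g"
  shows "weak_derivative L (\<lambda>x. u x + v x) (\<lambda>x. f x + g x)"
  unfolding weak_derivative_def
proof
  fix \<phi> assume \<phi>: "\<phi> \<in> test_functions L"
  note p = test_function_props[OF \<phi>]
  note i = test_integrable[OF p(1) assms(1)] test_integrable[OF p(1) assms(2)]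
    test_integrable[OF p(2) assms(3)] test_integrable[OF p(2) assms(4)]
  show "(LINT x|Om L. deriv \<phi> x *\<^sub>R (u x + v x)) = - (LINT x|Om L. \<phi> x *\<^sub>R (f x + g x))"
    using assms(5,6) \<phi> i by (simp add: weak_derivative_def scaleR_add_right)
qed

lemma weak_derivative_scaleR:
  fixes u f :: "real \<Rightarrow> 'a::euclidean_space"
  assumes "weak_derivative L u f"
  shows "weak_derivative L (\<lambda>x. r *\<^sub>R u x) (\<lambda>x. r *\<^sub>R f x)"
proof -
  have "(LINT x|Om L. c x *\<^sub>R r *\<^sub>R h x) = r *\<^sub>R (LINT x|Om L. c x *\<^sub>R h x)"
    for c :: "real \<Rightarrow> real" and h :: "real \<Rightarrow> 'a"
    by (subst integral_scaleR_right[symmetric])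
       (auto simp: mult.commute intro!: Bochner_Integration.integral_cong)
  then show ?thesis using assms by (simp add: weak_derivative_def)
qed

lemma weak_derivative_diff:
  fixes u v f g :: "real \<Rightarrow> 'a::euclidean_space"
  assumes "integrable (Om L) u" "integrable (Om L) v" "integrable (Om L) f" "integrable (Om L) g"
    and "weak_derivative L u f" "weak_derivative L v g"
  shows "weak_derivative L (\<lambda>x. u x - v x) (\<lambda>x. f x - g x)"
  using weak_derivative_add[of u "\<lambda>x. (-1) *\<^sub>R v x" f "\<lambda>x. (-1) *\<^sub>R g x"]
    weak_derivative_scaleR[of v g "-1"] assms by simp

text \<open>Subtracting the primitive leaves a continuous function with weak derivative 0, and the
  scalar case applies to each component of it. This is the fundamental theorem of calculus for
  continuous representatives.\<close>

lemma weak_derivative_imp_primitive: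
  fixes u g :: "real \<Rightarrow> 'a::euclidean_space"
  assumes u: "continuous_on {0..L} u" and g: "integrable (Om L) g"
    and wd: "weak_derivative L u g" and x: "x \<in> {0..L}"
  shows "u x = u 0 + primitive g x"
proof (rule euclidean_eqI)
  fix e :: 'a
  define w where "w x = u x - primitive g x" for x
  have pg: "continuous_on {0..L} (primitive g)" by (rule primitive_continuous[OF g])
  have wc: "continuous_on {0..L} w"
    unfolding w_def by (intro continuous_intros u pg)
  have "weak_derivative L w (\<lambda>x. g x - g x)"
    unfolding w_def
    by (intro weak_derivative_diff integrable_Om_continuous u pg g wd weak_derivative_primitive[where c=0]) auto
  then have "weak_derivative L (\<lambda>x. w x \<bullet> e) (\<lambda>x. 0)"
    using weak_derivative_inner[OF integrable_Om_continuous[OF wc], of "\<lambda>x. 0" e] by simp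
  then have "w x \<bullet> e = w (L / 2) \<bullet> e" "w 0 \<bullet> e = w (L / 2) \<bullet> e"
    using L_pos x
    by (auto intro!: continuous_weak_derivative_0_const[where w="\<lambda>x. w x \<bullet> e"] continuous_intros wc)
  then show "u x \<bullet> e = (u 0 + primitive g x) \<bullet> e"
    by (simp add: w_def inner_diff_left inner_add_left)
qed

text \<open>Half-lines form an intersection-stable generator of the Borel sets, so a vanishing
  primitive forces the integral over every Borel set to vanish. A Lebesgue set differs from a Borel
  set by a null set only.\<close>

lemma primitive_0_imp_AE_0:
  fixes g :: "real \<Rightarrow> 'a::euclidean_space"
  assumes g: "integrable (Om L) g" and p: "\<And>x. x \<in> {0..L} \<Longrightarrow> primitive g x = 0"
  shows "AE x in Om L. g x = 0"
proof -
  interpret M: finite_measure "Om L" by simp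
  show ?thesis
  proof (rule M.density_zero[OF g])
    let ?P = "\<lambda>A. (LINT x|Om L. indicat_real A x *\<^sub>R g x) = 0"
    have all: "primitive g x = 0" for x
    proof (cases "x \<in> {0..L}")
      case False
      then consider "x < 0" | "L < x" by force
      then show ?thesis
      proof cases
        case 1
        then have "primitive g x = (LINT t|Om L. 0)"
          unfolding primitive_def by (intro Bochner_Integration.integral_cong) auto
        then show ?thesis by simp
      next
        case 2
        then have "primitive g x = primitive g L"
          unfolding primitive_def by (intro Bochner_Integration.integral_cong) auto
        then show ?thesis using p[of L] L_pos by simp
      qed
    qed (rule p)
    have total: "(LINT x|Om L. g x) = 0"
    proof -
      have "(LINT x|Om L. g x) = primitive g L"
        unfolding primitive_def by (intro Bochner_Integration.integral_cong) auto
      then show ?thesis using all by simp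
    qed
    have bor: "?P A" if "A \<in> sets borel" for A
    proof -
      have A: "A \<in> sigma_sets UNIV (range lessThan)"
        using that by (simp add: borel_Iio)
      have "{..<a} \<inter> {..<b} = {..<min a b}" for a b :: real by auto
      then have st: "Int_stable (range (lessThan :: real \<Rightarrow> real set))"
        by (auto simp: Int_stable_def)
      have "range (lessThan :: real \<Rightarrow> real set) \<subseteq> Pow UNIV" by simp
      from st this A show ?thesis
      proof (induction rule: sigma_sets_induct_disjoint)
        case (basic A)
        then show ?case using all by (auto simp: primitive_def)
      next
        case (compl A)
        then have A: "A \<in> sets borel" by (simp add: borel_Iio)
        have "(LINT x|Om L. indicat_real (UNIV - A) x *\<^sub>R g x)
            = (LINT x|Om L. g x - indicat_real A x *\<^sub>R g x)"
          by (intro Bochner_Integration.integral_cong) (auto simp: indicator_def)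
        also have "\<dots> = 0"
          using compl(2) total g integrable_indicator_Om[OF g A] by simp
        finally show ?case .
      next
        case (union A)
        then have A: "A i \<in> sets borel" for i by (auto simp: borel_Iio)
        \<comment> \<open>The sets \<open>A i\<close> live on the whole line and belong to the
          restricted sigma-algebra only after intersection with (0,L), which leaves the integral
          unchanged.\<close>
        have sp: "(LINT x|Om L. indicat_real (B \<inter> {0<..<L}) x *\<^sub>R g x)
            = (LINT x|Om L. indicat_real B x *\<^sub>R g x)" for B
          by (intro Bochner_Integration.integral_cong) (auto simp: indicator_def)
        have AO: "A i \<inter> {0<..<L} \<in> sets (Om L)" for i
          using A[of i] by (simp add: sets_restrict_space_iff sets_completionI_sets)
        have "(LINT x:(\<Union>i. A i \<inter> {0<..<L})|Om L. g x) = (\<Sum>i. (LINT x:(A i \<inter> {0<..<L})|Om L. g x))"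
        proof (rule lebesgue_integral_countable_add)
          show "A i \<inter> {0<..<L} \<inter> (A j \<inter> {0<..<L}) = {}" if "i \<noteq> j" for i j
            using union(1) that by (auto simp: disjoint_family_on_def)
          have "(\<Union>i. A i) \<inter> {0<..<L} = (\<Union>i. A i \<inter> {0<..<L})" by blast
          then show "set_integrable (Om L) (\<Union>i. A i \<inter> {0<..<L}) g"
            unfolding set_integrable_def using A
            by (intro integrable_indicator_Om[OF g]) auto
        qed (rule AO)
        moreover have "(\<Union>i. A i \<inter> {0<..<L}) = (\<Union>i. A i) \<inter> {0<..<L}" by blast
        ultimately show ?case
          using union(3) sp unfolding set_lebesgue_integral_def by simp
      qed auto
    qed
    fix A assume "A \<in> sets (Om L)"
    then have "A \<in> sets lebesgue" by (auto simp: sets_restrict_space_iff)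
    then obtain S N N' where S: "A = S \<union> N" "N \<subseteq> N'" "N' \<in> null_sets lborel" "S \<in> sets lborel"
      by (rule sets_completionE)
    have "AE x in lborel. x \<notin> N'" using S(3) by (rule AE_not_in)
    then have "AE x in lebesgue. x \<notin> N'" by (rule AE_completion)
    then have "AE x in Om L. x \<notin> N'" by (subst AE_restrict_space_iff) auto
    then have ae: "AE x in Om L. indicat_real A x *\<^sub>R g x = indicat_real S x *\<^sub>R g x"
      by eventually_elim (use S in \<open>auto simp: indicator_def\<close>)
    have "(LINT x|Om L. indicat_real A x *\<^sub>R g x) = (LINT x|Om L. indicat_real S x *\<^sub>R g x)"
    proof (rule integral_cong_AE[OF _ _ ae])
      have [measurable]: "indicat_real A \<in> borel_measurable (Om L)"
        using \<open>A \<in> sets (Om L)\<close> by (rule borel_measurable_indicator)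
      show "(\<lambda>x. indicat_real A x *\<^sub>R g x) \<in> borel_measurable (Om L)"
        using borel_measurable_integrable[OF g] by measurable
      show "(\<lambda>x. indicat_real S x *\<^sub>R g x) \<in> borel_measurable (Om L)"
        using integrable_indicator_Om[OF g, of S] S(4) by auto
    qed
    then show "set_lebesgue_integral (Om L) A g = 0"
      using bor[of S] S(4) by (simp add: set_lebesgue_integral_def)
  qed
qed

text \<open>The difference of the two candidates is a weak derivative of the zero function and
  therefore has vanishing primitive.\<close>

lemma weak_derivative_unique:
  fixes u f g :: "real \<Rightarrow> 'a::euclidean_space"
  assumes u: "integrable (Om L) u" and f: "integrable (Om L) f" and g: "integrable (Om L) g"
    and "weak_derivative L u f" "weak_derivative L u g"
  shows "AE x in Om L. f x = g x"
proof -
  have fg: "integrable (Om L) (\<lambda>x. f x - g x)" using f g by simp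
  have "weak_derivative L (\<lambda>x. u x - u x) (\<lambda>x. f x - g x)"
    using assms by (intro weak_derivative_diff)
  then have wd: "weak_derivative L (\<lambda>x. 0) (\<lambda>x. f x - g x)" by simp
  have "AE x in Om L. f x - g x = 0"
    by (rule primitive_0_imp_AE_0[OF fg]) (use weak_derivative_imp_primitive[OF _ fg wd] in auto)
  then show ?thesis by simp
qed

text \<open>The distance of \<open>f\<close> and \<open>g\<close> is continuous and nonnegative with
  integral 0, so it vanishes everywhere, end points included.\<close>

lemma AE_eq_imp_continuous_eq:
  fixes f g :: "real \<Rightarrow> 'a::euclidean_space"
  assumes f: "continuous_on {0..L} f" and g: "continuous_on {0..L} g"
    and ae: "AE x in Om L. f x = g x" and x: "x \<in> {0..L}"
  shows "f x = g x"
proof -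
  let ?d = "\<lambda>x. norm (f x - g x)"
  have d: "continuous_on {0..L} ?d" by (intro continuous_intros f g)
  have "(?d has_integral (LINT x|Om L. ?d x)) {0<..<L}"
    by (rule has_integral_integral_lebesgue_on[OF integrable_Om_continuous[OF d]]) simp
  moreover have "(LINT x|Om L. ?d x) = (LINT x|Om L. 0)"
    using ae by (intro integral_cong_AE) (auto intro: measurable_Om_continuous[OF d])
  ultimately have "(?d has_integral 0) {0..L}" by (simp add: has_integral_Icc_iff_Ioo)
  then have "integral {0..L} ?d = 0" by (rule integral_unique)
  then have "?d x = 0" using integral_eq_0_iff[OF d L_pos] x by auto
  then show ?thesis by simp
qed

section \<open>Elements of \<open>H1\<close> and \<open>H2\<close> and their chosen
  derivatives\<close>

lemma H1_continuous: "u \<in> H1 L \<Longrightarrow> continuous_on {0..L} u"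
  by (simp add: H1_def)

lemma H2_continuous: "u \<in> H2 L \<Longrightarrow> continuous_on {0..L} u"
  by (simp add: H2_def)

lemma wderiv_H1:
  assumes "u \<in> H1 L"
  shows "wderiv L u \<in> L2 L" "weak_derivative L u (wderiv L u)"
proof -
  have "\<exists>g. g \<in> L2 L \<and> weak_derivative L u g" using assms by (auto simp: H1_def)
  from someI_ex[OF this] show "wderiv L u \<in> L2 L" "weak_derivative L u (wderiv L u)"
    by (simp_all add: wderiv_def)
qed

text \<open>Identifies the arbitrary choice behind \<open>wderiv\<close>, up to a null set.\<close>

lemma wderiv_unique:
  assumes "u \<in> H1 L" "g \<in> L2 L" "weak_derivative L u g"
  shows "AE x in Om L. wderiv L u x = g x"
  using assms wderiv_H1[OF assms(1)]
  by (intro weak_derivative_unique[of u] L2_integrable integrable_Om_continuous H1_continuous)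

lemma H1_primitive:
  assumes "u \<in> H1 L" "x \<in> {0..L}"
  shows "u x = u 0 + primitive (wderiv L u) x"
  using assms wderiv_H1[OF assms(1)]
  by (intro weak_derivative_imp_primitive L2_integrable H1_continuous)

lemma H1_Hoelder:
  assumes u: "u \<in> H1 L" and st: "s \<in> {0..L}" "t \<in> {0..L}"
  shows "norm (u t - u s) \<le> sqrt \<bar>t - s\<bar> * L2_norm L (wderiv L u)"
proof -
  have *: "norm (u t - u s) \<le> sqrt \<bar>t - s\<bar> * L2_norm L (wderiv L u)"
    if "s \<in> {0..L}" "t \<in> {0..L}" "s \<le> t" for s t
    using primitive_Hoelder[OF wderiv_H1(1)[OF u], of s t] H1_primitive[OF u that(1)]
      H1_primitive[OF u that(2)] that by simp
  show ?thesis
    using *[of s t] *[of t s] st by (cases "s \<le> t") (auto simp: norm_minus_commute abs_minus_commute)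
qed

lemma H1_I:
  assumes "continuous_on {0..L} u" "g \<in> L2 L" "weak_derivative L u g"
  shows "u \<in> H1 L"
  using assms by (auto simp: H1_def)

lemma cderiv_exists:
  assumes "\<exists>z. continuous_on {0..L} z \<and> weak_derivative L u z"
  shows "continuous_on {0..L} (cderiv L u)" "weak_derivative L u (cderiv L u)"
  using someI_ex[OF assms] by (simp_all add: cderiv_def)

text \<open>Continuity upgrades uniqueness to every point of [0,L]; boundary conditions and nodal
  conditions on y' rely on this.\<close>

lemma cderiv_unique:
  assumes u: "continuous_on {0..L} u" and z: "continuous_on {0..L} z" "weak_derivative L u z"
    and x: "x \<in> {0..L}"
  shows "cderiv L u x = z x"
proof (rule AE_eq_imp_continuous_eq[OF _ z(1) _ x])
  show "continuous_on {0..L} (cderiv L u)" using z by (intro cderiv_exists) auto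
  show "AE x in Om L. cderiv L u x = z x"
    using cderiv_exists[of u] assms
    by (intro weak_derivative_unique[of u] integrable_Om_continuous) auto
qed

lemma weak_derivative_cong:
  assumes "weak_derivative L u g" "\<And>x. x \<in> {0<..<L} \<Longrightarrow> u x = v x"
    "\<And>x. x \<in> {0<..<L} \<Longrightarrow> g x = f x"
  shows "weak_derivative L v f"
proof -
  have "(LINT x|Om L. c x *\<^sub>R u x) = (LINT x|Om L. c x *\<^sub>R v x)"
    "(LINT x|Om L. c x *\<^sub>R g x) = (LINT x|Om L. c x *\<^sub>R f x)" for c
    using assms(2,3) by (auto intro!: Bochner_Integration.integral_cong)
  then show ?thesis using assms(1) by (simp add: weak_derivative_def)
qed

lemma H1_cong:
  assumes "u \<in> H1 L" "\<And>x. x \<in> {0..L} \<Longrightarrow> u x = v x"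
  shows "v \<in> H1 L"
proof (rule H1_I)
  show "continuous_on {0..L} v" using H1_continuous[OF assms(1)] assms(2) by (rule continuous_on_eq)
  show "weak_derivative L v (wderiv L u)"
    by (rule weak_derivative_cong[OF wderiv_H1(2)[OF assms(1)]]) (use assms(2) in auto)
qed (rule wderiv_H1[OF assms(1)])

lemma H2_cderiv:
  assumes u: "u \<in> H2 L"
  shows "cderiv L u \<in> H1 L" "weak_derivative L u (cderiv L u)"
proof -
  obtain z where z: "z \<in> H1 L" "weak_derivative L u z" using u by (auto simp: H2_def)
  then show "weak_derivative L u (cderiv L u)"
    using H1_continuous by (intro cderiv_exists) auto
  show "cderiv L u \<in> H1 L"
    using cderiv_unique[OF H2_continuous[OF u] H1_continuous[OF z(1)] z(2)]
    by (intro H1_cong[OF z(1)]) auto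
qed

lemma H2_H1:
  assumes u: "u \<in> H2 L"
  shows "u \<in> H1 L"
  by (rule H1_I[OF H2_continuous[OF u] L2_continuous[OF H1_continuous[OF H2_cderiv(1)[OF u]]] H2_cderiv(2)[OF u]])

lemma H2_I:
  assumes "continuous_on {0..L} u" "z \<in> H1 L" "weak_derivative L u z"
  shows "u \<in> H2 L"
  using assms by (auto simp: H2_def)

lemma H2_wderiv_AE:
  assumes u: "u \<in> H2 L"
  shows "AE x in Om L. wderiv L u x = cderiv L u x"
  by (rule wderiv_unique[OF H2_H1[OF u] L2_continuous[OF H1_continuous[OF H2_cderiv(1)[OF u]]] H2_cderiv(2)[OF u]])

text \<open>The three derivatives in the second claim are independent choices, which is why
  additivity holds only almost everywhere.\<close>

lemma H1_add:
  assumes "u \<in> H1 L" "v \<in> H1 L"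
  shows "(\<lambda>x. u x + v x) \<in> H1 L"
    "AE x in Om L. wderiv L (\<lambda>x. u x + v x) x = wderiv L u x + wderiv L v x"
proof -
  note w = wderiv_H1[OF assms(1)] wderiv_H1[OF assms(2)]
  have wd: "weak_derivative L (\<lambda>x. u x + v x) (\<lambda>x. wderiv L u x + wderiv L v x)"
    using w assms by (intro weak_derivative_add integrable_Om_continuous L2_integrable H1_continuous)
  have l: "(\<lambda>x. wderiv L u x + wderiv L v x) \<in> L2 L" using w by (intro L2_add)
  show i: "(\<lambda>x. u x + v x) \<in> H1 L"
    using assms[THEN H1_continuous] by (intro H1_I[OF _ l wd] continuous_intros)
  show "AE x in Om L. wderiv L (\<lambda>x. u x + v x) x = wderiv L u x + wderiv L v x"
    by (rule wderiv_unique[OF i l wd])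
qed

lemma H1_scaleR:
  assumes "u \<in> H1 L"
  shows "(\<lambda>x. r *\<^sub>R u x) \<in> H1 L"
    "AE x in Om L. wderiv L (\<lambda>x. r *\<^sub>R u x) x = r *\<^sub>R wderiv L u x"
proof -
  note w = wderiv_H1[OF assms(1)]
  have wd: "weak_derivative L (\<lambda>x. r *\<^sub>R u x) (\<lambda>x. r *\<^sub>R wderiv L u x)"
    using w by (intro weak_derivative_scaleR)
  have l: "(\<lambda>x. r *\<^sub>R wderiv L u x) \<in> L2 L" using w by (intro L2_scaleR)
  show i: "(\<lambda>x. r *\<^sub>R u x) \<in> H1 L"
    using assms[THEN H1_continuous] by (intro H1_I[OF _ l wd] continuous_intros)
  show "AE x in Om L. wderiv L (\<lambda>x. r *\<^sub>R u x) x = r *\<^sub>R wderiv L u x"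
    by (rule wderiv_unique[OF i l wd])
qed

text \<open>\<open>cderiv\<close> of a sum or a multiple is known only on [0,L]. So
  \<open>wderiv\<close> may receive functions that differ outside, and choose differently for
  them.\<close>

lemma wderiv_cong_AE:
  assumes "u \<in> H1 L" "\<And>x. x \<in> {0..L} \<Longrightarrow> v x = u x"
  shows "AE x in Om L. wderiv L v x = wderiv L u x"
proof (rule wderiv_unique)
  show "v \<in> H1 L" using assms by (intro H1_cong[OF assms(1)]) auto
  show "weak_derivative L v (wderiv L u)"
    by (rule weak_derivative_cong[OF wderiv_H1(2)[OF assms(1)]]) (use assms(2) in auto)
qed (rule wderiv_H1[OF assms(1)])

lemma H2_add:
  assumes "u \<in> H2 L" "v \<in> H2 L"
  shows "(\<lambda>x. u x + v x) \<in> H2 L"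
    "\<And>x. x \<in> {0..L} \<Longrightarrow> cderiv L (\<lambda>x. u x + v x) x = cderiv L u x + cderiv L v x"
    "AE x in Om L. wderiv L (cderiv L (\<lambda>x. u x + v x)) x = wderiv L (cderiv L u) x + wderiv L (cderiv L v) x"
proof -
  note w = H2_cderiv[OF assms(1)] H2_cderiv[OF assms(2)]
  have wd: "weak_derivative L (\<lambda>x. u x + v x) (\<lambda>x. cderiv L u x + cderiv L v x)"
    using w assms by (intro weak_derivative_add integrable_Om_continuous H1_continuous H2_continuous)
  note l = H1_add[OF w(1,3)]
  have c: "continuous_on {0..L} (\<lambda>x. u x + v x)"
    using assms[THEN H2_continuous] by (intro continuous_intros)
  show i: "(\<lambda>x. u x + v x) \<in> H2 L"
    by (rule H2_I[OF c l(1) wd])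
  show cd: "cderiv L (\<lambda>x. u x + v x) x = cderiv L u x + cderiv L v x" if "x \<in> {0..L}" for x
    using cderiv_unique[OF c H1_continuous[OF l(1)] wd that] .
  show "AE x in Om L. wderiv L (cderiv L (\<lambda>x. u x + v x)) x = wderiv L (cderiv L u) x + wderiv L (cderiv L v) x"
  proof -
    have "AE x in Om L. wderiv L (cderiv L (\<lambda>x. u x + v x)) x = wderiv L (\<lambda>x. cderiv L u x + cderiv L v x) x"
      by (rule wderiv_cong_AE[OF l(1)]) (rule cd)
    then show ?thesis using l(2) by eventually_elim simp
  qed
qed

lemma H2_scaleR:
  assumes "u \<in> H2 L"
  shows "(\<lambda>x. r *\<^sub>R u x) \<in> H2 L"
    "\<And>x. x \<in> {0..L} \<Longrightarrow> cderiv L (\<lambda>x. r *\<^sub>R u x) x = r *\<^sub>R cderiv L u x"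
    "AE x in Om L. wderiv L (cderiv L (\<lambda>x. r *\<^sub>R u x)) x = r *\<^sub>R wderiv L (cderiv L u) x"
proof -
  note w = H2_cderiv[OF assms(1)]
  have wd: "weak_derivative L (\<lambda>x. r *\<^sub>R u x) (\<lambda>x. r *\<^sub>R cderiv L u x)"
    using w by (intro weak_derivative_scaleR)
  note l = H1_scaleR[OF w(1), of r]
  have c: "continuous_on {0..L} (\<lambda>x. r *\<^sub>R u x)"
    using assms[THEN H2_continuous] by (intro continuous_intros)
  show i: "(\<lambda>x. r *\<^sub>R u x) \<in> H2 L"
    by (rule H2_I[OF c l(1) wd])
  show cd: "cderiv L (\<lambda>x. r *\<^sub>R u x) x = r *\<^sub>R cderiv L u x" if "x \<in> {0..L}" for x
    using cderiv_unique[OF c H1_continuous[OF l(1)] wd that] .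
  show "AE x in Om L. wderiv L (cderiv L (\<lambda>x. r *\<^sub>R u x)) x = r *\<^sub>R wderiv L (cderiv L u) x"
  proof -
    have "AE x in Om L. wderiv L (cderiv L (\<lambda>x. r *\<^sub>R u x)) x = wderiv L (\<lambda>x. r *\<^sub>R cderiv L u x) x"
      by (rule wderiv_cong_AE[OF l(1)]) (rule cd)
    then show ?thesis using l(2) by eventually_elim simp
  qed
qed

section \<open>Sobolev norms and the sup bound in one dimension\<close>

lemma H1_norm_nonneg [simp]: "0 \<le> H1_norm L u" and H2_norm_nonneg [simp]: "0 \<le> H2_norm L u"
  by (simp_all add: H1_norm_def H2_norm_def)

lemma L2_le_H1_norm: "L2_norm L u \<le> H1_norm L u" "L2_norm L (wderiv L u) \<le> H1_norm L u"
  by (simp_all add: H1_norm_def real_le_rsqrt)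

lemma H1_norm_cderiv_le_H2_norm: "H1_norm L (cderiv L u) \<le> H2_norm L u"
  by (simp add: H1_norm_def H2_norm_def)

lemma L2_le_H2_norm: "L2_norm L u \<le> H2_norm L u" "L2_norm L (cderiv L u) \<le> H2_norm L u"
  "L2_norm L (wderiv L (cderiv L u)) \<le> H2_norm L u"
  by (simp_all add: H2_norm_def real_le_rsqrt)

lemma H1_norm_le_H2_norm:
  assumes "u \<in> H2 L"
  shows "H1_norm L u \<le> H2_norm L u"
proof -
  have "L2_norm L (wderiv L u) = L2_norm L (cderiv L u)"
    by (rule L2_norm_cong_AE[OF wderiv_H1(1)[OF H2_H1[OF assms]]
          L2_continuous[OF H1_continuous[OF H2_cderiv(1)[OF assms]]] H2_wderiv_AE[OF assms]])
  then show ?thesis by (simp add: H1_norm_def H2_norm_def)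
qed

text \<open>Integrate \<open>|u(x)| \<le> |u(t)| + \<surd>L \<parallel>u'\<parallel>\<close> over \<open>t\<close>.\<close>

lemma H1_sup_bound:
  fixes u :: "real \<Rightarrow> 'a::euclidean_space"
  assumes u: "u \<in> H1 L" and x: "x \<in> {0..L}"
  shows "norm (u x) \<le> (1 / sqrt L + sqrt L) * H1_norm L u"
proof -
  have uL: "u \<in> L2 L" using u by (intro L2_continuous H1_continuous)
  have pt: "norm (u x) \<le> norm (u t) + sqrt L * L2_norm L (wderiv L u)" if "t \<in> {0..L}" for t
  proof -
    have "norm (u x) \<le> norm (u t) + norm (u x - u t)"
      using norm_triangle_ineq[of "u t" "u x - u t"] by simp
    also have "norm (u x - u t) \<le> sqrt \<bar>x - t\<bar> * L2_norm L (wderiv L u)"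
      using H1_Hoelder[OF u that x] .
    also have "\<dots> \<le> sqrt L * L2_norm L (wderiv L u)"
      using that x by (intro mult_right_mono) auto
    finally show ?thesis by simp
  qed
  have "L * norm (u x) = (LINT t|Om L. norm (u x))" using measure_Om by simp
  also have "\<dots> \<le> (LINT t|Om L. norm (u t) + sqrt L * L2_norm L (wderiv L u))"
    using pt uL L2_integrable[OF L2_const]
    by (intro integral_mono Bochner_Integration.integrable_add integrable_norm L2_integrable L2_const) auto
  also have "\<dots> = (LINT t|Om L. norm (u t)) + L * (sqrt L * L2_norm L (wderiv L u))"
  proof (subst Bochner_Integration.integral_add)
    show "integrable (Om L) (\<lambda>t. norm (u t))" using L2_integrable[OF uL] by simp
    show "integrable (Om L) (\<lambda>t. sqrt L * L2_norm L (wderiv L u))" by (rule L2_integrable[OF L2_const])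
  qed (use measure_Om in simp)
  also have "(LINT t|Om L. norm (u t)) \<le> L2_norm L u * sqrt L"
  proof -
    have "(LINT t|Om L. norm (u t)) \<le> L2_norm L u * L2_norm L (\<lambda>_. 1::real)"
      using L2_Cauchy_Schwarz_norm[OF uL L2_const[of "1::real"]] by simp
    also have "L2_norm L (\<lambda>_. 1::real) = sqrt L" using measure_Om by (simp add: L2_norm_def)
    finally show ?thesis .
  qed
  finally have "L * norm (u x) \<le> sqrt L * L2_norm L u + L * (sqrt L * L2_norm L (wderiv L u))"
    by (simp add: mult.commute)
  also have "\<dots> \<le> sqrt L * H1_norm L u + L * (sqrt L * H1_norm L u)"
    using L2_le_H1_norm[of u] L_pos by (intro add_mono mult_left_mono) auto
  also have "\<dots> = L * ((1 / sqrt L + sqrt L) * H1_norm L u)"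
  proof -
    have "1 / sqrt L = sqrt L / L" using L_pos by (simp add: field_simps)
    then show ?thesis using L_pos by (simp only:) (simp add: field_simps)
  qed
  finally show ?thesis using L_pos by simp
qed

end

section \<open>The energy density\<close>

text \<open>\<open>psi\<close> with the exact modulus, its formal limit for \<delta> = 0.\<close>

definition psi0 :: "real \<Rightarrow> real \<Rightarrow> real" where
  "psi0 A B = \<bar>A - B\<bar> + 4 * B\<^sup>2 / (A + B + \<bar>A - B\<bar>)"

text \<open>With A, B the squares, the denominator in \<open>psi0\<close> is 2A for A > B and 2B
  otherwise. The case \<beta> = 0 of the second branch is separate: the fraction is then 0/0, which
  evaluates to 0.\<close>

lemma Qbar_eq_psi0:
  "Qbar \<alpha> \<beta> = (\<alpha>\<^sup>2 + 5 * \<beta>\<^sup>2 + psi0 (\<alpha>\<^sup>2) (\<beta>\<^sup>2)) / 2"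
proof (cases "\<bar>\<alpha>\<bar> > \<bar>\<beta>\<bar>")
  case True
  then have "\<beta>\<^sup>2 < \<alpha>\<^sup>2" by (simp add: abs_le_square_iff flip: not_le)
  moreover from this have "\<alpha>\<^sup>2 \<noteq> 0" using zero_le_power2[of \<beta>] by linarith
  ultimately show ?thesis using True
    by (simp add: Qbar_def psi0_def field_simps power2_eq_square)
next
  case False
  then have le: "\<alpha>\<^sup>2 \<le> \<beta>\<^sup>2" by (simp only: not_less abs_le_square_iff)
  show ?thesis
  proof (cases "\<beta> = 0")
    case True
    then show ?thesis using False by (simp add: Qbar_def psi0_def)
  next
    case False
    then show ?thesis using \<open>\<not> \<bar>\<beta>\<bar> < \<bar>\<alpha>\<bar>\<close> le
      by (simp add: Qbar_def psi0_def field_simps power2_eq_square)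
  qed
qed

lemma psi_nonneg:
  assumes "0 \<le> A" "0 \<le> B" "0 \<le> m \<delta> (A - B)"
  shows "0 \<le> psi m \<delta> A B"
  using assms by (simp add: psi_def)

text \<open>Both denominators are at least B, so exchanging them changes the fraction by at most 4
  times the difference of the moduli; the modulus in front contributes the fifth
  \<open>e\<close>.\<close>

lemma psi_psi0_close:
  assumes A: "0 \<le> A" "0 \<le> B" and m: "0 \<le> m \<delta> (A - B)" "\<bar>m \<delta> (A - B) - \<bar>A - B\<bar>\<bar> \<le> e"
  shows "\<bar>psi m \<delta> A B - psi0 A B\<bar> \<le> 5 * e"
proof (cases "B = 0")
  case True
  then show ?thesis using m by (simp add: psi_def psi0_def)
next
  case False
  then have B: "0 < B" using A by simp
  define s t where "s = A + B + m \<delta> (A - B)" and "t = A + B + \<bar>A - B\<bar>"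
  have st: "B \<le> s" "B \<le> t" "0 < s" "0 < t" using A B m by (auto simp: s_def t_def)
  have "4 * B\<^sup>2 / s - 4 * B\<^sup>2 / t = (4 * B\<^sup>2 / (s * t)) * (t - s)"
    using st by (simp add: field_simps)
  moreover have "4 * B\<^sup>2 / (s * t) \<le> 4"
    using st mult_mono[of B s B t] B by (simp add: field_simps power2_eq_square)
  moreover have "0 \<le> 4 * B\<^sup>2 / (s * t)" using st by simp
  ultimately have "\<bar>4 * B\<^sup>2 / s - 4 * B\<^sup>2 / t\<bar> \<le> 4 * \<bar>t - s\<bar>"
    by (simp only: abs_mult) (intro mult_right_mono, simp_all)
  also have "\<bar>t - s\<bar> \<le> e" using m by (simp add: s_def t_def abs_minus_commute)
  finally have "\<bar>4 * B\<^sup>2 / s - 4 * B\<^sup>2 / t\<bar> \<le> 4 * e" by simp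
  then show ?thesis using m unfolding psi_def psi0_def s_def[symmetric] t_def[symmetric] by linarith
qed

text \<open>Gradient in the first vector of (p, q) -> Qbar(|p|, |q|), which is |p|^2 + 2 |q|^2 +
  |q|^4 / |p|^2 where |p| > |q|. The branches agree on |p| = |q|, both giving 0.\<close>

definition Q_grad1 :: "'a::real_inner \<Rightarrow> 'b::real_inner \<Rightarrow> 'a" where
  "Q_grad1 p q = (if norm p > norm q then (2 * (1 - (norm q)^4 / (norm p)^4)) *\<^sub>R p else 0)"

text \<open>Gradient in the second vector; on |p| = |q| both branches give 8 q.\<close>

definition Q_grad2 :: "'a::real_inner \<Rightarrow> 'b::real_inner \<Rightarrow> 'b" where
  "Q_grad2 p q = (if norm p > norm q then (4 * (1 + (norm q)\<^sup>2 / (norm p)\<^sup>2)) *\<^sub>R q else 8 *\<^sub>R q)"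

lemma norm_Q_grad1: "norm (Q_grad1 p q) \<le> 2 * norm p"
proof (cases "norm p > norm q")
  case True
  then have "0 \<le> (norm q)^4 / (norm p)^4" "(norm q)^4 / (norm p)^4 \<le> 1"
    using power_mono[of "norm q" "norm p" 4] by (simp_all add: divide_le_eq_1)
  moreover have "\<bar>2 * (1 - t)\<bar> \<le> 2" if "0 \<le> t" "t \<le> 1" for t :: real using that by simp
  ultimately have "\<bar>2 * (1 - (norm q)^4 / (norm p)^4)\<bar> \<le> 2" by blast
  then show ?thesis using True by (simp only: Q_grad1_def if_True norm_scaleR) (intro mult_right_mono, simp_all)
qed (simp add: Q_grad1_def)

lemma norm_Q_grad2: "norm (Q_grad2 p q) \<le> 8 * norm q"
proof (cases "norm p > norm q")
  case True
  then have "0 \<le> (norm q)\<^sup>2 / (norm p)\<^sup>2" "(norm q)\<^sup>2 / (norm p)\<^sup>2 \<le> 1"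
    using power_mono[of "norm q" "norm p" 2] by (simp_all add: divide_le_eq_1)
  moreover have "\<bar>4 * (1 + t)\<bar> \<le> 8" if "0 \<le> t" "t \<le> 1" for t :: real using that by simp
  ultimately have "\<bar>4 * (1 + (norm q)\<^sup>2 / (norm p)\<^sup>2)\<bar> \<le> 8" by blast
  then show ?thesis using True by (simp only: Q_grad2_def if_True norm_scaleR) (intro mult_right_mono, simp_all)
qed (simp add: Q_grad2_def)

text \<open>\<open>Qbar\<close> is the square of \<open>g(\<alpha>, \<beta>) = \<alpha> + \<beta>\<^sup>2/\<alpha>\<close> (for \<open>\<alpha> > \<beta>\<close>), respectively \<open>2 \<beta>\<close>. Convexity comes
  from the tangent bound \<open>g(\<alpha>', \<beta>') \<ge> \<alpha>' (1 - r\<^sup>2) + 2 \<beta>' r\<close> for \<open>r = \<beta>/\<alpha>\<close>, combined with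
  \<open>g\<^sup>2 + g'\<^sup>2 \<ge> 2 g g'\<close>.\<close>

definition Qroot :: "real \<Rightarrow> real \<Rightarrow> real" where
  "Qroot \<alpha> \<beta> = (if \<alpha> > \<beta> then \<alpha> + \<beta>\<^sup>2 / \<alpha> else 2 * \<beta>)"

lemma Qbar_Qroot:
  assumes "0 \<le> \<alpha>" "0 \<le> \<beta>"
  shows "Qbar \<alpha> \<beta> = (Qroot \<alpha> \<beta>)\<^sup>2"
proof (cases "\<alpha> > \<beta>")
  case True
  then have "\<alpha> > 0" using assms by simp
  then have "\<alpha> + \<beta>\<^sup>2 / \<alpha> = (\<alpha>\<^sup>2 + \<beta>\<^sup>2) / \<alpha>" by (simp add: field_simps power2_eq_square)
  then show ?thesis using True assms by (simp add: Qbar_def Qroot_def power_divide)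
qed (use assms in \<open>simp add: Qbar_def Qroot_def power_mult_distrib\<close>)

text \<open>Where \<alpha> > \<beta> the gap is the square (\<beta> - \<alpha> r)^2 divided by
  \<alpha>; otherwise \<alpha> \<le> \<beta> and 1 + r \<le> 2 suffice.\<close>

lemma Qroot_tangent:
  assumes "0 \<le> \<alpha>" "0 \<le> \<beta>" "0 \<le> r" "r \<le> 1"
  shows "\<alpha> * (1 - r\<^sup>2) + 2 * \<beta> * r \<le> Qroot \<alpha> \<beta>"
proof (cases "\<alpha> > \<beta>")
  case True
  then have a: "\<alpha> > 0" using assms by simp
  have "0 \<le> (\<beta> - \<alpha> * r)\<^sup>2 / \<alpha>" using a by simp
  also have "\<dots> = \<alpha> + \<beta>\<^sup>2 / \<alpha> - (\<alpha> * (1 - r\<^sup>2) + 2 * \<beta> * r)"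
    using a by (simp add: field_simps power2_eq_square)
  finally show ?thesis using True by (simp add: Qroot_def)
next
  case False
  have "\<alpha> * (1 - r\<^sup>2) = \<alpha> * ((1 - r) * (1 + r))" by (simp add: power2_eq_square algebra_simps)
  also have "\<dots> \<le> \<beta> * ((1 - r) * 2)"
    using False assms by (intro mult_mono mult_nonneg_nonneg) auto
  finally show ?thesis using False by (simp add: Qroot_def algebra_simps)
qed

lemma Qbar_subgradient:
  fixes p p' :: "'a::real_inner" and q q' :: "'b::real_inner"
  shows "Qbar (norm p) (norm q) + Q_grad1 p q \<bullet> (p' - p) + Q_grad2 p q \<bullet> (q' - q)
    \<le> Qbar (norm p') (norm q')"
proof (cases "norm p > norm q")
  case True
  define \<alpha> \<beta> \<alpha>' \<beta>' r where "\<alpha> = norm p" and "\<beta> = norm q" and "\<alpha>' = norm p'" and "\<beta>' = norm q'" and "r = \<beta> / \<alpha>"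
  have pos: "0 < \<alpha>" "0 \<le> \<beta>" "\<beta> < \<alpha>" "0 \<le> \<alpha>'" "0 \<le> \<beta>'"
    using True by (auto simp: \<alpha>_def \<beta>_def \<alpha>'_def \<beta>'_def intro: le_less_trans[OF norm_ge_zero])
  have r: "0 \<le> r" "r \<le> 1" "\<beta> = r * \<alpha>" using pos by (auto simp: r_def)
  have Q: "Qbar \<alpha> \<beta> = (\<alpha> * (1 + r\<^sup>2))\<^sup>2"
    using pos by (simp add: Qbar_def r(3) power_mult_distrib field_simps power2_eq_square)
  have "\<beta>^4 / \<alpha>^4 = r^4" "\<beta>\<^sup>2 / \<alpha>\<^sup>2 = r\<^sup>2" by (simp_all add: r_def power_divide)
  then have g: "Q_grad1 p q = (2 * (1 - r^4)) *\<^sub>R p" "Q_grad2 p q = (4 * (1 + r\<^sup>2)) *\<^sub>R q"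
    using True by (simp_all add: Q_grad1_def Q_grad2_def \<alpha>_def \<beta>_def)
  \<comment> \<open>With nonnegative factors in front, Cauchy-Schwarz reduces the vector inequality
    to one between the four norms.\<close>
  have r4: "r^4 \<le> 1" using r by (simp add: power_le_one)
  have "Q_grad1 p q \<bullet> p' = (2 * (1 - r^4)) * (p \<bullet> p')" by (simp add: g)
  also have "\<dots> \<le> (2 * (1 - r^4)) * (\<alpha> * \<alpha>')"
    using r4 norm_cauchy_schwarz[of p p'] by (intro mult_left_mono) (auto simp: \<alpha>_def \<alpha>'_def)
  finally have 1: "Q_grad1 p q \<bullet> p' \<le> (2 * (1 - r^4)) * (\<alpha> * \<alpha>')" .
  have "Q_grad2 p q \<bullet> q' = (4 * (1 + r\<^sup>2)) * (q \<bullet> q')" by (simp add: g)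
  also have "\<dots> \<le> (4 * (1 + r\<^sup>2)) * (\<beta> * \<beta>')"
    using norm_cauchy_schwarz[of q q'] by (intro mult_left_mono) (auto simp: \<beta>_def \<beta>'_def)
  finally have 2: "Q_grad2 p q \<bullet> q' \<le> (4 * (1 + r\<^sup>2)) * (\<beta> * \<beta>')" .
  have 3: "Q_grad1 p q \<bullet> p = 2 * (1 - r^4) * \<alpha>\<^sup>2" "Q_grad2 p q \<bullet> q = 4 * (1 + r\<^sup>2) * \<beta>\<^sup>2"
    by (simp_all add: g \<alpha>_def \<beta>_def power2_norm_eq_inner)
  have "Qbar \<alpha> \<beta> + Q_grad1 p q \<bullet> (p' - p) + Q_grad2 p q \<bullet> (q' - q)
      \<le> (\<alpha> * (1 + r\<^sup>2))\<^sup>2 + ((2 * (1 - r^4)) * (\<alpha> * \<alpha>') - 2 * (1 - r^4) * \<alpha>\<^sup>2)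
        + ((4 * (1 + r\<^sup>2)) * (\<beta> * \<beta>') - 4 * (1 + r\<^sup>2) * \<beta>\<^sup>2)"
    using 1 2 by (simp add: Q inner_diff_right 3)
  \<comment> \<open>Regrouping as 2 g t - g^2, where g = \<alpha> (1 + r^2) is the root at (p, q)
    and t the tangent expression at (p', q').\<close>
  also have "\<dots> = 2 * (\<alpha> * (1 + r\<^sup>2)) * (\<alpha>' * (1 - r\<^sup>2) + 2 * \<beta>' * r) - (\<alpha> * (1 + r\<^sup>2))\<^sup>2"
    unfolding r(3) by (simp add: power2_eq_square power4_eq_xxxx algebra_simps)
  also have "\<dots> \<le> 2 * (\<alpha> * (1 + r\<^sup>2)) * Qroot \<alpha>' \<beta>' - (\<alpha> * (1 + r\<^sup>2))\<^sup>2"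
    using Qroot_tangent[OF pos(4,5) r(1,2)] pos by (intro diff_mono mult_left_mono) auto
  also have "\<dots> \<le> (Qroot \<alpha>' \<beta>')\<^sup>2"
  proof -
    have "2 * x * y - x\<^sup>2 \<le> y\<^sup>2" for x y :: real
      using zero_le_power2[of "y - x"] by (simp add: power2_diff algebra_simps)
    then show ?thesis .
  qed
  also have "\<dots> = Qbar \<alpha>' \<beta>'" using pos by (simp add: Qbar_Qroot)
  finally show ?thesis by (simp add: \<alpha>_def \<beta>_def \<alpha>'_def \<beta>'_def)
next
  case False
  \<comment> \<open>The tangent with r = 1, followed by ordinary convexity of 4 |q|^2.\<close>
  have "2 * norm q' \<le> Qroot (norm p') (norm q')"
    using Qroot_tangent[of "norm p'" "norm q'" 1] by simp
  then have "(2 * norm q')\<^sup>2 \<le> (Qroot (norm p') (norm q'))\<^sup>2" by (intro power_mono) auto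
  then have 1: "4 * (norm q')\<^sup>2 \<le> Qbar (norm p') (norm q')"
    by (simp add: Qbar_Qroot power_mult_distrib)
  have "0 \<le> (norm (q' - q))\<^sup>2" by simp
  then have "4 * (norm q)\<^sup>2 + 8 * (q \<bullet> (q' - q)) \<le> 4 * (norm q')\<^sup>2"
    by (simp add: power2_norm_eq_inner inner_diff_left inner_diff_right inner_commute)
  then show ?thesis using False 1 by (simp add: Q_grad1_def Q_grad2_def Qbar_def)
qed

lemma Qbar_nonneg: "0 \<le> Qbar \<alpha> \<beta>"
  by (simp add: Qbar_def)

text \<open>The subgradient inequality at (p, q), combined with the linear growth of the gradients.
  Exchanging the two pairs gives the opposite bound.\<close>

lemma Qbar_diff_le:
  fixes p p' :: "'a::real_inner" and q q' :: "'b::real_inner"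
  shows "Qbar (norm p) (norm q) - Qbar (norm p') (norm q')
    \<le> 2 * (norm p * norm (p - p')) + 8 * (norm q * norm (q - q'))"
proof -
  have "Q_grad1 p q \<bullet> (p - p') \<le> norm (Q_grad1 p q) * norm (p - p')" by (rule norm_cauchy_schwarz)
  also have "\<dots> \<le> (2 * norm p) * norm (p - p')" by (intro mult_right_mono norm_Q_grad1) auto
  finally have 1: "Q_grad1 p q \<bullet> (p - p') \<le> 2 * (norm p * norm (p - p'))" by simp
  have "Q_grad2 p q \<bullet> (q - q') \<le> norm (Q_grad2 p q) * norm (q - q')" by (rule norm_cauchy_schwarz)
  also have "\<dots> \<le> (8 * norm q) * norm (q - q')" by (intro mult_right_mono norm_Q_grad2) auto
  finally have 2: "Q_grad2 p q \<bullet> (q - q') \<le> 8 * (norm q * norm (q - q'))" by simp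
  have "Q_grad1 p q \<bullet> (p' - p) = - (Q_grad1 p q \<bullet> (p - p'))"
    "Q_grad2 p q \<bullet> (q' - q) = - (Q_grad2 p q \<bullet> (q - q'))"
    by (simp_all add: inner_diff_right)
  then show ?thesis using Qbar_subgradient[of p q p' q'] 1 2 by linarith
qed

lemma Qbar_le:
  fixes p :: "'a::real_inner" and q :: "'b::real_inner"
  shows "Qbar (norm p) (norm q) \<le> 2 * (norm p)\<^sup>2 + 8 * (norm q)\<^sup>2"
  using Qbar_diff_le[of p q 0 0] by (simp add: Qbar_def power2_eq_square)

text \<open>By Lagrange's identity the last diagonal entry of the Gram matrix and the determinant
  are the same expression in p and q, so conditions on the first two columns settle orthogonality
  and orientation at once.\<close>

lemma rotation_frame_matrix_iff:
  fixes p q :: "real^3"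
  shows "rotation_matrix (frame_matrix p q) \<longleftrightarrow> norm p = 1 \<and> norm q = 1 \<and> p \<bullet> q = 0"
proof -
  have dot: "a \<bullet> b = a$1*b$1 + a$2*b$2 + a$3*b$3" for a b :: "real^3"
    by (simp add: inner_vec_def sum_3)
  have one: "(mat 1 :: real^3^3) $ i $ j = (if i = j then 1 else 0)" for i j
    by (simp add: mat_def)
  have gram: "transpose (frame_matrix p q) ** frame_matrix p q
    = vector [vector [p \<bullet> p, p \<bullet> q, 0], vector [q \<bullet> p, q \<bullet> q, 0], vector [0, 0, (p \<bullet> p) * (q \<bullet> q) - (p \<bullet> q)\<^sup>2]]"
    by (simp add: frame_matrix_def vec_eq_iff forall_3 matrix_matrix_mult_def transpose_def sum_3 cross3_def dot
        power2_eq_square algebra_simps)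
  have det: "det (frame_matrix p q) = (p \<bullet> p) * (q \<bullet> q) - (p \<bullet> q)\<^sup>2"
    unfolding frame_matrix_def det_transpose
    by (simp add: det_3 cross3_def dot power2_eq_square algebra_simps)
  have n: "norm a = 1 \<longleftrightarrow> a \<bullet> a = 1" for a :: "real^3"
    by (simp add: norm_eq_1)
  show ?thesis
    unfolding rotation_matrix_def orthogonal_matrix gram det n
    by (auto simp: vec_eq_iff forall_3 one inner_commute)
qed

section \<open>Functionals on V\<close>

context bounded_interval
begin

text \<open>The finite set \<open>S\<close> accommodates the nodes, where splines have kinks.
  Measurability of \<open>w\<close> comes out of its gauge integrability.\<close>

lemma classical_weak_derivative:
  fixes v w :: "real \<Rightarrow> 'a::euclidean_space"
  assumes v: "continuous_on {0..L} v" and S: "finite S"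
    and d: "\<And>x. x \<in> {0<..<L} - S \<Longrightarrow> (v has_vector_derivative w x) (at x)"
    and B: "\<And>x. x \<in> {0<..<L} \<Longrightarrow> norm (w x) \<le> B"
  shows "w \<in> L2 L" "weak_derivative L v w"
proof -
  have i: "(w has_integral v x - v 0) {0..x}" if "x \<in> {0..L}" for x
    by (rule fundamental_theorem_of_calculus_interior_strong[OF S])
       (use that d continuous_on_subset[OF v, of "{0..x}"] in auto)
  have "(\<lambda>x. indicator {0..L} x *\<^sub>R w x) \<in> borel_measurable lebesgue"
    using i[of L] L_pos by (intro has_integral_implies_lebesgue_measurable) auto
  then have "(\<lambda>x. indicator {0..L} x *\<^sub>R w x) \<in> borel_measurable (Om L)"
    by (rule measurable_restrict_space1)
  also have "?this \<longleftrightarrow> w \<in> borel_measurable (Om L)"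
    by (rule measurable_cong) auto
  finally show l: "w \<in> L2 L" using B by (rule L2_bounded)
  show "weak_derivative L v w"
  proof (rule weak_derivative_primitive[where c="v 0", OF L2_integrable[OF l]])
    fix x assume x: "x \<in> {0..L}"
    have "primitive w x = v x - v 0"
      using primitive_has_integral[OF L2_integrable[OF l], of x] i[OF x] x
      by (intro has_integral_unique[of w _ "{0..x}"]) auto
    then show "v x = v 0 + primitive w x" by simp
  qed
qed

lemma H1_classical:
  fixes v w :: "real \<Rightarrow> 'a::euclidean_space"
  assumes v: "continuous_on {0..L} v" and S: "finite S"
    and d: "\<And>x. x \<in> {0<..<L} - S \<Longrightarrow> (v has_vector_derivative w x) (at x)"
    and B: "\<And>x. x \<in> {0<..<L} \<Longrightarrow> norm (w x) \<le> B"
  shows "v \<in> H1 L" "AE x in Om L. wderiv L v x = w x"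
proof -
  note c = classical_weak_derivative[OF assms]
  show 1: "v \<in> H1 L" by (rule H1_I[OF v c])
  show "AE x in Om L. wderiv L v x = w x" by (rule wderiv_unique[OF 1 c])
qed

lemma H2_classical:
  fixes u v w :: "real \<Rightarrow> 'a::euclidean_space"
  assumes u: "continuous_on {0..L} u" and uv: "\<And>x. x \<in> {0<..<L} \<Longrightarrow> (u has_vector_derivative v x) (at x)"
    and v: "continuous_on {0..L} v" and S: "finite S"
    and d: "\<And>x. x \<in> {0<..<L} - S \<Longrightarrow> (v has_vector_derivative w x) (at x)"
    and B: "\<And>x. x \<in> {0<..<L} \<Longrightarrow> norm (w x) \<le> B"
  shows "u \<in> H2 L" "\<And>x. x \<in> {0..L} \<Longrightarrow> cderiv L u x = v x"
    "AE x in Om L. wderiv L (cderiv L u) x = w x"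
proof -
  have c: "v \<in> H1 L" "AE x in Om L. wderiv L v x = w x"
    by (rule H1_classical[OF v S d B]; assumption)+
  obtain B' where B': "\<And>x. x \<in> {0..L} \<Longrightarrow> norm (v x) \<le> B'" using continuous_bound[OF v] by blast
  have uv': "weak_derivative L u v"
    by (rule classical_weak_derivative(2)[OF u, of "{}" _ B']) (use uv B' in auto)
  show h: "u \<in> H2 L" by (rule H2_I[OF u c(1) uv'])
  show cu: "\<And>x. x \<in> {0..L} \<Longrightarrow> cderiv L u x = v x" by (rule cderiv_unique[OF u v uv'])
  have "AE x in Om L. wderiv L (cderiv L u) x = wderiv L v x" by (rule wderiv_cong_AE[OF c(1)]) (rule cu)
  then show "AE x in Om L. wderiv L (cderiv L u) x = w x" using c(2) by eventually_elim simp
qed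

lemma L2_norm_bound_AE:
  fixes f :: "real \<Rightarrow> 'a::euclidean_space"
  assumes f: "f \<in> L2 L" and b: "AE x in Om L. norm (f x) \<le> B" and B: "0 \<le> B"
  shows "L2_norm L f \<le> B * sqrt L"
proof -
  have "(LINT x|Om L. (norm (f x))\<^sup>2) \<le> (LINT x|Om L. B\<^sup>2)"
    using b by (intro integral_mono_AE L2_integrable_square f L2_integrable[OF L2_const])
      (auto elim!: eventually_mono intro!: power_mono)
  also have "\<dots> = B\<^sup>2 * L" using L_pos measure_Om by simp
  finally have "L2_norm L f \<le> sqrt (B\<^sup>2 * L)"
    unfolding L2_norm_def by (rule real_sqrt_le_mono)
  then show ?thesis using B by (simp add: real_sqrt_mult)
qed

lemma H1_norm_bound:
  assumes u: "u \<in> H1 L" and B: "0 \<le> B" "\<And>x. x \<in> {0..L} \<Longrightarrow> norm (u x) \<le> B"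
    "AE x in Om L. norm (wderiv L u x) \<le> B"
  shows "H1_norm L u \<le> 2 * B * sqrt L"
proof -
  have "L2_norm L u \<le> B * sqrt L"
    by (rule L2_norm_bound_AE[OF L2_continuous[OF H1_continuous[OF u]] _ B(1)]) (use B in \<open>auto intro!: AE_Om_I\<close>)
  moreover have "L2_norm L (wderiv L u) \<le> B * sqrt L"
    by (rule L2_norm_bound_AE[OF wderiv_H1(1)[OF u] B(3,1)])
  moreover have "H1_norm L u \<le> L2_norm L u + L2_norm L (wderiv L u)"
    unfolding H1_norm_def by (rule sqrt_sum_squares_le_sum) auto
  ultimately show ?thesis by linarith
qed

lemma H2_norm_bound:
  assumes u: "u \<in> H2 L" and B: "0 \<le> B" "\<And>x. x \<in> {0..L} \<Longrightarrow> norm (u x) \<le> B"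
    "\<And>x. x \<in> {0..L} \<Longrightarrow> norm (cderiv L u x) \<le> B"
    "AE x in Om L. norm (wderiv L (cderiv L u) x) \<le> B"
  shows "H2_norm L u \<le> 3 * B * sqrt L"
proof -
  have "L2_norm L u \<le> B * sqrt L"
    by (rule L2_norm_bound_AE[OF L2_continuous[OF H2_continuous[OF u]] _ B(1)]) (use B in \<open>auto intro!: AE_Om_I\<close>)
  moreover have "H1_norm L (cderiv L u) \<le> 2 * B * sqrt L"
    by (rule H1_norm_bound[OF H2_cderiv(1)[OF u] B(1,3,4)])
  moreover have "H2_norm L u = sqrt ((L2_norm L u)\<^sup>2 + (H1_norm L (cderiv L u))\<^sup>2)"
    by (simp add: H2_norm_def H1_norm_def add.assoc)
  moreover have "\<dots> \<le> L2_norm L u + H1_norm L (cderiv L u)"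
    by (rule sqrt_sum_squares_le_sum) auto
  ultimately show ?thesis by linarith
qed

section \<open>Bounded functionals on \<open>V\<close> and what weak convergence gives\<close>

lemma V_iff: "(y, b) \<in> V L \<longleftrightarrow> y \<in> H2 L \<and> b \<in> H1 L"
  by (simp add: V_def)

lemma V_norm_pair: "V_norm L (y, b) = H2_norm L y + H1_norm L b"
  by (simp add: V_norm_def)

lemma bounded_linear_on_V_I:
  fixes T :: "curve \<times> curve \<Rightarrow> 'w::real_normed_vector"
  assumes "\<And>y b z c. y \<in> H2 L \<Longrightarrow> b \<in> H1 L \<Longrightarrow> z \<in> H2 L \<Longrightarrow> c \<in> H1 L \<Longrightarrow>
      T (\<lambda>x. y x + z x, \<lambda>x. b x + c x) = T (y, b) + T (z, c)"
    and "\<And>r y b. y \<in> H2 L \<Longrightarrow> b \<in> H1 L \<Longrightarrow> T (\<lambda>x. r *\<^sub>R y x, \<lambda>x. r *\<^sub>R b x) = r *\<^sub>R T (y, b)"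
    and "\<And>y b. y \<in> H2 L \<Longrightarrow> b \<in> H1 L \<Longrightarrow> norm (T (y, b)) \<le> C * (H2_norm L y + H1_norm L b)"
  shows "bounded_linear_on_V L T"
  unfolding bounded_linear_on_V_def
  using assms by (auto simp: V_iff V_norm_pair intro!: exI[of _ C])

text \<open>Linearity is postulated for sums and multiples of elements of \<open>V\<close>, so the
  difference is formed as a sum with the (-1)-fold pair.\<close>

lemma bounded_linear_on_V_diff:
  fixes T :: "curve \<times> curve \<Rightarrow> 'w::real_normed_vector"
  assumes T: "bounded_linear_on_V L T" and V: "(y, b) \<in> V L" "(z, c) \<in> V L"
  shows "(\<lambda>x. y x - z x, \<lambda>x. b x - c x) \<in> V L"
    "T (\<lambda>x. y x - z x, \<lambda>x. b x - c x) = T (y, b) - T (z, c)"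
proof -
  have m: "(\<lambda>x. (-1) *\<^sub>R z x, \<lambda>x. (-1) *\<^sub>R c x) \<in> V L"
    using V H2_scaleR(1)[of z "-1"] H1_scaleR(1)[of c "-1"] by (simp add: V_iff)
  show "(\<lambda>x. y x - z x, \<lambda>x. b x - c x) \<in> V L"
    using V m H2_add(1)[of y "\<lambda>x. (-1) *\<^sub>R z x"] H1_add(1)[of b "\<lambda>x. (-1) *\<^sub>R c x"] by (simp add: V_iff)
  have "T (\<lambda>x. y x + (-1) *\<^sub>R z x, \<lambda>x. b x + (-1) *\<^sub>R c x) = T (y, b) + T (\<lambda>x. (-1) *\<^sub>R z x, \<lambda>x. (-1) *\<^sub>R c x)"
    using T V m unfolding bounded_linear_on_V_def by blast
  also have "T (\<lambda>x. (-1) *\<^sub>R z x, \<lambda>x. (-1) *\<^sub>R c x) = (-1) *\<^sub>R T (z, c)"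
    using T V unfolding bounded_linear_on_V_def by blast
  finally show "T (\<lambda>x. y x - z x, \<lambda>x. b x - c x) = T (y, b) - T (z, c)" by simp
qed

text \<open>A nonnegative constant, so that the bound survives when the norm is replaced by a
  majorant.\<close>

lemma bounded_linear_on_V_bound:
  assumes "bounded_linear_on_V L T"
  obtains C where "C \<ge> 0" "\<And>u. u \<in> V L \<Longrightarrow> norm (T u) \<le> C * V_norm L u"
proof -
  obtain C where C: "\<And>u. u \<in> V L \<Longrightarrow> norm (T u) \<le> C * V_norm L u"
    using assms unfolding bounded_linear_on_V_def by blast
  have n: "0 \<le> V_norm L u" for u by (cases u) (simp add: V_norm_pair)
  have "norm (T u) \<le> max C 0 * V_norm L u" if "u \<in> V L" for u
  proof (rule order_trans[OF C[OF that]])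
    show "C * V_norm L u \<le> max C 0 * V_norm L u" by (rule mult_right_mono[OF _ n]) simp
  qed
  then show ?thesis by (intro that[of "max C 0"]) auto
qed

text \<open>\<open>\<tau>\<close> stands for y, y' or b. Point evaluation is bounded through the sup
  bound in \<open>H1\<close>; linearity is asked for at the single point \<open>x\<close>, since
  \<open>cderiv\<close> is undetermined outside [0,L].\<close>

lemma bounded_linear_trace:
  fixes \<tau> :: "curve \<times> curve \<Rightarrow> curve"
  assumes x: "x \<in> {0..L}"
    and \<tau>: "\<And>y b. y \<in> H2 L \<Longrightarrow> b \<in> H1 L \<Longrightarrow> \<tau> (y, b) \<in> H1 L"
      "\<And>y b. y \<in> H2 L \<Longrightarrow> b \<in> H1 L \<Longrightarrow> H1_norm L (\<tau> (y, b)) \<le> H2_norm L y + H1_norm L b"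
    and add: "\<And>y b z c. y \<in> H2 L \<Longrightarrow> b \<in> H1 L \<Longrightarrow> z \<in> H2 L \<Longrightarrow> c \<in> H1 L \<Longrightarrow>
      \<tau> (\<lambda>x. y x + z x, \<lambda>x. b x + c x) x = \<tau> (y, b) x + \<tau> (z, c) x"
    and scaleR: "\<And>r y b. y \<in> H2 L \<Longrightarrow> b \<in> H1 L \<Longrightarrow> \<tau> (\<lambda>x. r *\<^sub>R y x, \<lambda>x. r *\<^sub>R b x) x = r *\<^sub>R \<tau> (y, b) x"
  shows "bounded_linear_on_V L (\<lambda>u. \<tau> u x \<bullet> e)"
proof (rule bounded_linear_on_V_I[where C="(1 / sqrt L + sqrt L) * norm e"])
  fix y b :: curve assume V: "y \<in> H2 L" "b \<in> H1 L"
  have "\<bar>\<tau> (y, b) x \<bullet> e\<bar> \<le> norm (\<tau> (y, b) x) * norm e" by (rule Cauchy_Schwarz_ineq2)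
  also have "norm (\<tau> (y, b) x) \<le> (1 / sqrt L + sqrt L) * H1_norm L (\<tau> (y, b))"
    by (rule H1_sup_bound[OF \<tau>(1)[OF V] x])
  also have "\<dots> \<le> (1 / sqrt L + sqrt L) * (H2_norm L y + H1_norm L b)"
    using L_pos by (intro mult_left_mono \<tau>(2)[OF V]) auto
  finally show "norm (\<tau> (y, b) x \<bullet> e) \<le> (1 / sqrt L + sqrt L) * norm e * (H2_norm L y + H1_norm L b)"
    by (simp add: mult_ac mult_right_mono)
qed (simp_all add: add scaleR inner_add_left)

text \<open>\<open>\<gamma>\<close> stands for y'' or b', which are additive only almost everywhere;
  the integral does not see the exceptional sets.\<close>

lemma bounded_linear_pairing:
  fixes \<gamma> :: "curve \<times> curve \<Rightarrow> curve"
  assumes \<xi>: "\<xi> \<in> L2 L"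
    and \<gamma>: "\<And>y b. y \<in> H2 L \<Longrightarrow> b \<in> H1 L \<Longrightarrow> \<gamma> (y, b) \<in> L2 L"
      "\<And>y b. y \<in> H2 L \<Longrightarrow> b \<in> H1 L \<Longrightarrow> L2_norm L (\<gamma> (y, b)) \<le> H2_norm L y + H1_norm L b"
    and add: "\<And>y b z c. y \<in> H2 L \<Longrightarrow> b \<in> H1 L \<Longrightarrow> z \<in> H2 L \<Longrightarrow> c \<in> H1 L \<Longrightarrow>
      AE x in Om L. \<gamma> (\<lambda>x. y x + z x, \<lambda>x. b x + c x) x = \<gamma> (y, b) x + \<gamma> (z, c) x"
    and scaleR: "\<And>r y b. y \<in> H2 L \<Longrightarrow> b \<in> H1 L \<Longrightarrow>
      AE x in Om L. \<gamma> (\<lambda>x. r *\<^sub>R y x, \<lambda>x. r *\<^sub>R b x) x = r *\<^sub>R \<gamma> (y, b) x"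
  shows "bounded_linear_on_V L (\<lambda>u. LINT x|Om L. \<xi> x \<bullet> \<gamma> u x)"
proof (rule bounded_linear_on_V_I[where C="L2_norm L \<xi>"])
  fix y b z c :: curve and r :: real assume V: "y \<in> H2 L" "b \<in> H1 L"
  have "\<bar>LINT x|Om L. \<xi> x \<bullet> \<gamma> (y, b) x\<bar> \<le> L2_norm L \<xi> * L2_norm L (\<gamma> (y, b))"
    by (rule L2_Cauchy_Schwarz[OF \<xi> \<gamma>(1)[OF V]])
  also have "\<dots> \<le> L2_norm L \<xi> * (H2_norm L y + H1_norm L b)"
    by (intro mult_left_mono \<gamma>(2)[OF V] L2_norm_nonneg)
  finally show "norm (LINT x|Om L. \<xi> x \<bullet> \<gamma> (y, b) x) \<le> L2_norm L \<xi> * (H2_norm L y + H1_norm L b)" by simp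
  have "(LINT x|Om L. \<xi> x \<bullet> \<gamma> (\<lambda>x. r *\<^sub>R y x, \<lambda>x. r *\<^sub>R b x) x) = (LINT x|Om L. \<xi> x \<bullet> r *\<^sub>R \<gamma> (y, b) x)"
    using scaleR[OF V, of r] V
    by (intro integral_cong_AE borel_measurable_integrable L2_inner_integrable \<xi> \<gamma>(1) H2_scaleR(1) H1_scaleR(1) L2_scaleR) auto
  then show "(LINT x|Om L. \<xi> x \<bullet> \<gamma> (\<lambda>x. r *\<^sub>R y x, \<lambda>x. r *\<^sub>R b x) x) = r *\<^sub>R (LINT x|Om L. \<xi> x \<bullet> \<gamma> (y, b) x)"
    by simp
  assume V': "z \<in> H2 L" "c \<in> H1 L"
  have "(LINT x|Om L. \<xi> x \<bullet> \<gamma> (\<lambda>x. y x + z x, \<lambda>x. b x + c x) x) = (LINT x|Om L. \<xi> x \<bullet> (\<gamma> (y, b) x + \<gamma> (z, c) x))"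
    using add[OF V V'] V V'
    by (intro integral_cong_AE borel_measurable_integrable L2_inner_integrable \<xi> \<gamma>(1) H2_add(1) H1_add(1) L2_add) auto
  also have "\<dots> = (LINT x|Om L. \<xi> x \<bullet> \<gamma> (y, b) x) + (LINT x|Om L. \<xi> x \<bullet> \<gamma> (z, c) x)"
    using L2_inner_integrable[OF \<xi> \<gamma>(1)[OF V]] L2_inner_integrable[OF \<xi> \<gamma>(1)[OF V']] by (simp add: inner_add_right)
  finally show "(LINT x|Om L. \<xi> x \<bullet> \<gamma> (\<lambda>x. y x + z x, \<lambda>x. b x + c x) x)
     = (LINT x|Om L. \<xi> x \<bullet> \<gamma> (y, b) x) + (LINT x|Om L. \<xi> x \<bullet> \<gamma> (z, c) x)" .
qed

text \<open>Vector-valued limits are reduced to components, since the trace functionals are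
  real-valued evaluations against a basis vector.\<close>

lemma weakly_convergesD:
  fixes Y B :: "'i \<Rightarrow> curve"
  assumes w: "weakly_converges L (\<lambda>i. (Y i, B i)) (y, b) F"
  shows "x \<in> {0..L} \<Longrightarrow> ((\<lambda>i. cderiv L (Y i) x) \<longlongrightarrow> cderiv L y x) F"
    "x \<in> {0..L} \<Longrightarrow> ((\<lambda>i. Y i x) \<longlongrightarrow> y x) F"
    "x \<in> {0..L} \<Longrightarrow> ((\<lambda>i. B i x) \<longlongrightarrow> b x) F"
    "\<xi> \<in> L2 L \<Longrightarrow> ((\<lambda>i. LINT x|Om L. \<xi> x \<bullet> wderiv L (B i) x) \<longlongrightarrow> (LINT x|Om L. \<xi> x \<bullet> wderiv L b x)) F"
    "\<xi> \<in> L2 L \<Longrightarrow> ((\<lambda>i. LINT x|Om L. \<xi> x \<bullet> wderiv L (cderiv L (Y i)) x) \<longlongrightarrow> (LINT x|Om L. \<xi> x \<bullet> wderiv L (cderiv L y) x)) F"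
proof -
  have *: "((\<lambda>i. f (Y i, B i)) \<longlongrightarrow> f (y, b)) F" if "bounded_linear_on_V L f" for f :: "curve \<times> curve \<Rightarrow> real"
    using w that by (auto simp: weakly_converges_def)
  note mono = add_increasing2[OF H1_norm_nonneg] add_increasing[OF H2_norm_nonneg]
  show "((\<lambda>i. cderiv L (Y i) x) \<longlongrightarrow> cderiv L y x) F" if x: "x \<in> {0..L}"
    using *[OF bounded_linear_trace[OF x, of "\<lambda>u. cderiv L (fst u)"]]
    by (subst tendsto_componentwise_iff)
       (simp add: mono H2_cderiv(1) H1_norm_cderiv_le_H2_norm H2_add(2)[OF _ _ x] H2_scaleR(2)[OF _ x])
  show "((\<lambda>i. Y i x) \<longlongrightarrow> y x) F" if x: "x \<in> {0..L}"
    using *[OF bounded_linear_trace[OF x, of fst]]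
    by (subst tendsto_componentwise_iff) (simp add: mono H2_H1 H1_norm_le_H2_norm)
  show "((\<lambda>i. B i x) \<longlongrightarrow> b x) F" if x: "x \<in> {0..L}"
    using *[OF bounded_linear_trace[OF x, of snd]] by (subst tendsto_componentwise_iff) simp
  show "((\<lambda>i. LINT x|Om L. \<xi> x \<bullet> wderiv L (B i) x) \<longlongrightarrow> (LINT x|Om L. \<xi> x \<bullet> wderiv L b x)) F" if \<xi>: "\<xi> \<in> L2 L"
    using *[OF bounded_linear_pairing[OF \<xi>, of "\<lambda>u. wderiv L (snd u)"]]
    by (simp add: mono wderiv_H1(1) L2_le_H1_norm(2) H1_add(2) H1_scaleR(2))
  show "((\<lambda>i. LINT x|Om L. \<xi> x \<bullet> wderiv L (cderiv L (Y i)) x) \<longlongrightarrow> (LINT x|Om L. \<xi> x \<bullet> wderiv L (cderiv L y) x)) F" if \<xi>: "\<xi> \<in> L2 L"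
    using *[OF bounded_linear_pairing[OF \<xi>, of "\<lambda>u. wderiv L (cderiv L (fst u))"]]
    by (simp add: mono wderiv_H1(1) H2_cderiv(1) L2_le_H2_norm(3) H2_add(3) H2_scaleR(3))
qed

end

section \<open>Hermite interpolation\<close>

text \<open>Hermite interpolation in Newton form: \<open>herm2\<close> and \<open>herm3\<close> are the divided differences at the
  nodes \<open>a, a, b\<close> and \<open>a, a, b, b\<close>.\<close>

definition herm2 :: "real \<Rightarrow> real \<Rightarrow> 'a \<Rightarrow> 'a \<Rightarrow> 'a \<Rightarrow> 'a::real_normed_vector" where
  "herm2 a b ya yb sa = (1 / (b - a)\<^sup>2) *\<^sub>R (yb - ya - (b - a) *\<^sub>R sa)"

definition herm3 :: "real \<Rightarrow> real \<Rightarrow> 'a \<Rightarrow> 'a \<Rightarrow> 'a \<Rightarrow> 'a \<Rightarrow> 'a::real_normed_vector" where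
  "herm3 a b ya yb sa sb = (1 / (b - a)\<^sup>2) *\<^sub>R (sb - sa - (2 * (b - a)) *\<^sub>R herm2 a b ya yb sa)"

definition hermite :: "real \<Rightarrow> real \<Rightarrow> 'a \<Rightarrow> 'a \<Rightarrow> 'a \<Rightarrow> 'a \<Rightarrow> real \<Rightarrow> 'a::real_normed_vector" where
  "hermite a b ya yb sa sb x = ya + (x - a) *\<^sub>R sa + (x - a)\<^sup>2 *\<^sub>R herm2 a b ya yb sa
     + ((x - a)\<^sup>2 * (x - b)) *\<^sub>R herm3 a b ya yb sa sb"

definition hermite_d :: "real \<Rightarrow> real \<Rightarrow> 'a \<Rightarrow> 'a \<Rightarrow> 'a \<Rightarrow> 'a \<Rightarrow> real \<Rightarrow> 'a::real_normed_vector" where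
  "hermite_d a b ya yb sa sb x = sa + (2 * (x - a)) *\<^sub>R herm2 a b ya yb sa
     + (2 * (x - a) * (x - b) + (x - a)\<^sup>2) *\<^sub>R herm3 a b ya yb sa sb"

definition hermite_dd :: "real \<Rightarrow> real \<Rightarrow> 'a \<Rightarrow> 'a \<Rightarrow> 'a \<Rightarrow> 'a \<Rightarrow> real \<Rightarrow> 'a::real_normed_vector" where
  "hermite_dd a b ya yb sa sb x = 2 *\<^sub>R herm2 a b ya yb sa
     + (2 * (x - b) + 4 * (x - a)) *\<^sub>R herm3 a b ya yb sa sb"

lemma hermite_deriv:
  "(hermite a b ya yb sa sb has_vector_derivative hermite_d a b ya yb sa sb x) (at x within S)"
  unfolding hermite_def hermite_d_def
  by (auto intro!: derivative_eq_intros simp: algebra_simps power2_eq_square)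

lemma hermite_d_deriv:
  "(hermite_d a b ya yb sa sb has_vector_derivative hermite_dd a b ya yb sa sb x) (at x within S)"
  unfolding hermite_d_def hermite_dd_def
  by (auto intro!: derivative_eq_intros simp: algebra_simps power2_eq_square)

lemma hermite_left [simp]: "hermite a b ya yb sa sb a = ya" "hermite_d a b ya yb sa sb a = sa"
  by (simp_all add: hermite_def hermite_d_def)

lemma hermite_right:
  assumes "a < b"
  shows "hermite a b ya yb sa sb b = yb" "hermite_d a b ya yb sa sb b = sb"
proof -
  show "hermite a b ya yb sa sb b = yb"
    using assms by (simp add: hermite_def herm2_def)
  have "(b - a)\<^sup>2 *\<^sub>R herm3 a b ya yb sa sb = sb - sa - (2 * (b - a)) *\<^sub>R herm2 a b ya yb sa"
    using assms by (simp add: herm3_def)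
  then show "hermite_d a b ya yb sa sb b = sb" by (simp add: hermite_d_def)
qed

lemma continuous_on_hermite: "continuous_on S (hermite a b ya yb sa sb)"
  "continuous_on S (hermite_d a b ya yb sa sb)" "continuous_on S (hermite_dd a b ya yb sa sb)"
proof -
  show "continuous_on S (hermite a b ya yb sa sb)" unfolding hermite_def by (intro continuous_intros)
  show "continuous_on S (hermite_d a b ya yb sa sb)" unfolding hermite_d_def by (intro continuous_intros)
  show "continuous_on S (hermite_dd a b ya yb sa sb)" unfolding hermite_dd_def by (intro continuous_intros)
qed

context bounded_interval
begin

text \<open>A common bound on [0,L] for the interpolant and its first two derivatives; each
  coefficient collects the three contributions, for instance L^2, 2 L and 2 for
  \<open>herm2\<close>. It is linear in the norms of the divided differences, so it vanishes in the
  limit together with the data.\<close>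

definition hermite_size :: "real^3 \<Rightarrow> real^3 \<Rightarrow> real^3 \<Rightarrow> real^3 \<Rightarrow> real" where
  "hermite_size ya yb sa sb = norm ya + (1 + L) * norm sa
     + (2 + 2 * L + L\<^sup>2) * norm (herm2 0 L ya yb sa)
     + (6 * L + 3 * L\<^sup>2 + L^3) * norm (herm3 0 L ya yb sa sb)"

lemma hermite_size_bounds:
  assumes x: "x \<in> {0..L}"
  shows "norm (hermite 0 L ya yb sa sb x) \<le> hermite_size ya yb sa sb"
    "norm (hermite_d 0 L ya yb sa sb x) \<le> hermite_size ya yb sa sb"
    "norm (hermite_dd 0 L ya yb sa sb x) \<le> hermite_size ya yb sa sb"
proof -
  define A B C D where "A = norm ya" and "B = norm sa" and "C = norm (herm2 0 L ya yb sa)"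
    and "D = norm (herm3 0 L ya yb sa sb)"
  have pos: "0 \<le> A" "0 \<le> B" "0 \<le> C" "0 \<le> D" by (auto simp: A_def B_def C_def D_def)
  have xs: "0 \<le> x" "x \<le> L" "x\<^sup>2 \<le> L\<^sup>2" "\<bar>x - L\<bar> \<le> L" using x by (auto intro: power_mono)
  have LL: "0 \<le> L" "0 \<le> L\<^sup>2" "0 \<le> L^3" using L_pos by auto
  have size: "hermite_size ya yb sa sb = A + (B + L * B) + (2 * C + 2 * L * C + L\<^sup>2 * C) + (6 * L * D + 3 * L\<^sup>2 * D + L^3 * D)"
    by (simp add: hermite_size_def A_def B_def C_def D_def algebra_simps)
  have LX: "0 \<le> L * B" "0 \<le> L * C" "0 \<le> L\<^sup>2 * C" "0 \<le> L * D" "0 \<le> L\<^sup>2 * D" "0 \<le> L^3 * D"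
    using pos LL by (auto intro: mult_nonneg_nonneg)
  have tri3: "norm (a + b + c) \<le> norm a + norm b + norm c" for a b c :: "real^3"
    by (meson norm_triangle_ineq norm_triangle_le add_mono order_refl order_trans)
  have c3: "\<bar>x\<^sup>2 * (x - L)\<bar> \<le> L^3"
  proof -
    have "\<bar>x\<^sup>2 * (x - L)\<bar> = x\<^sup>2 * \<bar>x - L\<bar>" by (simp add: abs_mult)
    also have "\<dots> \<le> L\<^sup>2 * L" using xs by (intro mult_mono) auto
    finally show ?thesis by (simp add: power2_eq_square power3_eq_cube)
  qed
  have "norm (hermite 0 L ya yb sa sb x) \<le> norm (ya + x *\<^sub>R sa) + norm (x\<^sup>2 *\<^sub>R herm2 0 L ya yb sa)
      + norm ((x\<^sup>2 * (x - L)) *\<^sub>R herm3 0 L ya yb sa sb)"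
    unfolding hermite_def diff_0_right by (rule tri3)
  also have "\<dots> \<le> (A + L * B) + L\<^sup>2 * C + L^3 * D"
  proof (intro add_mono)
    have "norm (ya + x *\<^sub>R sa) \<le> A + x * B"
      using norm_triangle_ineq[of ya "x *\<^sub>R sa"] xs by (simp add: A_def B_def)
    also have "\<dots> \<le> A + L * B" using xs pos by (intro add_left_mono mult_right_mono)
    finally show "norm (ya + x *\<^sub>R sa) \<le> A + L * B" .
    show "norm (x\<^sup>2 *\<^sub>R herm2 0 L ya yb sa) \<le> L\<^sup>2 * C"
      using xs by (simp add: C_def mult_right_mono)
    show "norm ((x\<^sup>2 * (x - L)) *\<^sub>R herm3 0 L ya yb sa sb) \<le> L^3 * D"
      unfolding norm_scaleR D_def by (intro mult_right_mono c3) simp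
  qed
  finally show "norm (hermite 0 L ya yb sa sb x) \<le> hermite_size ya yb sa sb"
    unfolding size using LX pos by linarith
  have d3: "\<bar>2 * x * (x - L) + x\<^sup>2\<bar> \<le> 3 * L\<^sup>2"
  proof -
    have "\<bar>2 * x * (x - L) + x\<^sup>2\<bar> \<le> 2 * (x * \<bar>x - L\<bar>) + x\<^sup>2"
      using abs_triangle_ineq[of "2 * x * (x - L)" "x\<^sup>2"] xs by (simp add: abs_mult)
    also have "x * \<bar>x - L\<bar> \<le> L * L" using xs by (intro mult_mono) auto
    finally show ?thesis using xs by (simp add: power2_eq_square)
  qed
  have "norm (hermite_d 0 L ya yb sa sb x) \<le> norm sa + norm ((2 * x) *\<^sub>R herm2 0 L ya yb sa)
      + norm ((2 * x * (x - L) + x\<^sup>2) *\<^sub>R herm3 0 L ya yb sa sb)"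
    unfolding hermite_d_def diff_0_right by (rule tri3)
  also have "\<dots> \<le> B + (2 * L) * C + 3 * L\<^sup>2 * D"
  proof (intro add_mono)
    show "norm ((2 * x) *\<^sub>R herm2 0 L ya yb sa) \<le> (2 * L) * C"
      unfolding norm_scaleR C_def using xs by (intro mult_right_mono) auto
    show "norm ((2 * x * (x - L) + x\<^sup>2) *\<^sub>R herm3 0 L ya yb sa sb) \<le> 3 * L\<^sup>2 * D"
      unfolding norm_scaleR D_def by (intro mult_right_mono d3) simp
  qed (simp add: B_def)
  finally show "norm (hermite_d 0 L ya yb sa sb x) \<le> hermite_size ya yb sa sb"
    unfolding size using LX pos by linarith
  have "norm (hermite_dd 0 L ya yb sa sb x) \<le> norm (2 *\<^sub>R herm2 0 L ya yb sa)
      + norm ((2 * (x - L) + 4 * x) *\<^sub>R herm3 0 L ya yb sa sb)"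
    unfolding hermite_dd_def diff_0_right by (rule norm_triangle_ineq)
  also have "\<dots> \<le> 2 * C + 6 * L * D"
  proof (intro add_mono)
    show "norm ((2 * (x - L) + 4 * x) *\<^sub>R herm3 0 L ya yb sa sb) \<le> 6 * L * D"
      unfolding norm_scaleR D_def using xs by (intro mult_right_mono) auto
  qed (simp add: C_def)
  finally show "norm (hermite_dd 0 L ya yb sa sb x) \<le> hermite_size ya yb sa sb"
    unfolding size using LX pos by linarith
qed

lemma hermite_H2:
  fixes ya yb sa sb :: "real^3"
  shows "hermite 0 L ya yb sa sb \<in> H2 L"
    "\<And>x. x \<in> {0..L} \<Longrightarrow> cderiv L (hermite 0 L ya yb sa sb) x = hermite_d 0 L ya yb sa sb x"
    "H2_norm L (hermite 0 L ya yb sa sb) \<le> 3 * hermite_size ya yb sa sb * sqrt L"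
proof -
  note c = H2_classical[where u="hermite 0 L ya yb sa sb" and S="{}",
      OF continuous_on_hermite(1) hermite_deriv continuous_on_hermite(2) finite.emptyI hermite_d_deriv
        hermite_size_bounds(3)]
  show 1: "hermite 0 L ya yb sa sb \<in> H2 L" by (rule c(1)) auto
  show 2: "cderiv L (hermite 0 L ya yb sa sb) x = hermite_d 0 L ya yb sa sb x" if "x \<in> {0..L}" for x
    by (rule c(2)) (use that in auto)
  have 3: "AE x in Om L. wderiv L (cderiv L (hermite 0 L ya yb sa sb)) x = hermite_dd 0 L ya yb sa sb x"
    by (rule c(3)) auto
  have "norm (hermite 0 L ya yb sa sb 0) \<le> hermite_size ya yb sa sb"
    using L_pos by (intro hermite_size_bounds) auto
  then have 0: "0 \<le> hermite_size ya yb sa sb" by (rule order_trans[OF norm_ge_zero])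
  show "H2_norm L (hermite 0 L ya yb sa sb) \<le> 3 * hermite_size ya yb sa sb * sqrt L"
  proof (rule H2_norm_bound[OF 1 0])
    have "AE x in Om L. x \<in> {0<..<L}" by (rule AE_Om_I) auto
    with 3 show "AE x in Om L. norm (wderiv L (cderiv L (hermite 0 L ya yb sa sb)) x) \<le> hermite_size ya yb sa sb"
      by eventually_elim (auto intro: hermite_size_bounds)
  qed (use hermite_size_bounds 2 in auto)
qed

lemma affine_H1:
  fixes p q :: "real^3"
  defines "u \<equiv> \<lambda>x. p + x *\<^sub>R q"
  shows "u \<in> H1 L" "H1_norm L u \<le> 2 * (norm p + (1 + L) * norm q) * sqrt L"
proof -
  have c: "u \<in> H1 L" "AE x in Om L. wderiv L u x = q"
    by (rule H1_classical[where S="{}" and B="norm q" and w="\<lambda>_. q"];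
        auto simp: u_def intro!: continuous_intros derivative_eq_intros)+
  show "u \<in> H1 L" by fact
  show "H1_norm L u \<le> 2 * (norm p + (1 + L) * norm q) * sqrt L"
  proof (rule H1_norm_bound[OF c(1)])
    show "0 \<le> norm p + (1 + L) * norm q" using L_pos by simp
    have Lq: "0 \<le> L * norm q" using L_pos by simp
    show "norm (u x) \<le> norm p + (1 + L) * norm q" if "x \<in> {0..L}" for x
    proof -
      have "norm (u x) \<le> norm p + x * norm q"
        using norm_triangle_ineq[of p "x *\<^sub>R q"] that by (simp add: u_def)
      also have "x * norm q \<le> norm q + L * norm q"
        using that by (intro add_increasing mult_right_mono) auto
      finally show ?thesis by (simp add: algebra_simps)
    qed
    show "AE x in Om L. norm (wderiv L u x) \<le> norm p + (1 + L) * norm q"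
      using c(2) by eventually_elim (use Lq in \<open>simp add: algebra_simps\<close>)
  qed
qed

text \<open>\<open>T\<close> sees only the Hermite and affine interpolants of the boundary data, so it factors through
  finitely many numbers and weak convergence suffices.\<close>

lemma boundary_operator_tendsto:
  fixes T :: "curve \<times> curve \<Rightarrow> 'w::real_normed_vector" and Y B :: "'i \<Rightarrow> curve"
  assumes T: "bounded_linear_on_V L T" and dep: "depends_only_on_boundary_values L T"
    and V: "\<And>i. (Y i, B i) \<in> V L" "(y, b) \<in> V L"
    and conv: "\<And>x. x \<in> {0, L} \<Longrightarrow> ((\<lambda>i. Y i x) \<longlongrightarrow> y x) F"
      "\<And>x. x \<in> {0, L} \<Longrightarrow> ((\<lambda>i. cderiv L (Y i) x) \<longlongrightarrow> cderiv L y x) F"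
      "\<And>x. x \<in> {0, L} \<Longrightarrow> ((\<lambda>i. B i x) \<longlongrightarrow> b x) F"
  shows "((\<lambda>i. T (Y i, B i)) \<longlongrightarrow> T (y, b)) F"
proof -
  \<comment> \<open>By linearity it suffices to treat the differences, whose boundary data tend to
    0.\<close>
  define d where "d i x = Y i x - y x" for i x
  define s where "s i x = cderiv L (Y i) x - cderiv L y x" for i x
  define \<beta> where "\<beta> i x = B i x - b x" for i x
  define P where "P i = hermite 0 L (d i 0) (d i L) (s i 0) (s i L)" for i
  define q where "q i = (1 / L) *\<^sub>R (\<beta> i L - \<beta> i 0)" for i
  define A where "A i = (\<lambda>x. \<beta> i 0 + x *\<^sub>R q i)" for i
  have d0: "((\<lambda>i. d i x) \<longlongrightarrow> 0) F" "((\<lambda>i. s i x) \<longlongrightarrow> 0) F" "((\<lambda>i. \<beta> i x) \<longlongrightarrow> 0) F"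
    if "x \<in> {0, L}" for x
    using conv[OF that] unfolding d_def s_def \<beta>_def by (auto simp: LIM_zero_iff)
  have T_diff: "T (Y i, B i) - T (y, b) = T (P i, A i)" and PA: "(P i, A i) \<in> V L" for i
  proof -
    note D = bounded_linear_on_V_diff[OF T V(1)[of i] V(2)]
    show PA: "(P i, A i) \<in> V L"
      using hermite_H2(1) affine_H1(1) by (simp add: V_iff P_def A_def)
    have m: "Y i \<in> H2 L" "y \<in> H2 L" using V by (auto simp: V_iff)
    have "cderiv L (\<lambda>x. Y i x - y x) x = s i x" if "x \<in> {0..L}" for x
      using H2_add(2)[OF m(1) H2_scaleR(1)[OF m(2)] that, of "-1"] H2_scaleR(2)[OF m(2) that, of "-1"]
      by (simp add: s_def)
    then have "\<forall>x\<in>{0, L}. Y i x - y x = P i x \<and> cderiv L (\<lambda>x. Y i x - y x) x = cderiv L (P i) x \<and> B i x - b x = A i x"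
      using L_pos by (auto simp: hermite_H2(2) hermite_right[OF L_pos] P_def A_def d_def q_def \<beta>_def)
    then have "T (\<lambda>x. Y i x - y x, \<lambda>x. B i x - b x) = T (P i, A i)"
      using dep D(1) PA unfolding depends_only_on_boundary_values_def by blast
    then show "T (Y i, B i) - T (y, b) = T (P i, A i)" using D(2) by simp
  qed
  obtain C where C: "C \<ge> 0" "\<And>u. u \<in> V L \<Longrightarrow> norm (T u) \<le> C * V_norm L u"
    using bounded_linear_on_V_bound[OF T] by blast
  \<comment> \<open>An explicit majorant built from finitely many boundary vectors, each of which
    tends to 0.\<close>
  define K where "K i = C * (3 * hermite_size (d i 0) (d i L) (s i 0) (s i L) * sqrt L
      + 2 * (norm (\<beta> i 0) + (1 + L) * norm (q i)) * sqrt L)" for i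
  have TK: "norm (T (Y i, B i) - T (y, b)) \<le> K i" for i
  proof -
    have "norm (T (P i, A i)) \<le> C * (H2_norm L (P i) + H1_norm L (A i))"
      using C(2)[OF PA[of i]] by (simp add: V_norm_pair)
    also have "\<dots> \<le> K i"
      unfolding K_def P_def A_def by (intro mult_left_mono add_mono hermite_H2(3) affine_H1(2) C)
    finally show ?thesis by (simp add: T_diff)
  qed
  have K0: "(K \<longlongrightarrow> 0) F"
  proof -
    have h2: "((\<lambda>i. herm2 0 L (d i 0) (d i L) (s i 0)) \<longlongrightarrow> 0) F"
      unfolding herm2_def by (auto intro!: tendsto_eq_intros d0)
    have h3: "((\<lambda>i. herm3 0 L (d i 0) (d i L) (s i 0) (s i L)) \<longlongrightarrow> 0) F"
      unfolding herm3_def by (auto intro!: tendsto_eq_intros d0 h2)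
    have qq: "(q \<longlongrightarrow> 0) F"
      unfolding q_def by (auto intro!: tendsto_eq_intros d0)
    note d00 = d0[of 0, simplified] d0[of L, simplified]
    have "(K \<longlongrightarrow> C * (3 * (norm (0::real^3) + (1 + L) * norm (0::real^3)
        + (2 + 2 * L + L\<^sup>2) * norm (0::real^3) + (6 * L + 3 * L\<^sup>2 + L^3) * norm (0::real^3)) * sqrt L
      + 2 * (norm (0::real^3) + (1 + L) * norm (0::real^3)) * sqrt L)) F"
      unfolding K_def hermite_size_def
      by (intro tendsto_mult tendsto_add tendsto_norm tendsto_const d00 h2 h3 qq)
    then show ?thesis by simp
  qed
  have "((\<lambda>i. T (Y i, B i) - T (y, b)) \<longlongrightarrow> 0) F"
    by (rule Lim_null_comparison[OF always_eventually K0]) (simp add: TK)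
  then show ?thesis by (rule LIM_zero_cancel)
qed

end

section \<open>The lower bound\<close>

lemma regularized_modulusD:
  assumes "regularized_modulus c0 c1 c2 cuni m" "\<delta> > 0"
  shows "0 \<le> m \<delta> x" "\<bar>m \<delta> x - \<bar>x\<bar>\<bar> \<le> cuni * \<delta>" "m \<delta> \<in> borel_measurable borel"
proof -
  have a: "m \<delta> differentiable at x" for x using assms by (simp add: regularized_modulus_def)
  then have "continuous_on UNIV (m \<delta>)"
    by (intro differentiable_imp_continuous_on) (simp add: differentiable_on_def)
  then show "m \<delta> \<in> borel_measurable borel" by (rule borel_measurable_continuous_onI)
  show "0 \<le> m \<delta> x" "\<bar>m \<delta> x - \<bar>x\<bar>\<bar> \<le> cuni * \<delta>" using assms by (simp_all add: regularized_modulus_def)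
qed

context bounded_interval
begin

section \<open>Integrability of the densities and the energy as a real number\<close>

lemma L2_dominated:
  fixes f :: "real \<Rightarrow> 'a::euclidean_space" and g :: "real \<Rightarrow> 'b::euclidean_space"
  assumes [measurable]: "f \<in> borel_measurable (Om L)" and g: "g \<in> L2 L"
    and le: "\<And>x. x \<in> {0<..<L} \<Longrightarrow> norm (f x) \<le> M * norm (g x)" and M: "0 \<le> M"
  shows "f \<in> L2 L"
proof -
  have "integrable (Om L) (\<lambda>x. (norm (f x))\<^sup>2)"
  proof (rule Bochner_Integration.integrable_bound)
    show "integrable (Om L) (\<lambda>x. M\<^sup>2 * (norm (g x))\<^sup>2)"
      by (intro integrable_mult_right L2_integrable_square g)
    show "AE x in Om L. norm ((norm (f x))\<^sup>2) \<le> norm (M\<^sup>2 * (norm (g x))\<^sup>2)"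
    proof (rule AE_Om_I)
      fix x assume "x \<in> {0<..<L}"
      then have "(norm (f x))\<^sup>2 \<le> (M * norm (g x))\<^sup>2" by (intro power_mono le) auto
      then show "norm ((norm (f x))\<^sup>2) \<le> norm (M\<^sup>2 * (norm (g x))\<^sup>2)" by (simp add: power_mult_distrib)
    qed
  qed simp
  then show ?thesis by (simp add: L2_def)
qed

lemma Qbar_integrable:
  fixes p :: "real \<Rightarrow> 'a::euclidean_space" and q :: "real \<Rightarrow> 'b::euclidean_space"
  assumes p: "p \<in> L2 L" and q: "q \<in> L2 L"
  shows "integrable (Om L) (\<lambda>x. Qbar (norm (p x)) (norm (q x)))"
proof (rule Bochner_Integration.integrable_bound)
  note [measurable] = p[THEN L2_measurable] q[THEN L2_measurable]
  show "integrable (Om L) (\<lambda>x. 2 * (norm (p x))\<^sup>2 + 8 * (norm (q x))\<^sup>2)"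
    by (intro Bochner_Integration.integrable_add integrable_mult_right L2_integrable_square p q)
  show "(\<lambda>x. Qbar (norm (p x)) (norm (q x))) \<in> borel_measurable (Om L)"
    unfolding Qbar_def by measurable
  show "AE x in Om L. norm (Qbar (norm (p x)) (norm (q x))) \<le> norm (2 * (norm (p x))\<^sup>2 + 8 * (norm (q x))\<^sup>2)"
    using Qbar_le Qbar_nonneg by (intro AE_I2) simp
qed

text \<open>The integrand of the discrete functional without its factor 1/2, so that it approximates
  \<open>2 * Qbar\<close>.\<close>

definition bending :: "(real \<Rightarrow> real \<Rightarrow> real) \<Rightarrow> real \<Rightarrow> real^3 \<Rightarrow> real^3 \<Rightarrow> real" where
  "bending m \<delta> p q = (norm p)\<^sup>2 + 5 * (norm q)\<^sup>2 + psi m \<delta> ((norm p)\<^sup>2) ((norm q)\<^sup>2)"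

text \<open>Dropping the nonnegative \<open>psi\<close> gives coercivity. The closeness of
  \<open>psi\<close> and \<open>psi0\<close> with e = cuni \<delta> gives a distance to
  \<open>2 * Qbar\<close> that is uniform in both vectors.\<close>

lemma bending_props:
  assumes m: "regularized_modulus c0 c1 c2 cuni m" and \<delta>: "\<delta> > 0"
  shows "(norm p)\<^sup>2 + 5 * (norm q)\<^sup>2 \<le> bending m \<delta> p q"
    "\<bar>bending m \<delta> p q - 2 * Qbar (norm p) (norm q)\<bar> \<le> 5 * (cuni * \<delta>)"
    "0 \<le> bending m \<delta> p q"
proof -
  note r = regularized_modulusD[OF m \<delta>]
  have "0 \<le> psi m \<delta> ((norm p)\<^sup>2) ((norm q)\<^sup>2)" by (intro psi_nonneg r) auto
  then show "(norm p)\<^sup>2 + 5 * (norm q)\<^sup>2 \<le> bending m \<delta> p q" "0 \<le> bending m \<delta> p q"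
    by (simp_all add: bending_def)
  have "\<bar>psi m \<delta> ((norm p)\<^sup>2) ((norm q)\<^sup>2) - psi0 ((norm p)\<^sup>2) ((norm q)\<^sup>2)\<bar> \<le> 5 * (cuni * \<delta>)"
    by (intro psi_psi0_close r) auto
  moreover have "2 * Qbar (norm p) (norm q) = (norm p)\<^sup>2 + 5 * (norm q)\<^sup>2 + psi0 ((norm p)\<^sup>2) ((norm q)\<^sup>2)"
    by (simp add: Qbar_eq_psi0)
  ultimately show "\<bar>bending m \<delta> p q - 2 * Qbar (norm p) (norm q)\<bar> \<le> 5 * (cuni * \<delta>)"
    by (simp add: bending_def)
qed

lemma bending_integrable:
  assumes m: "regularized_modulus c0 c1 c2 cuni m" and \<delta>: "\<delta> > 0" and p: "p \<in> L2 L" and q: "q \<in> L2 L"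
  shows "integrable (Om L) (\<lambda>x. bending m \<delta> (p x) (q x))"
proof (rule Bochner_Integration.integrable_bound)
  note [measurable] = p[THEN L2_measurable] q[THEN L2_measurable] regularized_modulusD(3)[OF m \<delta>]
  have "integrable (Om L) (\<lambda>x. 5 * (cuni * \<delta>))" by (rule L2_integrable[OF L2_const])
  then show "integrable (Om L) (\<lambda>x. 2 * Qbar (norm (p x)) (norm (q x)) + 5 * (cuni * \<delta>))"
    using Qbar_integrable[OF p q] by (intro Bochner_Integration.integrable_add) simp_all
  show "(\<lambda>x. bending m \<delta> (p x) (q x)) \<in> borel_measurable (Om L)"
    unfolding bending_def psi_def by measurable
  show "AE x in Om L. norm (bending m \<delta> (p x) (q x)) \<le> norm (2 * Qbar (norm (p x)) (norm (q x)) + 5 * (cuni * \<delta>))"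
  proof (rule AE_I2)
    fix x
    show "norm (bending m \<delta> (p x) (q x)) \<le> norm (2 * Qbar (norm (p x)) (norm (q x)) + 5 * (cuni * \<delta>))"
      using bending_props(2,3)[OF m \<delta>, of "p x" "q x"] unfolding real_norm_def by linarith
  qed
qed

lemma square_inner_integrable:
  fixes z :: "real \<Rightarrow> real^3"
  assumes z: "continuous_on {0..L} z" and q: "q \<in> L2 L"
  shows "integrable (Om L) (\<lambda>x. (z x \<bullet> q x)\<^sup>2)" "(\<lambda>x. z x \<bullet> q x) \<in> L2 L"
proof -
  obtain M where M: "0 \<le> M" "\<And>x. x \<in> {0..L} \<Longrightarrow> norm (z x) \<le> M" using continuous_bound[OF z] by blast
  show l: "(\<lambda>x. z x \<bullet> q x) \<in> L2 L"
  proof (rule L2_dominated[OF _ q _ M(1)])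
    show "(\<lambda>x. z x \<bullet> q x) \<in> borel_measurable (Om L)"
      using measurable_Om_continuous[OF z] L2_measurable[OF q] by measurable
    show "norm (z x \<bullet> q x) \<le> M * norm (q x)" if "x \<in> {0<..<L}" for x
      using Cauchy_Schwarz_ineq2[of "z x" "q x"] mult_right_mono[OF M(2), of x "norm (q x)"] that by simp
  qed
  then show "integrable (Om L) (\<lambda>x. (z x \<bullet> q x)\<^sup>2)" using L2_integrable_square by fastforce
qed

text \<open>For an admissible pair in \<open>V\<close> all three integrals are finite, so the energy
  can be estimated without extended arithmetic.\<close>

lemma E_disc_eq:
  assumes m: "regularized_modulus c0 c1 c2 cuni m" and \<delta>: "\<delta> > 0" "\<epsilon>1 > 0" "\<epsilon>2 > 0"
    and V: "(y, b) \<in> V L" and adm: "(y, b) \<in> discrete_admissible L T lbc N X"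
  shows "E_disc L T lbc m \<delta> \<epsilon>1 \<epsilon>2 N X (y, b) =
    ennreal ((1 / 2) * (LINT x|Om L. bending m \<delta> (wderiv L (cderiv L y) x) (wderiv L b x))
      + (1 / (2 * \<epsilon>1)) * (LINT x|Om L. (cderiv L y x \<bullet> b x)\<^sup>2)
      + (1 / (2 * \<epsilon>2)) * (LINT x|Om L. (cderiv L y x \<bullet> wderiv L b x)\<^sup>2))"
proof -
  have y: "y \<in> H2 L" and b: "b \<in> H1 L" using V by (auto simp: V_iff)
  note p = wderiv_H1(1)[OF H2_cderiv(1)[OF y]] and q = wderiv_H1(1)[OF b]
    and z = H1_continuous[OF H2_cderiv(1)[OF y]] and bc = L2_continuous[OF H1_continuous[OF b]]
  note nn = bending_props(3)[OF m \<delta>(1)]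
  have "E_disc L T lbc m \<delta> \<epsilon>1 \<epsilon>2 N X (y, b)
    = ennreal (1 / 2) * (\<integral>\<^sup>+x. ennreal (bending m \<delta> (wderiv L (cderiv L y) x) (wderiv L b x)) \<partial>Om L)
       + ennreal (1 / (2 * \<epsilon>1)) * (\<integral>\<^sup>+x. ennreal ((cderiv L y x \<bullet> b x)\<^sup>2) \<partial>Om L)
       + ennreal (1 / (2 * \<epsilon>2)) * (\<integral>\<^sup>+x. ennreal ((cderiv L y x \<bullet> wderiv L b x)\<^sup>2) \<partial>Om L)"
    using adm by (simp add: E_disc_def bending_def)
  also have "\<dots> = ennreal (1 / 2) * ennreal (LINT x|Om L. bending m \<delta> (wderiv L (cderiv L y) x) (wderiv L b x))
       + ennreal (1 / (2 * \<epsilon>1)) * ennreal (LINT x|Om L. (cderiv L y x \<bullet> b x)\<^sup>2)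
       + ennreal (1 / (2 * \<epsilon>2)) * ennreal (LINT x|Om L. (cderiv L y x \<bullet> wderiv L b x)\<^sup>2)"
    using nn_integral_eq_integral[OF bending_integrable[OF m \<delta>(1) p q]]
      nn_integral_eq_integral[OF square_inner_integrable(1)[OF z bc]]
      nn_integral_eq_integral[OF square_inner_integrable(1)[OF z q]] nn by simp
  also have "ennreal r1 * ennreal s1 + ennreal r2 * ennreal s2 + ennreal r3 * ennreal s3
      = ennreal (r1 * s1 + r2 * s2 + r3 * s3)"
    if "0 \<le> r1" "0 \<le> s1" "0 \<le> r2" "0 \<le> s2" "0 \<le> r3" "0 \<le> s3" for r1 s1 r2 s2 r3 s3
    using that by (simp add: ennreal_mult)
  finally show ?thesis using \<delta> nn by simp
qed

section \<open>Partitions and functions with unit length at the nodes\<close>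

lemma partition_mesh_le:
  assumes p: "partition_with_mesh L h N X"
  shows "j < N \<Longrightarrow> X (Suc j) - X j \<le> h"
proof -
  assume "j < N"
  then have "X (Suc j) - X j \<le> Max ((\<lambda>j. X (Suc j) - X j) ` {..<N})" by (intro Max_ge) auto
  then show ?thesis using p by (simp add: partition_with_mesh_def)
qed

lemma partition_mono:
  assumes p: "partition_with_mesh L h N X" and "i \<le> j" "j \<le> N"
  shows "X i \<le> X j"
  using assms(2,3)
proof (induction j rule: dec_induct)
  case (step n)
  then have "X n < X (Suc n)" using p by (auto simp: partition_with_mesh_def)
  then show ?case using step by simp
qed simp

lemma partition_range:
  assumes p: "partition_with_mesh L h N X" and "j \<le> N"
  shows "X j \<in> {0..L}"
  using partition_mono[OF p, of 0 j] partition_mono[OF p, of j N] assms by (auto simp: partition_with_mesh_def)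

lemma mesh_bounds:
  assumes p: "partition_with_mesh L h N X"
  shows "0 < h" "h \<le> L" "j < N \<Longrightarrow> X j < X (Suc j)" "j < N \<Longrightarrow> {X j..X (Suc j)} \<subseteq> {0..L}"
proof -
  have P: "0 < N" "\<And>j. j < N \<Longrightarrow> X j < X (Suc j)" using p by (auto simp: partition_with_mesh_def)
  then show "j < N \<Longrightarrow> X j < X (Suc j)" by blast
  show "0 < h" using partition_mesh_le[OF p P(1)] P(2)[OF P(1)] by linarith
  have "h \<in> (\<lambda>j. X (Suc j) - X j) ` {..<N}"
    using p P(1) Max_in[of "(\<lambda>j. X (Suc j) - X j) ` {..<N}"] by (auto simp: partition_with_mesh_def)
  then obtain k where "k < N" "h = X (Suc k) - X k" by auto
  then show "h \<le> L" using partition_range[OF p, of k] partition_range[OF p, of "Suc k"] by auto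
  show "{X j..X (Suc j)} \<subseteq> {0..L}" if "j < N"
    using partition_range[OF p, of j] partition_range[OF p, of "Suc j"] that by auto
qed

lemma partition_element:
  assumes p: "partition_with_mesh L h N X" and x: "x \<in> {0..L}"
  obtains j where "j < N" "X j \<le> x" "x \<le> X (Suc j)"
proof -
  \<comment> \<open>The first node that is not left of x; unless x = 0, its predecessor lies
    strictly to the left of x.\<close>
  define k where "k = (LEAST k. x \<le> X k)"
  have N: "0 < N" "X 0 = 0" "X N = L" using p by (auto simp: partition_with_mesh_def)
  have k: "x \<le> X k" unfolding k_def by (rule LeastI[of _ N]) (use N x in auto)
  have kN: "k \<le> N" unfolding k_def by (rule Least_le) (use N x in auto)
  show thesis
  proof (cases k)
    case 0
    then have "x = 0" using k x N by auto
    then show ?thesis using that[of 0] N p by (auto simp: partition_with_mesh_def less_imp_le)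
  next
    case (Suc j)
    have "\<not> x \<le> X j" using not_less_Least[of j "\<lambda>k. x \<le> X k"] Suc by (simp add: k_def)
    then show ?thesis using that[of j] Suc k kN by auto
  qed
qed

text \<open>Comparison with the left node of the element containing x: Hoelder continuity over a
  length of at most h.\<close>

lemma nodal_unit_close:
  assumes p: "partition_with_mesh L h N X" and u: "u \<in> H1 L" and n: "\<And>j. j \<le> N \<Longrightarrow> norm (u (X j)) = 1"
    and x: "x \<in> {0..L}"
  shows "\<bar>norm (u x) - 1\<bar> \<le> sqrt h * L2_norm L (wderiv L u)"
proof -
  obtain j where j: "j < N" "X j \<le> x" "x \<le> X (Suc j)" using partition_element[OF p x] by blast
  have "\<bar>norm (u x) - 1\<bar> \<le> norm (u x - u (X j))"
    using n[of j] j norm_triangle_ineq3[of "u x" "u (X j)"] by simp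
  also have "\<dots> \<le> sqrt \<bar>x - X j\<bar> * L2_norm L (wderiv L u)"
    by (rule H1_Hoelder[OF u partition_range[OF p] x]) (use j in simp)
  also have "\<dots> \<le> sqrt h * L2_norm L (wderiv L u)"
    using j partition_mesh_le[OF p j(1)] by (intro mult_right_mono) auto
  finally show ?thesis .
qed

text \<open>Sequential form with one real bound \<open>C\<close> on all energies: dominated
  convergence works along sequences, and the inequality along the filter is reduced to this by
  contradiction.\<close>

lemma liminf_sequence:
  fixes T :: "curve \<times> curve \<Rightarrow> 'w::real_normed_vector" and Y B :: "nat \<Rightarrow> curve"
  assumes T: "bounded_linear_on_V L T" and dep: "depends_only_on_boundary_values L T"
    and m: "regularized_modulus c0 c1 c2 cuni m"
    and V: "\<And>n. (Y n, B n) \<in> V L" "(y, b) \<in> V L"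
    and weak: "weakly_converges L (\<lambda>n. (Y n, B n)) (y, b) sequentially"
    and part: "\<And>n. partition_with_mesh L (h n) (N n) (X n)" and h: "h \<longlonglongrightarrow> 0"
    and pos: "\<And>n. d n > 0" "\<And>n. e1 n > 0" "\<And>n. e2 n > 0"
    and lim: "d \<longlonglongrightarrow> 0" "e1 \<longlonglongrightarrow> 0" "e2 \<longlonglongrightarrow> 0"
    and C: "0 \<le> C" and E: "\<And>n. E_disc L T lbc m (d n) (e1 n) (e2 n) (N n) (X n) (Y n, B n) \<le> ennreal C"
  shows "E_cont L T lbc (y, b) \<le> ennreal C"
proof -
  define z zn where "z = cderiv L y" and "zn n = cderiv L (Y n)" for n
  define p pn where "p = wderiv L z" and "pn n = wderiv L (zn n)" for n
  define q qn where "q = wderiv L b" and "qn n = wderiv L (B n)" for n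
  have y: "y \<in> H2 L" "b \<in> H1 L" and Yn: "\<And>n. Y n \<in> H2 L" "\<And>n. B n \<in> H1 L"
    using V by (auto simp: V_iff)
  have zH: "z \<in> H1 L" "\<And>n. zn n \<in> H1 L" unfolding z_def zn_def by (intro H2_cderiv y Yn)+
  have L2s: "p \<in> L2 L" "q \<in> L2 L" "\<And>n. pn n \<in> L2 L" "\<And>n. qn n \<in> L2 L"
    unfolding p_def q_def pn_def qn_def by (intro wderiv_H1 zH y Yn)+
  note cont = H1_continuous[OF zH(1)] H1_continuous[OF zH(2)] H1_continuous[OF y(2)] H1_continuous[OF Yn(2)]
  note [measurable] = cont[THEN measurable_Om_continuous] L2s[THEN L2_measurable]
  \<comment> \<open>Finite energy excludes the infinite branch of the functional.\<close>
  have adm: "(Y n, B n) \<in> discrete_admissible L T lbc (N n) (X n)" for n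
  proof (rule ccontr)
    assume "\<not> ?thesis"
    then have "E_disc L T lbc m (d n) (e1 n) (e2 n) (N n) (X n) (Y n, B n) = \<infinity>"
      by (simp add: E_disc_def)
    then show False using E[of n] by (simp add: top_unique)
  qed
  define Ib I1 I2 where "Ib n = (LINT x|Om L. bending m (d n) (pn n x) (qn n x))"
    and "I1 n = (LINT x|Om L. (zn n x \<bullet> B n x)\<^sup>2)" and "I2 n = (LINT x|Om L. (zn n x \<bullet> qn n x)\<^sup>2)" for n
  have Ipos: "0 \<le> I1 n" "0 \<le> I2 n" for n by (auto simp: I1_def I2_def)
  have Ib_pos: "0 \<le> Ib n" for n by (simp add: Ib_def bending_props(3)[OF m pos(1)])
  have energy: "(1 / 2) * Ib n + (1 / (2 * e1 n)) * I1 n + (1 / (2 * e2 n)) * I2 n \<le> C" for n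
    using E[of n] C unfolding E_disc_eq[OF m pos V(1) adm] Ib_def I1_def I2_def zn_def pn_def qn_def
    by simp
  have epos: "0 \<le> (1 / (2 * e1 n)) * I1 n" "0 \<le> (1 / (2 * e2 n)) * I2 n" for n
    using pos[of n] Ipos[of n] by simp_all
  have Ib_le: "Ib n \<le> 2 * C" for n
    using energy[of n] epos[of n] by linarith
  have I_le: "I1 n \<le> 2 * e1 n * C" "I2 n \<le> 2 * e2 n * C" for n
  proof -
    have "(1 / (2 * e1 n)) * I1 n \<le> C" "(1 / (2 * e2 n)) * I2 n \<le> C"
      using energy[of n] epos[of n] Ib_pos[of n] by linarith+
    then show "I1 n \<le> 2 * e1 n * C" "I2 n \<le> 2 * e2 n * C"
      using pos[of n] by (simp_all add: field_simps)
  qed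
  \<comment> \<open>Half the integral of |y''|^2 + 5 |b'|^2 lies below the energy, so
    \<open>2 * C\<close> bounds both squared norms.\<close>
  define K where "K = sqrt (2 * C)"
  have "0 \<le> K" using C by (simp add: K_def)
  have "(LINT x|Om L. (norm (pn n x))\<^sup>2 + 5 * (norm (qn n x))\<^sup>2) \<le> 2 * C" for n
  proof (rule order_trans[OF _ Ib_le])
    show "(LINT x|Om L. (norm (pn n x))\<^sup>2 + 5 * (norm (qn n x))\<^sup>2) \<le> Ib n"
      unfolding Ib_def
      by (intro integral_mono bending_props(1)[OF m pos(1)] bending_integrable[OF m pos(1)]
          Bochner_Integration.integrable_add integrable_mult_right L2_integrable_square L2s)
  qed
  then have "(L2_norm L (pn n))\<^sup>2 + 5 * (L2_norm L (qn n))\<^sup>2 \<le> 2 * C" for n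
    using L2_integrable_square[OF L2s(3)] L2_integrable_square[OF L2s(4)] by (simp add: L2_norm_power2)
  then have "(L2_norm L (pn n))\<^sup>2 \<le> 2 * C" "(L2_norm L (qn n))\<^sup>2 \<le> 2 * C" for n
    using zero_le_power2[of "L2_norm L (pn n)"] zero_le_power2[of "L2_norm L (qn n)"] by (smt (verit))+
  then have normK: "L2_norm L (pn n) \<le> K" "L2_norm L (qn n) \<le> K" for n
    unfolding K_def by (auto intro: real_le_rsqrt)

  have h_nonneg: "0 \<le> h n" and h_le: "h n \<le> L" for n
    using mesh_bounds(1,2)[OF part] less_imp_le by blast+
  have close: "\<bar>norm (zn n x) - 1\<bar> \<le> sqrt (h n) * K" "\<bar>norm (B n x) - 1\<bar> \<le> sqrt (h n) * K"
    if x: "x \<in> {0..L}" for n x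
  proof -
    have nodes: "norm (zn n (X n j)) = 1" "norm (B n (X n j)) = 1" if "j \<le> N n" for j
      using adm[of n] that by (auto simp: discrete_admissible_def zn_def)
    have "\<bar>norm (zn n x) - 1\<bar> \<le> sqrt (h n) * L2_norm L (pn n)"
      unfolding pn_def by (rule nodal_unit_close[OF part zH(2) nodes(1) x])
    also have "\<dots> \<le> sqrt (h n) * K" using normK h_nonneg by (intro mult_left_mono) auto
    finally show "\<bar>norm (zn n x) - 1\<bar> \<le> sqrt (h n) * K" .
    have "\<bar>norm (B n x) - 1\<bar> \<le> sqrt (h n) * L2_norm L (qn n)"
      unfolding qn_def by (rule nodal_unit_close[OF part Yn(2) nodes(2) x])
    also have "\<dots> \<le> sqrt (h n) * K" using normK h_nonneg by (intro mult_left_mono) auto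
    finally show "\<bar>norm (B n x) - 1\<bar> \<le> sqrt (h n) * K" .
  qed
  have conv: "(\<lambda>n. zn n x) \<longlonglongrightarrow> z x" "(\<lambda>n. B n x) \<longlonglongrightarrow> b x" "(\<lambda>n. Y n x) \<longlonglongrightarrow> y x" if "x \<in> {0..L}" for x
    using weakly_convergesD(1,2,3)[OF weak that] by (simp_all add: zn_def z_def)
  have hK: "(\<lambda>n. sqrt (h n) * K) \<longlonglongrightarrow> 0"
    using h by (auto intro!: tendsto_eq_intros)
  have unit: "norm (z x) = 1" "norm (b x) = 1" if x: "x \<in> {0..L}" for x
  proof -
    have "(\<lambda>n. norm (zn n x) - 1) \<longlonglongrightarrow> 0" "(\<lambda>n. norm (B n x) - 1) \<longlonglongrightarrow> 0"
      using close[OF x] by (auto intro!: Lim_null_comparison[OF _ hK])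
    moreover have "(\<lambda>n. norm (zn n x) - 1) \<longlonglongrightarrow> norm (z x) - 1" "(\<lambda>n. norm (B n x) - 1) \<longlonglongrightarrow> norm (b x) - 1"
      using conv[OF x] by (auto intro!: tendsto_intros)
    ultimately have "norm (z x) - 1 = 0" "norm (b x) - 1 = 0" using LIMSEQ_unique by blast+
    then show "norm (z x) = 1" "norm (b x) = 1" by auto
  qed
  \<comment> \<open>Uniform in n because no element is longer than L; \<open>M\<close> supplies the
    majorants for dominated convergence.\<close>
  define M where "M = 1 + sqrt L * K"
  have M: "norm (zn n x) \<le> M" "norm (B n x) \<le> M" if "x \<in> {0..L}" for n x
  proof -
    have "sqrt (h n) * K \<le> sqrt L * K" using h_le \<open>0 \<le> K\<close> by (intro mult_right_mono) auto
    then show "norm (zn n x) \<le> M" "norm (B n x) \<le> M" using close[OF that, of n] by (auto simp: M_def)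
  qed
  have M1: "1 \<le> M" using \<open>0 \<le> K\<close> L_pos by (simp add: M_def)

  have orth: "AE x in Om L. z x \<bullet> b x = 0"
  proof -
    have "I1 \<longlonglongrightarrow> (LINT x|Om L. (z x \<bullet> b x)\<^sup>2)"
      unfolding I1_def
    proof (rule integral_dominated_convergence[where w="\<lambda>_. (M * M)\<^sup>2"])
      show "AE x in Om L. (\<lambda>n. (zn n x \<bullet> B n x)\<^sup>2) \<longlonglongrightarrow> (z x \<bullet> b x)\<^sup>2"
        using conv by (intro AE_Om_I tendsto_intros) auto
      show "AE x in Om L. norm ((zn n x \<bullet> B n x)\<^sup>2) \<le> (M * M)\<^sup>2" for n
      proof (rule AE_Om_I)
        fix x assume x: "x \<in> {0<..<L}"
        have "\<bar>zn n x \<bullet> B n x\<bar> \<le> norm (zn n x) * norm (B n x)" by (rule Cauchy_Schwarz_ineq2)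
        also have "\<dots> \<le> M * M" using M[of x n] x M1 by (intro mult_mono) auto
        finally show "norm ((zn n x \<bullet> B n x)\<^sup>2) \<le> (M * M)\<^sup>2"
          using power_mono[of "\<bar>zn n x \<bullet> B n x\<bar>" "M * M" 2] by simp
      qed
      show "integrable (Om L) (\<lambda>_. (M * M)\<^sup>2)" by (rule L2_integrable[OF L2_const])
    qed measurable
    moreover have "(\<lambda>n. 2 * e1 n * C) \<longlonglongrightarrow> 2 * 0 * C" by (intro tendsto_intros lim)
    ultimately have "(LINT x|Om L. (z x \<bullet> b x)\<^sup>2) \<le> 2 * 0 * C"
      using I_le by (intro LIMSEQ_le) auto
    moreover have "0 \<le> (LINT x|Om L. (z x \<bullet> b x)\<^sup>2)" by simp
    ultimately have "(LINT x|Om L. (z x \<bullet> b x)\<^sup>2) = 0" by linarith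
    then have "AE x in Om L. (z x \<bullet> b x)\<^sup>2 = 0"
      using square_inner_integrable(1)[OF cont(1) L2_continuous[OF cont(3)]]
      by (subst (asm) integral_nonneg_eq_0_iff_AE) auto
    then show ?thesis by simp
  qed

  have twist: "AE x in Om L. z x \<bullet> q x = 0"
  proof -
    \<comment> \<open>Replacing y' by y_n' in \<open>\<xi>\<close> costs \<open>rn\<close>, which
      tends to 0 in L2. What remains is \<phi> times y_n' . b_n', whose L2 norm the second penalty
      controls. Since |y'| = 1, \<open>\<xi>\<close> is in L2 whenever \<phi> is.\<close>
    define \<phi> where "\<phi> x = z x \<bullet> q x" for x
    define \<xi> where "\<xi> x = \<phi> x *\<^sub>R z x" for x
    have \<phi>: "\<phi> \<in> L2 L" unfolding \<phi>_def by (rule square_inner_integrable(2)[OF cont(1) L2s(2)])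
    note [measurable] = L2_measurable[OF \<phi>]
    have \<xi>: "\<xi> \<in> L2 L"
      by (rule L2_dominated[OF _ \<phi>, where M=1]) (use unit in \<open>auto simp: \<xi>_def[abs_def]\<close>)
    define rn where "rn n x = \<phi> x *\<^sub>R (z x - zn n x)" for n x
    have rb: "norm (rn n x) \<le> (1 + M) * norm (\<phi> x)" if "x \<in> {0<..<L}" for n x
    proof -
      have "norm (z x - zn n x) \<le> 1 + M"
        using norm_triangle_ineq4[of "z x" "zn n x"] unit(1)[of x] M(1)[of x n] that by auto
      then show ?thesis using mult_right_mono[of "norm (z x - zn n x)" "1 + M" "norm (\<phi> x)"]
        by (simp add: rn_def mult.commute)
    qed
    have rn: "rn n \<in> L2 L" for n
      by (rule L2_dominated[OF _ \<phi> rb]) (use M1 in \<open>auto simp: rn_def[abs_def]\<close>)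
    have "(\<lambda>n. LINT x|Om L. (norm (rn n x))\<^sup>2) \<longlonglongrightarrow> (LINT x|Om L. 0)"
    proof (rule integral_dominated_convergence[where w="\<lambda>x. (1 + M)\<^sup>2 * (norm (\<phi> x))\<^sup>2"])
      show "AE x in Om L. (\<lambda>n. (norm (rn n x))\<^sup>2) \<longlonglongrightarrow> 0"
        unfolding rn_def using conv(1) by (intro AE_Om_I) (auto intro!: tendsto_eq_intros)
      show "AE x in Om L. norm ((norm (rn n x))\<^sup>2) \<le> (1 + M)\<^sup>2 * (norm (\<phi> x))\<^sup>2" for n
      proof (rule AE_Om_I)
        fix x assume "x \<in> {0<..<L}"
        then have "(norm (rn n x))\<^sup>2 \<le> ((1 + M) * norm (\<phi> x))\<^sup>2" by (intro power_mono rb) auto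
        then show "norm ((norm (rn n x))\<^sup>2) \<le> (1 + M)\<^sup>2 * (norm (\<phi> x))\<^sup>2" by (simp only: power_mult_distrib) simp
      qed
      show "integrable (Om L) (\<lambda>x. (1 + M)\<^sup>2 * (norm (\<phi> x))\<^sup>2)"
        by (intro integrable_mult_right L2_integrable_square \<phi>)
    qed (use rn[THEN L2_measurable] in measurable)
    then have "(\<lambda>n. L2_norm L (rn n)) \<longlonglongrightarrow> 0"
      unfolding L2_norm_def by (auto intro!: tendsto_eq_intros)
    then have bound0: "(\<lambda>n. L2_norm L (rn n) * K + L2_norm L \<phi> * sqrt (2 * e2 n * C)) \<longlonglongrightarrow> 0"
      using lim(3) by (auto intro!: tendsto_eq_intros)
    have "(\<lambda>n. LINT x|Om L. \<xi> x \<bullet> qn n x) \<longlonglongrightarrow> 0"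
    proof (rule Lim_null_comparison[OF _ bound0], rule always_eventually, rule allI)
      fix n
      have zq: "(\<lambda>x. zn n x \<bullet> qn n x) \<in> L2 L" by (rule square_inner_integrable(2)[OF cont(2) L2s(4)])
      have "(LINT x|Om L. \<xi> x \<bullet> qn n x) = (LINT x|Om L. rn n x \<bullet> qn n x + \<phi> x \<bullet> (zn n x \<bullet> qn n x))"
        by (intro Bochner_Integration.integral_cong) (auto simp: \<xi>_def rn_def algebra_simps inner_diff_left)
      also have "\<dots> = (LINT x|Om L. rn n x \<bullet> qn n x) + (LINT x|Om L. \<phi> x \<bullet> (zn n x \<bullet> qn n x))"
        by (intro Bochner_Integration.integral_add L2_inner_integrable rn L2s \<phi> zq)
      finally have "\<bar>LINT x|Om L. \<xi> x \<bullet> qn n x\<bar> \<le> \<bar>LINT x|Om L. rn n x \<bullet> qn n x\<bar> + \<bar>LINT x|Om L. \<phi> x \<bullet> (zn n x \<bullet> qn n x)\<bar>"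
        by simp
      also have "\<dots> \<le> L2_norm L (rn n) * L2_norm L (qn n) + L2_norm L \<phi> * L2_norm L (\<lambda>x. zn n x \<bullet> qn n x)"
        by (intro add_mono L2_Cauchy_Schwarz rn L2s \<phi> zq)
      also have "\<dots> \<le> L2_norm L (rn n) * K + L2_norm L \<phi> * sqrt (2 * e2 n * C)"
      proof (intro add_mono mult_left_mono normK L2_norm_nonneg)
        show "L2_norm L (\<lambda>x. zn n x \<bullet> qn n x) \<le> sqrt (2 * e2 n * C)"
          unfolding L2_norm_def using I_le(2)[of n] by (simp add: I2_def)
      qed
      finally show "norm (LINT x|Om L. \<xi> x \<bullet> qn n x) \<le> L2_norm L (rn n) * K + L2_norm L \<phi> * sqrt (2 * e2 n * C)"
        by simp
    qed
    moreover have "(\<lambda>n. LINT x|Om L. \<xi> x \<bullet> qn n x) \<longlonglongrightarrow> (LINT x|Om L. \<xi> x \<bullet> q x)"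
      using weakly_convergesD(4)[OF weak \<xi>] by (simp add: qn_def q_def)
    ultimately have "(LINT x|Om L. \<xi> x \<bullet> q x) = 0" using LIMSEQ_unique by blast
    moreover have "(LINT x|Om L. \<xi> x \<bullet> q x) = (LINT x|Om L. (norm (\<phi> x))\<^sup>2)"
      by (intro Bochner_Integration.integral_cong) (auto simp: \<xi>_def \<phi>_def power2_eq_square)
    ultimately have "(LINT x|Om L. (norm (\<phi> x))\<^sup>2) = 0" by simp
    then have "AE x in Om L. (norm (\<phi> x))\<^sup>2 = 0"
      using L2_integrable_square[OF \<phi>] by (subst (asm) integral_nonneg_eq_0_iff_AE) auto
    then show ?thesis by (simp add: \<phi>_def)
  qed

  have frame: "(y, b) \<in> A_frame L T lbc"
  proof -
    have "AE x in Om L. x \<in> {0<..<L}" by (rule AE_Om_I) auto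
    with orth have "AE x in Om L. rotation_matrix (frame_matrix (cderiv L y x) (b x))"
      by eventually_elim (use unit in \<open>auto simp: rotation_frame_matrix_iff z_def\<close>)
    moreover have "(\<lambda>n. T (Y n, B n)) \<longlonglongrightarrow> T (y, b)"
      using L_pos by (intro boundary_operator_tendsto[OF T dep V]) (use conv in \<open>auto simp: zn_def z_def\<close>)
    then have "T (y, b) = lbc"
      using adm by (simp add: discrete_admissible_def LIMSEQ_const_iff)
    ultimately show ?thesis using V(2) by (simp add: A_frame_def)
  qed

  have "(LINT x|Om L. Qbar (norm (p x)) (norm (q x))) \<le> C"
  proof -
    \<comment> \<open>The subgradient is taken at the limit pair, so it does not depend on n and can
      be paired with the weakly convergent derivatives.\<close>
    define \<xi> \<eta> where "\<xi> x = Q_grad1 (p x) (q x)" and "\<eta> x = Q_grad2 (p x) (q x)" for x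
    have \<xi>: "\<xi> \<in> L2 L"
      by (rule L2_dominated[OF _ L2s(1), where M=2])
         (auto simp: \<xi>_def norm_Q_grad1, simp add: \<xi>_def[abs_def] Q_grad1_def)
    have \<eta>: "\<eta> \<in> L2 L"
      by (rule L2_dominated[OF _ L2s(2), where M=8])
         (auto simp: \<eta>_def norm_Q_grad2, simp add: \<eta>_def[abs_def] Q_grad2_def)
    let ?Q = "LINT x|Om L. Qbar (norm (p x)) (norm (q x))"
    let ?l = "\<lambda>n. ?Q + ((LINT x|Om L. \<xi> x \<bullet> pn n x) - (LINT x|Om L. \<xi> x \<bullet> p x))
      + ((LINT x|Om L. \<eta> x \<bullet> qn n x) - (LINT x|Om L. \<eta> x \<bullet> q x))"
    \<comment> \<open>The additional term is half of the uniform gap \<open>5 * (cuni * d n)\<close>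
      between \<open>bending\<close> and \<open>2 * Qbar\<close>, integrated over the length
      L.\<close>
    have "?l n \<le> C + 5 / 2 * (cuni * d n) * L" for n
    proof -
      note ints = Qbar_integrable[OF L2s(1,2)] L2_inner_integrable[OF \<xi> L2s(1)] L2_inner_integrable[OF \<xi> L2s(3)]
        L2_inner_integrable[OF \<eta> L2s(2)] L2_inner_integrable[OF \<eta> L2s(4)]
      have "?l n = (LINT x|Om L. Qbar (norm (p x)) (norm (q x)) + (\<xi> x \<bullet> pn n x - \<xi> x \<bullet> p x)
          + (\<eta> x \<bullet> qn n x - \<eta> x \<bullet> q x))"
        using ints by simp
      also have "\<dots> \<le> (LINT x|Om L. 1 / 2 * bending m (d n) (pn n x) (qn n x) + 5 / 2 * (cuni * d n))"
      proof (rule integral_mono)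
        show "integrable (Om L) (\<lambda>x. Qbar (norm (p x)) (norm (q x)) + (\<xi> x \<bullet> pn n x - \<xi> x \<bullet> p x)
          + (\<eta> x \<bullet> qn n x - \<eta> x \<bullet> q x))"
          using ints by simp
        show "integrable (Om L) (\<lambda>x. 1 / 2 * bending m (d n) (pn n x) (qn n x) + 5 / 2 * (cuni * d n))"
          using bending_integrable[OF m pos(1) L2s(3,4)] L2_integrable[OF L2_const]
          by (intro Bochner_Integration.integrable_add integrable_mult_right) auto
        show "Qbar (norm (p x)) (norm (q x)) + (\<xi> x \<bullet> pn n x - \<xi> x \<bullet> p x) + (\<eta> x \<bullet> qn n x - \<eta> x \<bullet> q x)
            \<le> 1 / 2 * bending m (d n) (pn n x) (qn n x) + 5 / 2 * (cuni * d n)" for x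
          using Qbar_subgradient[of "p x" "q x" "pn n x" "qn n x"]
            bending_props(2)[OF m pos(1), of n "pn n x" "qn n x"]
          by (simp add: \<xi>_def \<eta>_def inner_diff_right abs_le_iff)
      qed
      also have "\<dots> = 1 / 2 * Ib n + 5 / 2 * (cuni * d n) * L"
        using bending_integrable[OF m pos(1) L2s(3,4)] L2_integrable[OF L2_const] measure_Om
        by (subst Bochner_Integration.integral_add) (auto simp: Ib_def)
      also have "\<dots> \<le> C + 5 / 2 * (cuni * d n) * L" using Ib_le[of n] by simp
      finally show ?thesis .
    qed
    moreover have "?l \<longlonglongrightarrow> ?Q + ((LINT x|Om L. \<xi> x \<bullet> p x) - (LINT x|Om L. \<xi> x \<bullet> p x))
      + ((LINT x|Om L. \<eta> x \<bullet> q x) - (LINT x|Om L. \<eta> x \<bullet> q x))"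
      using weakly_convergesD(4)[OF weak \<eta>] weakly_convergesD(5)[OF weak \<xi>]
      unfolding pn_def zn_def qn_def p_def q_def z_def by (intro tendsto_intros)
    then have "?l \<longlonglongrightarrow> ?Q" by simp
    moreover have "(\<lambda>n. C + 5 / 2 * (cuni * d n) * L) \<longlonglongrightarrow> C"
      using lim(1) by (auto intro!: tendsto_eq_intros)
    ultimately show ?thesis by (intro LIMSEQ_le[of ?l ?Q]) auto
  qed
  then have "(\<integral>\<^sup>+x. ennreal (Qbar (norm (p x)) (norm (q x))) \<partial>Om L) \<le> ennreal C"
    using nn_integral_eq_integral[OF Qbar_integrable[OF L2s(1,2)]] Qbar_nonneg by (simp add: ennreal_leI)
  then show ?thesis
    using frame twist by (simp add: E_cont_def p_def q_def z_def)
qed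

end

section \<open>Spline interpolation\<close>

text \<open>At a point off a closed set the filter within that set is trivial and any derivative
  claim is vacuous, so only pieces containing x matter.\<close>

lemma has_vector_derivative_Un_closed:
  fixes f :: "real \<Rightarrow> 'a::real_normed_vector"
  assumes "closed S" "closed T"
    and S: "x \<in> S \<Longrightarrow> (f has_vector_derivative D) (at x within S)"
    and T: "x \<in> T \<Longrightarrow> (f has_vector_derivative D) (at x within T)"
  shows "(f has_vector_derivative D) (at x within S \<union> T)"
proof -
  have triv: "(f has_vector_derivative D) (at x within A)" if "closed A" "x \<notin> A" for A
  proof -
    have "at x within A = bot"
      using that closed_limpt[of A] trivial_limit_within[of x A] by auto
    then show ?thesis
      unfolding has_vector_derivative_def has_derivative_within by (simp add: bounded_linear_scaleR_left)
  qed
  have "(f has_vector_derivative D) (at x within S)" "(f has_vector_derivative D) (at x within T)"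
    using S T triv assms(1,2) by blast+
  then show ?thesis
    unfolding has_vector_derivative_def has_derivative_within
    unfolding at_within_union by (auto intro: filterlim_sup)
qed

lemma has_vector_derivative_UN_closed:
  fixes f :: "real \<Rightarrow> 'a::real_normed_vector" and N :: nat
  assumes "\<And>j. closed (I j)" and "\<And>j. j < N \<Longrightarrow> x \<in> I j \<Longrightarrow> (f has_vector_derivative D) (at x within I j)"
  shows "(f has_vector_derivative D) (at x within (\<Union>j<N. I j))"
  using assms(2)
proof (induction N)
  case 0
  then show ?case
    unfolding has_vector_derivative_def has_derivative_within by (simp add: bounded_linear_scaleR_left)
next
  case (Suc N)
  have "(f has_vector_derivative D) (at x within I N \<union> (\<Union>j<N. I j))"
    by (rule has_vector_derivative_Un_closed) (use Suc assms(1) in auto)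
  then show ?case by (simp add: lessThan_Suc)
qed

lemma increment_bound:
  fixes f :: "real \<Rightarrow> 'a::real_normed_vector"
  assumes d: "\<And>t. t \<in> {a..b} \<Longrightarrow> (f has_vector_derivative f' t) (at t within {a..b})"
    and B: "\<And>t. t \<in> {a..b} \<Longrightarrow> norm (f' t) \<le> B" and x: "x \<in> {a..b}"
  shows "norm (f x - f a) \<le> B * (x - a)"
proof -
  have "norm (f x - f a) \<le> B * norm (x - a)"
  proof (rule differentiable_bound[of "{a..b}" f "\<lambda>t h. h *\<^sub>R f' t"])
    show "(f has_derivative (\<lambda>h. h *\<^sub>R f' t)) (at t within {a..b})" if "t \<in> {a..b}" for t
      using d[OF that] by (simp add: has_vector_derivative_def)
    show "onorm (\<lambda>h. h *\<^sub>R f' t) \<le> B" if "t \<in> {a..b}" for t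
      using B[OF that] by (simp add: onorm_scaleR_left onorm_id bounded_linear_ident)
  qed (use x in auto)
  then show ?thesis using x by simp
qed

text \<open>Taylor expansion at the left node: with l = b - a, twice \<open>herm2\<close> is within
  2 M l of y''(a), and \<open>herm3\<close> is at most 3 M. Then 15 = 2 + 1 + 4 * 3 for the second
  derivative; the lower orders follow by integrating from a, where interpolant and function agree to
  first order.\<close>

lemma hermite_error:
  fixes y y1 y2 y3 :: "real \<Rightarrow> 'a::real_normed_vector"
  assumes ab: "a < b"
    and d0: "\<And>t. t \<in> {a..b} \<Longrightarrow> (y has_vector_derivative y1 t) (at t within {a..b})"
    and d1: "\<And>t. t \<in> {a..b} \<Longrightarrow> (y1 has_vector_derivative y2 t) (at t within {a..b})"
    and d2: "\<And>t. t \<in> {a..b} \<Longrightarrow> (y2 has_vector_derivative y3 t) (at t within {a..b})"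
    and M: "\<And>t. t \<in> {a..b} \<Longrightarrow> norm (y3 t) \<le> M" and x: "x \<in> {a..b}"
  shows "norm (hermite_dd a b (y a) (y b) (y1 a) (y1 b) x - y2 x) \<le> 15 * M * (b - a)"
    "norm (hermite_d a b (y a) (y b) (y1 a) (y1 b) x - y1 x) \<le> 15 * M * (b - a)\<^sup>2"
    "norm (hermite a b (y a) (y b) (y1 a) (y1 b) x - y x) \<le> 15 * M * (b - a)^3"
proof -
  define l where "l = b - a"
  have l: "0 < l" using ab by (simp add: l_def)
  have M0: "0 \<le> M" using M[OF x] by (rule order_trans[OF norm_ge_zero])
  have xl: "t - a \<le> l" "0 \<le> t - a" if "t \<in> {a..b}" for t using that by (auto simp: l_def)
  have e2: "norm (y2 t - y2 a) \<le> M * l" if t: "t \<in> {a..b}" for t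
    using increment_bound[OF d2 M t] mult_left_mono[OF xl(1)[OF t] M0] by linarith
  \<comment> \<open>Removing the linear Taylor term of y' leaves a function with derivative of size
    M l; \<open>g0\<close> repeats this one order lower, its derivative being
    \<open>g1 t - y1 a\<close>.\<close>
  define g1 where "g1 t = y1 t - (t - a) *\<^sub>R y2 a" for t
  have "(g1 has_vector_derivative y2 t - y2 a) (at t within {a..b})" if "t \<in> {a..b}" for t
    unfolding g1_def by (rule derivative_eq_intros d1[OF that] refl | simp)+
  from increment_bound[OF this e2]
  have g1: "norm (g1 t - y1 a) \<le> M * l * l" if t: "t \<in> {a..b}" for t
    using t mult_left_mono[OF xl(1)[OF t], of "M * l"] M0 l by (fastforce simp: g1_def)
  define g0 where "g0 t = y t - (t - a) *\<^sub>R y1 a - ((t - a)\<^sup>2 / 2) *\<^sub>R y2 a" for t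
  have g0d: "(g0 has_vector_derivative g1 t - y1 a) (at t within {a..b})" if "t \<in> {a..b}" for t
    unfolding g0_def g1_def
    by (rule derivative_eq_intros d0[OF that] refl | simp)+
  have g0: "norm (g0 b - y a) \<le> M * l * l * l"
    using increment_bound[OF g0d g1, of b] ab by (simp add: g0_def l_def)
  define c2 where "c2 = herm2 a b (y a) (y b) (y1 a)"
  define c3 where "c3 = herm3 a b (y a) (y b) (y1 a) (y1 b)"
  have lc2: "l\<^sup>2 *\<^sub>R c2 = y b - y a - l *\<^sub>R y1 a"
    using l by (simp add: c2_def herm2_def l_def)
  \<comment> \<open>The right side will be twice the second-order Taylor remainder of y at
    b.\<close>
  have "l\<^sup>2 *\<^sub>R (2 *\<^sub>R c2 - y2 a) = 2 *\<^sub>R (l\<^sup>2 *\<^sub>R c2) - l\<^sup>2 *\<^sub>R y2 a"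
    by (simp add: scaleR_diff_right)
  also have "\<dots> = 2 *\<^sub>R (g0 b - y a)"
    unfolding lc2 by (simp add: g0_def l_def scaleR_diff_right)
  finally have "l\<^sup>2 *\<^sub>R (2 *\<^sub>R c2 - y2 a) = 2 *\<^sub>R (g0 b - y a)" .
  then have "norm (l\<^sup>2 *\<^sub>R (2 *\<^sub>R c2 - y2 a)) \<le> 2 * (M * l * l * l)" using g0 by simp
  then have "l\<^sup>2 * norm (2 *\<^sub>R c2 - y2 a) \<le> l\<^sup>2 * (2 * M * l)"
    by (simp add: power2_eq_square mult_ac)
  then have c2: "norm (2 *\<^sub>R c2 - y2 a) \<le> 2 * M * l" using l by simp
  have "l\<^sup>2 *\<^sub>R c3 = y1 b - y1 a - (2 * l) *\<^sub>R c2"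
    using l by (simp add: c3_def c2_def herm3_def l_def)
  also have "\<dots> = (g1 b - y1 a) - l *\<^sub>R (2 *\<^sub>R c2 - y2 a)"
    by (simp add: g1_def l_def algebra_simps)
  finally have "norm (l\<^sup>2 *\<^sub>R c3) \<le> norm (g1 b - y1 a) + norm (l *\<^sub>R (2 *\<^sub>R c2 - y2 a))"
    using norm_triangle_ineq4 by metis
  also have "\<dots> \<le> M * l * l + l * (2 * M * l)"
    using g1[of b] ab l c2 by (intro add_mono) (auto intro: mult_left_mono)
  finally have "l\<^sup>2 * norm c3 \<le> l\<^sup>2 * (3 * M)" by (simp add: power2_eq_square algebra_simps)
  then have c3: "norm c3 \<le> 3 * M" using l by simp
  have dd: "norm (hermite_dd a b (y a) (y b) (y1 a) (y1 b) t - y2 t) \<le> 15 * M * l" if t: "t \<in> {a..b}" for t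
  proof -
    have "hermite_dd a b (y a) (y b) (y1 a) (y1 b) t - y2 t
      = (2 *\<^sub>R c2 - y2 a) - (y2 t - y2 a) + (2 * (t - b) + 4 * (t - a)) *\<^sub>R c3"
      by (simp add: hermite_dd_def c2_def c3_def)
    also have "norm \<dots> \<le> norm (2 *\<^sub>R c2 - y2 a) + norm (y2 t - y2 a) + norm ((2 * (t - b) + 4 * (t - a)) *\<^sub>R c3)"
      by (meson norm_triangle_ineq norm_triangle_ineq4 order_trans add_right_mono)
    also have "norm ((2 * (t - b) + 4 * (t - a)) *\<^sub>R c3) \<le> (4 * l) * (3 * M)"
      unfolding norm_scaleR using t c3 l by (intro mult_mono) (auto simp: l_def)
    finally show ?thesis using c2 e2[OF t] by (simp add: mult_ac)
  qed
  have d: "norm (hermite_d a b (y a) (y b) (y1 a) (y1 b) t - y1 t) \<le> 15 * M * l\<^sup>2" if t: "t \<in> {a..b}" for t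
  proof -
    have "norm ((hermite_d a b (y a) (y b) (y1 a) (y1 b) t - y1 t) - (hermite_d a b (y a) (y b) (y1 a) (y1 b) a - y1 a))
        \<le> 15 * M * l * (t - a)"
      by (rule increment_bound[OF has_vector_derivative_diff[OF hermite_d_deriv d1] dd t])
    also have "\<dots> \<le> 15 * M * l * l" using xl[OF t] M0 l by (intro mult_left_mono) auto
    finally show ?thesis by (simp add: power2_eq_square)
  qed
  have e: "norm (hermite a b (y a) (y b) (y1 a) (y1 b) t - y t) \<le> 15 * M * l^3" if t: "t \<in> {a..b}" for t
  proof -
    have "norm ((hermite a b (y a) (y b) (y1 a) (y1 b) t - y t) - (hermite a b (y a) (y b) (y1 a) (y1 b) a - y a))
        \<le> 15 * M * l\<^sup>2 * (t - a)"
      by (rule increment_bound[OF has_vector_derivative_diff[OF hermite_deriv d0] d t])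
    also have "\<dots> \<le> 15 * M * l\<^sup>2 * l" using xl[OF t] M0 l by (intro mult_left_mono) auto
    finally show ?thesis by (simp add: power2_eq_square power3_eq_cube)
  qed
  show "norm (hermite_dd a b (y a) (y b) (y1 a) (y1 b) x - y2 x) \<le> 15 * M * (b - a)"
    "norm (hermite_d a b (y a) (y b) (y1 a) (y1 b) x - y1 x) \<le> 15 * M * (b - a)\<^sup>2"
    "norm (hermite a b (y a) (y b) (y1 a) (y1 b) x - y x) \<le> 15 * M * (b - a)^3"
    using dd[OF x] d[OF x] e[OF x] by (simp_all add: l_def)
qed

definition chord_slope :: "real \<Rightarrow> real \<Rightarrow> 'a \<Rightarrow> 'a \<Rightarrow> 'a::real_normed_vector" where
  "chord_slope a b p q = (1 / (b - a)) *\<^sub>R (q - p)"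

definition chord :: "real \<Rightarrow> real \<Rightarrow> 'a \<Rightarrow> 'a \<Rightarrow> real \<Rightarrow> 'a::real_normed_vector" where
  "chord a b p q x = p + (x - a) *\<^sub>R chord_slope a b p q"

lemma chord_deriv: "(chord a b p q has_vector_derivative chord_slope a b p q) (at x within S)"
  unfolding chord_def by (auto intro!: derivative_eq_intros)

lemma chord_ends: "chord a b p q a = p" "a < b \<Longrightarrow> chord a b p q b = q"
  by (simp_all add: chord_def chord_slope_def)

text \<open>The Taylor argument of the cubic case one order lower: the chord slope is within M l of
  u'(a), and u' moves by at most M l on the element.\<close>

lemma chord_error:
  fixes u u1 u2 :: "real \<Rightarrow> 'a::real_normed_vector"
  assumes ab: "a < b"
    and d0: "\<And>t. t \<in> {a..b} \<Longrightarrow> (u has_vector_derivative u1 t) (at t within {a..b})"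
    and d1: "\<And>t. t \<in> {a..b} \<Longrightarrow> (u1 has_vector_derivative u2 t) (at t within {a..b})"
    and M: "\<And>t. t \<in> {a..b} \<Longrightarrow> norm (u2 t) \<le> M" and x: "x \<in> {a..b}"
  shows "norm (chord_slope a b (u a) (u b) - u1 x) \<le> 2 * M * (b - a)"
    "norm (chord a b (u a) (u b) x - u x) \<le> 2 * M * (b - a)\<^sup>2"
proof -
  define l where "l = b - a"
  have l: "0 < l" using ab by (simp add: l_def)
  have M0: "0 \<le> M" using M[OF x] by (rule order_trans[OF norm_ge_zero])
  have xl: "t - a \<le> l" "0 \<le> t - a" if "t \<in> {a..b}" for t using that by (auto simp: l_def)
  have e1: "norm (u1 t - u1 a) \<le> M * l" if t: "t \<in> {a..b}" for t
    using increment_bound[OF d1 M t] mult_left_mono[OF xl(1)[OF t] M0] by linarith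
  define g where "g t = u t - (t - a) *\<^sub>R u1 a" for t
  have "(g has_vector_derivative u1 t - u1 a) (at t within {a..b})" if "t \<in> {a..b}" for t
    unfolding g_def by (rule derivative_eq_intros d0[OF that] refl | simp)+
  from increment_bound[OF this e1, of b] ab
  have g: "norm (g b - u a) \<le> M * l * l" by (simp add: g_def l_def)
  have "l *\<^sub>R (chord_slope a b (u a) (u b) - u1 a) = g b - u a"
    using l by (simp add: chord_slope_def g_def l_def algebra_simps)
  then have "norm (l *\<^sub>R (chord_slope a b (u a) (u b) - u1 a)) \<le> l * (M * l)" using g by (simp add: mult_ac)
  then have s: "norm (chord_slope a b (u a) (u b) - u1 a) \<le> M * l" using l by simp
  have d: "norm (chord_slope a b (u a) (u b) - u1 t) \<le> 2 * M * l" if t: "t \<in> {a..b}" for t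
    using norm_triangle_ineq4[of "chord_slope a b (u a) (u b) - u1 a" "u1 t - u1 a"] s e1[OF t] by simp
  have "norm ((chord a b (u a) (u b) x - u x) - (chord a b (u a) (u b) a - u a)) \<le> 2 * M * l * (x - a)"
    by (rule increment_bound[OF has_vector_derivative_diff[OF chord_deriv d0] d x])
  also have "\<dots> \<le> 2 * M * l * l" using xl[OF x] M0 l by (intro mult_left_mono) auto
  finally show "norm (chord a b (u a) (u b) x - u x) \<le> 2 * M * (b - a)\<^sup>2"
    by (simp add: l_def power2_eq_square chord_ends)
  show "norm (chord_slope a b (u a) (u b) - u1 x) \<le> 2 * M * (b - a)"
    using d[OF x] by (simp add: l_def)
qed

lemma hermite_component_poly:
  fixes ya yb sa sb :: "real^3"
  shows "\<exists>q. degree q \<le> 3 \<and> (\<forall>x. hermite a b ya yb sa sb x $ i = poly q x)"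
proof -
  define c2 c3 where "c2 = herm2 a b ya yb sa $ i" and "c3 = herm3 a b ya yb sa sb $ i"
  define q where "q = [:ya $ i:] + smult (sa $ i) [:-a, 1:] + smult c2 ([:-a, 1:]^2) + smult c3 ([:-a, 1:]^2 * [:-b, 1:])"
  have "degree ([:-a, 1:]^2) = 2" by (simp add: degree_power_eq)
  moreover have "degree ([:-a, 1:]^2 * [:-b, 1:]) = 3"
    by (subst degree_mult_eq) (auto simp: degree_power_eq)
  ultimately have "degree q \<le> 3"
    unfolding q_def by (intro degree_add_le order_trans[OF degree_smult_le]) auto
  moreover have "hermite a b ya yb sa sb x $ i = poly q x" for x
    by (simp add: hermite_def q_def c2_def c3_def algebra_simps)
  ultimately show ?thesis by blast
qed

lemma chord_component_poly:
  fixes p q :: "real^3"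
  shows "\<exists>r. degree r \<le> 1 \<and> (\<forall>x. chord a b p q x $ i = poly r x)"
  by (rule exI[of _ "[:p $ i - a * chord_slope a b p q $ i, chord_slope a b p q $ i:]"])
     (simp add: chord_def algebra_simps)

text \<open>\<open>D 0\<close> agrees with \<open>f\<close> only on [0,L]; its derivative within
  that set is transferred to \<open>f\<close> itself.\<close>

lemma Ck_derivatives:
  fixes f :: "real \<Rightarrow> 'a::real_normed_vector"
  assumes "f \<in> Ck (Suc k) L"
  shows "\<exists>D. (\<forall>i\<le>Suc k. continuous_on {0..L} (D i)) \<and>
    (\<forall>x\<in>{0..L}. (f has_vector_derivative D 1 x) (at x within {0..L})) \<and>
    (\<forall>i\<le>k. \<forall>x\<in>{0..L}. 1 \<le> i \<longrightarrow> (D i has_vector_derivative D (Suc i) x) (at x within {0..L}))"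
proof -
  obtain D where D: "\<forall>x\<in>{0..L}. D 0 x = f x" "\<forall>i\<le>Suc k. continuous_on {0..L} (D i)"
     "\<forall>i<Suc k. \<forall>x\<in>{0..L}. (D i has_vector_derivative D (Suc i) x) (at x within {0..L})"
    using assms by (auto simp: Ck_def)
  have "(f has_vector_derivative D 1 x) (at x within {0..L})" if x: "x \<in> {0..L}" for x
    by (rule has_vector_derivative_transform[OF x, of _ "D 0"]) (use D x in auto)
  then show ?thesis using D by (intro exI[of _ D]) auto
qed

section \<open>Gluing polynomial pieces along a partition\<close>

context bounded_interval
begin

text \<open>The least index assigns an interior node to the element on its left.\<close>

definition element :: "(nat \<Rightarrow> real) \<Rightarrow> real \<Rightarrow> nat" where
  "element X x = (LEAST j. x \<le> X (Suc j))"

definition glue :: "(nat \<Rightarrow> real) \<Rightarrow> (nat \<Rightarrow> real \<Rightarrow> 'a) \<Rightarrow> real \<Rightarrow> 'a" where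
  "glue X F x = F (element X x) x"

lemma element_props:
  assumes p: "partition_with_mesh L h N X" and x: "x \<in> {0..L}"
  shows "element X x < N" "X (element X x) \<le> x" "x \<le> X (Suc (element X x))"
proof -
  obtain j where j: "j < N" "X j \<le> x" "x \<le> X (Suc j)" using partition_element[OF p x] by blast
  show "x \<le> X (Suc (element X x))" unfolding element_def by (rule LeastI[of _ j]) fact
  have le: "element X x \<le> j" unfolding element_def by (rule Least_le) fact
  then show "element X x < N" using j by simp
  show "X (element X x) \<le> x" using partition_mono[OF p le] j by simp
qed

text \<open>At a shared node the matching condition makes the choice between the two elements
  irrelevant, so every closed element can be treated with its own piece.\<close>

lemma glue_eq:
  assumes p: "partition_with_mesh L h N X"
    and match: "\<And>j. Suc j < N \<Longrightarrow> F j (X (Suc j)) = F (Suc j) (X (Suc j))"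
    and j: "j < N" and x: "x \<in> {X j..X (Suc j)}"
  shows "glue X F x = F j x"
proof -
  let ?k = "element X x"
  have xL: "x \<in> {0..L}" using x partition_range[OF p, of j] partition_range[OF p, of "Suc j"] j by auto
  note e = element_props[OF p xL]
  have le: "?k \<le> j" unfolding element_def by (rule Least_le) (use x in simp)
  show ?thesis
  proof (cases "?k = j")
    case False
    then have "Suc ?k \<le> j" using le by simp
    then have "X (Suc ?k) \<le> X j" using partition_mono[OF p] j by simp
    then have eq: "x = X (Suc ?k)" "X (Suc ?k) = X j" using e x by auto
    \<comment> \<open>Distinct elements that share a point are neighbours, since the nodes increase
      strictly.\<close>
    have "Suc ?k = j"
    proof (rule ccontr)
      assume "Suc ?k \<noteq> j"
      then have "Suc (Suc ?k) \<le> j" using \<open>Suc ?k \<le> j\<close> by simp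
      then have "X (Suc (Suc ?k)) \<le> X j" using partition_mono[OF p] j by simp
      moreover have "X (Suc ?k) < X (Suc (Suc ?k))"
        using p \<open>Suc (Suc ?k) \<le> j\<close> j by (simp add: partition_with_mesh_def)
      ultimately show False using eq by simp
    qed
    then show ?thesis using match[of ?k] j eq(1) by (simp add: glue_def)
  qed (simp add: glue_def)
qed

lemma partition_Union:
  assumes p: "partition_with_mesh L h N X"
  shows "(\<Union>j<N. {X j..X (Suc j)}) = {0..L}"
proof
  show "(\<Union>j<N. {X j..X (Suc j)}) \<subseteq> {0..L}"
  proof
    fix x assume "x \<in> (\<Union>j<N. {X j..X (Suc j)})"
    then obtain j where "j < N" "x \<in> {X j..X (Suc j)}" by blast
    then show "x \<in> {0..L}" using partition_range[OF p, of j] partition_range[OF p, of "Suc j"] by auto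
  qed
  show "{0..L} \<subseteq> (\<Union>j<N. {X j..X (Suc j)})"
  proof
    fix x assume "x \<in> {0..L}"
    then obtain j where "j < N" "X j \<le> x" "x \<le> X (Suc j)" using partition_element[OF p] by blast
    then show "x \<in> (\<Union>j<N. {X j..X (Suc j)})" by auto
  qed
qed

lemma glue_continuous:
  fixes F :: "nat \<Rightarrow> real \<Rightarrow> 'a::real_normed_vector"
  assumes p: "partition_with_mesh L h N X"
    and match: "\<And>j. Suc j < N \<Longrightarrow> F j (X (Suc j)) = F (Suc j) (X (Suc j))"
    and c: "\<And>j. j < N \<Longrightarrow> continuous_on {X j..X (Suc j)} (F j)"
  shows "continuous_on {0..L} (glue X F)"
  unfolding partition_Union[OF p, symmetric]
proof (rule continuous_on_closed_Union)
  show "continuous_on {X j..X (Suc j)} (glue X F)" if "j \<in> {..<N}" for j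
    using c[of j] that by (rule_tac continuous_on_eq[of _ "F j"]) (auto simp: glue_eq[OF p match])
qed auto

text \<open>Differentiability is checked within each closed element. At a node the one-sided
  derivatives have to agree, which is the second matching condition.\<close>

lemma glue_deriv:
  fixes F :: "nat \<Rightarrow> real \<Rightarrow> 'a::real_normed_vector"
  assumes p: "partition_with_mesh L h N X"
    and match: "\<And>j. Suc j < N \<Longrightarrow> F j (X (Suc j)) = F (Suc j) (X (Suc j))"
      "\<And>j. Suc j < N \<Longrightarrow> G j (X (Suc j)) = G (Suc j) (X (Suc j))"
    and d: "\<And>j x. j < N \<Longrightarrow> x \<in> {X j..X (Suc j)} \<Longrightarrow> (F j has_vector_derivative G j x) (at x within {X j..X (Suc j)})"
  shows "(glue X F has_vector_derivative glue X G x) (at x within {0..L})"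
  unfolding partition_Union[OF p, symmetric]
proof (rule has_vector_derivative_UN_closed)
  fix j assume j: "j < N" "x \<in> {X j..X (Suc j)}"
  show "(glue X F has_vector_derivative glue X G x) (at x within {X j..X (Suc j)})"
  proof (rule has_vector_derivative_transform[OF j(2), of _ "F j"])
    show "(F j has_vector_derivative glue X G x) (at x within {X j..X (Suc j)})"
      using d[OF j] glue_eq[where F=G, OF p match(2) j] by simp
  qed (use j glue_eq[where F=F, OF p match(1)] in auto)
qed simp

text \<open>Here the pieces \<open>G\<close> may jump at the nodes, as second derivatives of cubic
  C1 splines and first derivatives of linear splines do.\<close>

lemma glue_deriv_off_nodes:
  fixes F :: "nat \<Rightarrow> real \<Rightarrow> 'a::real_normed_vector"
  assumes p: "partition_with_mesh L h N X"
    and match: "\<And>j. Suc j < N \<Longrightarrow> F j (X (Suc j)) = F (Suc j) (X (Suc j))"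
    and d: "\<And>j x. j < N \<Longrightarrow> (F j has_vector_derivative G j x) (at x)"
    and x: "x \<in> {0<..<L} - X ` {..N}"
  shows "(glue X F has_vector_derivative glue X G x) (at x)"
proof -
  let ?k = "element X x"
  have xL: "x \<in> {0..L}" using x by auto
  note e = element_props[OF p xL]
  have "X ?k \<in> X ` {..N}" "X (Suc ?k) \<in> X ` {..N}" using e(1) by auto
  then have "X ?k \<noteq> x" "X (Suc ?k) \<noteq> x" using x by (metis DiffD2)+
  then have xin: "x \<in> {X ?k<..<X (Suc ?k)}" using e by auto
  have "(F ?k has_vector_derivative glue X G x) (at x)" using d[OF e(1)] by (simp add: glue_def)
  then show ?thesis
    by (rule has_vector_derivative_transform_within_open[OF _ _ xin])
       (use glue_eq[where F=F, OF p match e(1)] in auto)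
qed

lemma glue_spline_Ck1:
  fixes F G :: "nat \<Rightarrow> real \<Rightarrow> real^3"
  assumes p: "partition_with_mesh L h N X"
    and match: "\<And>j. Suc j < N \<Longrightarrow> F j (X (Suc j)) = F (Suc j) (X (Suc j))"
      "\<And>j. Suc j < N \<Longrightarrow> G j (X (Suc j)) = G (Suc j) (X (Suc j))"
    and d: "\<And>j x. (F j has_vector_derivative G j x) (at x)"
    and G: "\<And>j. continuous_on UNIV (G j)"
    and poly: "\<And>j i. \<exists>q. degree q \<le> n \<and> (\<forall>x. F j x $ i = poly q x)"
  shows "(\<lambda>x. glue X F x $ i) \<in> spline_space n 1 L N X"
proof -
  have dg: "(glue X F has_vector_derivative glue X G x) (at x within {0..L})" for x
    by (rule glue_deriv[OF p match]) (auto intro: has_vector_derivative_at_within[OF d])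
  have cG: "continuous_on {0..L} (glue X G)"
    by (rule glue_continuous[OF p match(2)]) (auto intro: continuous_on_subset[OF G])
  have "(\<lambda>x. glue X F x $ i) \<in> Ck 1 L"
    unfolding Ck_def mem_Collect_eq
  proof (intro exI[of _ "\<lambda>k::nat. if k = 0 then (\<lambda>x. glue X F x $ i) else (\<lambda>x. glue X G x $ i)"] conjI allI impI ballI)
    fix k :: nat
    have cF: "continuous_on {0..L} (glue X F)"
      by (rule continuous_on_vector_derivative) (rule dg)
    show "continuous_on {0..L} (if k = 0 then (\<lambda>x. glue X F x $ i) else (\<lambda>x. glue X G x $ i))"
      using cF cG by (auto intro!: continuous_intros)
    fix x assume "k < 1"
    then show "((if k = 0 then (\<lambda>x. glue X F x $ i) else (\<lambda>x. glue X G x $ i)) has_vector_derivative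
        (if Suc k = 0 then (\<lambda>x. glue X F x $ i) else (\<lambda>x. glue X G x $ i)) x) (at x within {0..L})"
      using bounded_linear.has_vector_derivative[OF bounded_linear_vec_nth dg] by simp
  qed auto
  moreover have "\<exists>q. degree q \<le> n \<and> (\<forall>x\<in>{X j..X (Suc j)}. glue X F x $ i = poly q x)" if "j < N" for j
  proof -
    obtain q where "degree q \<le> n" "\<forall>x. F j x $ i = poly q x" using poly by blast
    then show ?thesis using glue_eq[where F=F, OF p match(1) that] by (intro exI[of _ q]) auto
  qed
  ultimately show ?thesis by (auto simp: spline_space_def)
qed

lemma glue_spline_Ck0:
  fixes F :: "nat \<Rightarrow> real \<Rightarrow> real^3"
  assumes p: "partition_with_mesh L h N X"
    and match: "\<And>j. Suc j < N \<Longrightarrow> F j (X (Suc j)) = F (Suc j) (X (Suc j))"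
    and F: "\<And>j. continuous_on UNIV (F j)"
    and poly: "\<And>j i. \<exists>q. degree q \<le> n \<and> (\<forall>x. F j x $ i = poly q x)"
  shows "(\<lambda>x. glue X F x $ i) \<in> spline_space n 0 L N X"
proof -
  have cF: "continuous_on {0..L} (glue X F)"
    by (rule glue_continuous[OF p match]) (auto intro: continuous_on_subset[OF F])
  then have "(\<lambda>x. glue X F x $ i) \<in> Ck 0 L"
    unfolding Ck_def by (auto intro!: exI[of _ "\<lambda>_ x. glue X F x $ i"] continuous_intros)
  moreover have "\<exists>q. degree q \<le> n \<and> (\<forall>x\<in>{X j..X (Suc j)}. glue X F x $ i = poly q x)" if "j < N" for j
  proof -
    obtain q where "degree q \<le> n" "\<forall>x. F j x $ i = poly q x" using poly by blast
    then show ?thesis using glue_eq[where F=F, OF p match that] by (intro exI[of _ q]) auto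
  qed
  ultimately show ?thesis by (auto simp: spline_space_def)
qed

lemma deriv_at_interior:
  assumes "x \<in> {0<..<L}" "(f has_vector_derivative D) (at x within {0..L})"
  shows "(f has_vector_derivative D) (at x)"
  using assms at_within_Icc_at[of 0 x L] by simp

text \<open>One radius \<open>r\<close> for all errors. The exact nodal values are kept apart
  because discrete admissibility and the boundary condition follow from them, not from
  closeness.\<close>

definition spline_interpolant ::
  "real \<Rightarrow> nat \<Rightarrow> (nat \<Rightarrow> real) \<Rightarrow> curve \<Rightarrow> curve \<Rightarrow> curve \<Rightarrow> curve \<Rightarrow> bool" where
  "spline_interpolant r N X y b yh bh \<longleftrightarrow> (yh, bh) \<in> V_discrete L N X \<and> (yh, bh) \<in> V L \<and>
      (\<forall>j\<le>N. yh (X j) = y (X j) \<and> cderiv L yh (X j) = cderiv L y (X j) \<and> bh (X j) = b (X j)) \<and>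
      (\<forall>x\<in>{0..L}. norm (yh x - y x) \<le> r \<and> norm (cderiv L yh x - cderiv L y x) \<le> r
        \<and> norm (bh x - b x) \<le> r) \<and>
      (AE x in Om L. norm (wderiv L (cderiv L yh) x - wderiv L (cderiv L y) x) \<le> r
        \<and> norm (wderiv L bh x - wderiv L b x) \<le> r)"

text \<open>\<open>K\<close> depends on y, b and L but not on the partition. The claims on
  \<open>cderiv L b\<close> link the pointwise twist condition of the smooth pair with
  \<open>wderiv\<close> and provide a bound on b'.\<close>

lemma spline_interpolation:
  fixes y b :: curve
  assumes y: "y \<in> Cinf L" and b: "b \<in> Cinf L"
  obtains K where "K \<ge> 0" "(y, b) \<in> V L" "AE x in Om L. wderiv L b x = cderiv L b x"
    "continuous_on {0..L} (cderiv L b)"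
    "\<And>h N X. partition_with_mesh L h N X \<Longrightarrow> \<exists>yh bh. spline_interpolant (K * h) N X y b yh bh"
proof -
  have Ck: "y \<in> Ck (Suc 2) L" "b \<in> Ck (Suc 1) L" using y b by (auto simp: Cinf_def)
  obtain D where D: "\<forall>i\<le>Suc 2. continuous_on {0..L} (D i)"
      "\<forall>x\<in>{0..L}. (y has_vector_derivative D 1 x) (at x within {0..L})"
      "\<forall>i\<le>2. \<forall>x\<in>{0..L}. 1 \<le> i \<longrightarrow> (D i has_vector_derivative D (Suc i) x) (at x within {0..L})"
    using Ck_derivatives[OF Ck(1)] by blast
  obtain C where C: "\<forall>i\<le>Suc 1. continuous_on {0..L} (C i)"
      "\<forall>x\<in>{0..L}. (b has_vector_derivative C 1 x) (at x within {0..L})"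
      "\<forall>i\<le>1. \<forall>x\<in>{0..L}. 1 \<le> i \<longrightarrow> (C i has_vector_derivative C (Suc i) x) (at x within {0..L})"
    using Ck_derivatives[OF Ck(2)] by blast
  note D = D[rule_format] and C = C[rule_format]
  define y1 y2 y3 b1 b2 where "y1 = D 1" and "y2 = D 2" and "y3 = D 3" and "b1 = C 1" and "b2 = C 2"
  have cont: "continuous_on {0..L} y1" "continuous_on {0..L} y2" "continuous_on {0..L} y3"
      "continuous_on {0..L} b1" "continuous_on {0..L} b2"
    using D(1) C(1) by (auto simp: y1_def y2_def y3_def b1_def b2_def)
  have dy: "(y has_vector_derivative y1 x) (at x within {0..L})" "(y1 has_vector_derivative y2 x) (at x within {0..L})"
      "(y2 has_vector_derivative y3 x) (at x within {0..L})"
    and db: "(b has_vector_derivative b1 x) (at x within {0..L})" "(b1 has_vector_derivative b2 x) (at x within {0..L})"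
    if "x \<in> {0..L}" for x
    using D(2)[OF that] D(3)[of 1, OF _ that] D(3)[of 2, OF _ that] C(2)[OF that] C(3)[of 1, OF _ that]
    by (simp_all add: y1_def y2_def y3_def b1_def b2_def numeral_2_eq_2 numeral_3_eq_3)
  have cy: "continuous_on {0..L} y" and cb: "continuous_on {0..L} b"
    using continuous_on_vector_derivative[OF dy(1)] continuous_on_vector_derivative[OF db(1)] by blast+
  obtain M1 where M1: "M1 \<ge> 0" "\<And>x. x \<in> {0..L} \<Longrightarrow> norm (y3 x) \<le> M1" using continuous_bound[OF cont(3)] by blast
  obtain M2 where M2: "M2 \<ge> 0" "\<And>x. x \<in> {0..L} \<Longrightarrow> norm (b2 x) \<le> M2" using continuous_bound[OF cont(5)] by blast
  obtain P2 where P2: "\<And>x. x \<in> {0..L} \<Longrightarrow> norm (y2 x) \<le> P2" using continuous_bound[OF cont(2)] by blast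
  obtain R1 where R1: "\<And>x. x \<in> {0..L} \<Longrightarrow> norm (b1 x) \<le> R1" using continuous_bound[OF cont(4)] by blast
  have Yp: "y \<in> H2 L" "\<And>x. x \<in> {0..L} \<Longrightarrow> cderiv L y x = y1 x" "AE x in Om L. wderiv L (cderiv L y) x = y2 x"
    using P2
    by (intro H2_classical[OF cy _ cont(1) finite.emptyI, where B=P2 and w=y2]; auto intro!: deriv_at_interior dy)+
  have Bp: "b \<in> H1 L" "AE x in Om L. wderiv L b x = b1 x"
    using R1 by (intro H1_classical[OF cb finite.emptyI, where B=R1 and w=b1]; auto intro!: deriv_at_interior db)+
  have wb: "weak_derivative L b b1"
    using R1 by (intro classical_weak_derivative(2)[OF cb finite.emptyI, where B=R1]) (auto intro!: deriv_at_interior db)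
  have Bc: "cderiv L b x = b1 x" if "x \<in> {0..L}" for x by (rule cderiv_unique[OF cb cont(4) wb that])
  define M where "M = max M1 M2"
  have M: "M \<ge> 0" "\<And>x. x \<in> {0..L} \<Longrightarrow> norm (y3 x) \<le> M" "\<And>x. x \<in> {0..L} \<Longrightarrow> norm (b2 x) \<le> M"
    using M1 M2 by (auto simp: M_def intro: order_trans max.coboundedI1 max.coboundedI2)
  \<comment> \<open>The errors have the form 15 M l^(n+1) or 2 M l^(n+1) with n \<le> 2: one factor
    l is bounded by h, the others by L^n \<le> 1 + L + L^2.\<close>
  define K where "K = 15 * M * (1 + L + L\<^sup>2)"
  have KK: "15 * M * l ^ Suc n \<le> K * h" "2 * M * l ^ Suc m \<le> K * h"
    if "0 < l" "l \<le> h" "h \<le> L" "n \<le> 2" "m \<le> 1" for l h :: real and n m :: nat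
  proof -
    have *: "l ^ Suc n \<le> (1 + L + L\<^sup>2) * h" if "n \<le> 2" for n
    proof -
      have "l ^ n \<le> L ^ n" using \<open>0 < l\<close> \<open>l \<le> h\<close> \<open>h \<le> L\<close> by (intro power_mono) auto
      also have "\<dots> \<le> 1 + L + L\<^sup>2"
        using that L_pos by (auto simp: numeral_2_eq_2 le_Suc_eq)
      finally have "l ^ n \<le> 1 + L + L\<^sup>2" .
      then have "l ^ n * l \<le> (1 + L + L\<^sup>2) * h"
        using \<open>0 < l\<close> \<open>l \<le> h\<close> L_pos by (intro mult_mono) auto
      then show ?thesis by (simp add: mult.commute)
    qed
    have "15 * M * l ^ Suc n \<le> 15 * M * ((1 + L + L\<^sup>2) * h)" using *[of n] M that by (intro mult_left_mono) auto
    then show "15 * M * l ^ Suc n \<le> K * h" by (simp add: K_def mult.assoc)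
    have "2 * M * l ^ Suc m \<le> 15 * M * ((1 + L + L\<^sup>2) * h)"
      using *[of m] M that by (intro mult_mono) auto
    then show "2 * M * l ^ Suc m \<le> K * h" by (simp add: K_def mult.assoc)
  qed
  show thesis
  proof (rule that[of K])
    show "K \<ge> 0" using M L_pos by (simp add: K_def)
    show "(y, b) \<in> V L" using Yp Bp by (simp add: V_iff)
    have inO: "AE x in Om L. x \<in> {0<..<L}" by (rule AE_Om_I) auto
    show "AE x in Om L. wderiv L b x = cderiv L b x"
      using Bp(2) inO by eventually_elim (simp add: Bc)
    show "continuous_on {0..L} (cderiv L b)" by (rule continuous_on_eq[OF cont(4)]) (simp add: Bc)
    fix h N X assume p: "partition_with_mesh L h N X"
    note mesh = mesh_bounds[OF p]
    define F0 where "F0 j = hermite (X j) (X (Suc j)) (y (X j)) (y (X (Suc j))) (y1 (X j)) (y1 (X (Suc j)))" for j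
    define F1 where "F1 j = hermite_d (X j) (X (Suc j)) (y (X j)) (y (X (Suc j))) (y1 (X j)) (y1 (X (Suc j)))" for j
    define F2 where "F2 j = hermite_dd (X j) (X (Suc j)) (y (X j)) (y (X (Suc j))) (y1 (X j)) (y1 (X (Suc j)))" for j
    define G0 where "G0 j = chord (X j) (X (Suc j)) (b (X j)) (b (X (Suc j)))" for j
    define G1 where "G1 j = (\<lambda>x::real. chord_slope (X j) (X (Suc j)) (b (X j)) (b (X (Suc j))))" for j
    have ends: "F0 j (X j) = y (X j)" "F1 j (X j) = y1 (X j)" "G0 j (X j) = b (X j)" for j
      by (simp_all add: F0_def F1_def G0_def chord_ends)
    have ends': "F0 j (X (Suc j)) = y (X (Suc j))" "F1 j (X (Suc j)) = y1 (X (Suc j))"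
      "G0 j (X (Suc j)) = b (X (Suc j))" if "j < N" for j
      using mesh(3)[OF that] by (simp_all add: F0_def F1_def G0_def chord_ends hermite_right)
    have match: "F0 j (X (Suc j)) = F0 (Suc j) (X (Suc j))" "F1 j (X (Suc j)) = F1 (Suc j) (X (Suc j))"
      "G0 j (X (Suc j)) = G0 (Suc j) (X (Suc j))" if "Suc j < N" for j
      using that by (simp_all add: ends ends')
    have der: "(F0 j has_vector_derivative F1 j x) (at x)" "(F1 j has_vector_derivative F2 j x) (at x)"
      "(G0 j has_vector_derivative G1 j x) (at x)" for j x
      unfolding F0_def F1_def F2_def G0_def G1_def by (rule hermite_deriv hermite_d_deriv chord_deriv)+
    have err: "norm (F0 j x - y x) \<le> K * h" "norm (F1 j x - y1 x) \<le> K * h" "norm (F2 j x - y2 x) \<le> K * h"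
      "norm (G0 j x - b x) \<le> K * h" "norm (G1 j x - b1 x) \<le> K * h"
      if j: "j < N" and x: "x \<in> {X j..X (Suc j)}" for j x
    proof -
      note sub = mesh(4)[OF j]
      have d: "(y has_vector_derivative y1 t) (at t within {X j..X (Suc j)})"
        "(y1 has_vector_derivative y2 t) (at t within {X j..X (Suc j)})"
        "(y2 has_vector_derivative y3 t) (at t within {X j..X (Suc j)})"
        "(b has_vector_derivative b1 t) (at t within {X j..X (Suc j)})"
        "(b1 has_vector_derivative b2 t) (at t within {X j..X (Suc j)})"
        "norm (y3 t) \<le> M" "norm (b2 t) \<le> M"
        if "t \<in> {X j..X (Suc j)}" for t
        using dy[of t] db[of t] M(2,3)[of t] has_vector_derivative_within_subset[OF _ sub] that sub by blast+
      note eh = hermite_error[where y=y, OF mesh(3)[OF j] d(1) d(2) d(3) d(6) x]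
      note ec = chord_error[where u=b, OF mesh(3)[OF j] d(4) d(5) d(7) x]
      note l = KK[of "X (Suc j) - X j" h, OF _ partition_mesh_le[OF p j] mesh(2)]
      have l0: "0 < X (Suc j) - X j" using mesh(3)[OF j] by simp
      show "norm (F0 j x - y x) \<le> K * h"
        using eh(3) l(1)[OF l0, of 2 0] by (simp add: F0_def numeral_3_eq_3 numeral_2_eq_2)
      show "norm (F1 j x - y1 x) \<le> K * h"
        using eh(2) l(1)[OF l0, of 1 0] by (simp add: F1_def numeral_2_eq_2)
      show "norm (F2 j x - y2 x) \<le> K * h"
        using eh(1) l(1)[OF l0, of 0 0] by (simp add: F2_def)
      show "norm (G0 j x - b x) \<le> K * h"
        using ec(2) l(2)[OF l0, of 0 1] by (simp add: G0_def numeral_2_eq_2)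
      show "norm (G1 j x - b1 x) \<le> K * h"
        using ec(1) l(2)[OF l0, of 0 0] by (simp add: G1_def)
    qed
    define yh zh wh where "yh = glue X F0" and "zh = glue X F1" and "wh = glue X F2"
    define bh qh where "bh = glue X G0" and "qh = glue X G1"
    have gerr: "norm (yh x - y x) \<le> K * h" "norm (zh x - y1 x) \<le> K * h" "norm (wh x - y2 x) \<le> K * h"
      "norm (bh x - b x) \<le> K * h" "norm (qh x - b1 x) \<le> K * h" if x: "x \<in> {0..L}" for x
    proof -
      note e = element_props[OF p x]
      have "x \<in> {X (element X x)..X (Suc (element X x))}" using e by simp
      note err[OF e(1) this]
      then show "norm (yh x - y x) \<le> K * h" "norm (zh x - y1 x) \<le> K * h" "norm (wh x - y2 x) \<le> K * h"
        "norm (bh x - b x) \<le> K * h" "norm (qh x - b1 x) \<le> K * h"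
        by (simp_all add: yh_def zh_def wh_def bh_def qh_def glue_def)
    qed
    have dyh: "(yh has_vector_derivative zh x) (at x within {0..L})" for x
      unfolding yh_def zh_def
      by (rule glue_deriv[OF p match(1,2)]) (use der in \<open>auto intro: has_vector_derivative_at_within\<close>)
    have czh: "continuous_on {0..L} zh"
      unfolding zh_def by (rule glue_continuous[OF p match(2)]) (simp_all add: F1_def continuous_on_hermite)
    have cont_G0: "continuous_on S (G0 j)" for S j
      unfolding G0_def chord_def by (intro continuous_intros)
    have cbh: "continuous_on {0..L} bh"
      unfolding bh_def by (rule glue_continuous[OF p match(3)]) (simp_all add: cont_G0)
    have cyh: "continuous_on {0..L} yh"
      by (rule continuous_on_vector_derivative) (rule dyh)
    have nodes: "finite (X ` {..N})" by simp
    have nb: "norm (wh x) \<le> K * h + P2" "norm (qh x) \<le> K * h + R1" if "x \<in> {0<..<L}" for x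
      using gerr(3,5)[of x] P2[of x] R1[of x] that norm_triangle_sub[of "wh x" "y2 x"] norm_triangle_sub[of "qh x" "b1 x"]
      by auto
    have Yh: "yh \<in> H2 L" "\<And>x. x \<in> {0..L} \<Longrightarrow> cderiv L yh x = zh x" "AE x in Om L. wderiv L (cderiv L yh) x = wh x"
    proof -
      have d1: "(yh has_vector_derivative zh x) (at x)" if "x \<in> {0<..<L}" for x
        using deriv_at_interior[OF that dyh] .
      have d2: "(zh has_vector_derivative wh x) (at x)" if "x \<in> {0<..<L} - X ` {..N}" for x
        unfolding zh_def wh_def by (rule glue_deriv_off_nodes[OF p match(2) der(2) that])
      show "yh \<in> H2 L" by (rule H2_classical(1)[OF cyh d1 czh nodes d2 nb(1)])
      show "AE x in Om L. wderiv L (cderiv L yh) x = wh x" by (rule H2_classical(3)[OF cyh d1 czh nodes d2 nb(1)])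
      show "cderiv L yh x = zh x" if "x \<in> {0..L}" for x
        by (rule H2_classical(2)[OF cyh d1 czh nodes d2 nb(1) that])
    qed
    have Bh: "bh \<in> H1 L" "AE x in Om L. wderiv L bh x = qh x"
    proof -
      have d: "(bh has_vector_derivative qh x) (at x)" if "x \<in> {0<..<L} - X ` {..N}" for x
        unfolding bh_def qh_def by (rule glue_deriv_off_nodes[OF p match(3) der(3) that])
      show "bh \<in> H1 L" by (rule H1_classical(1)[OF cbh nodes d nb(2)])
      show "AE x in Om L. wderiv L bh x = qh x" by (rule H1_classical(2)[OF cbh nodes d nb(2)])
    qed
    have "(yh, bh) \<in> V_discrete L N X"
    proof -
      have "(\<lambda>x. yh x $ i) \<in> spline_space 3 1 L N X" for i
        unfolding yh_def
        by (rule glue_spline_Ck1[OF p match(1,2) der(1)])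
           (simp_all add: F1_def F0_def continuous_on_hermite hermite_component_poly)
      moreover have "(\<lambda>x. bh x $ i) \<in> spline_space 1 0 L N X" for i
        unfolding bh_def
        by (rule glue_spline_Ck0[OF p match(3) cont_G0]; (unfold G0_def, rule chord_component_poly)?)
      ultimately show ?thesis by (simp add: V_discrete_def)
    qed
    moreover have "(yh, bh) \<in> V L" using Yh Bh by (simp add: V_iff)
    moreover have "yh (X j) = y (X j) \<and> cderiv L yh (X j) = cderiv L y (X j) \<and> bh (X j) = b (X j)" if j: "j \<le> N" for j
    proof -
      have xj: "X j \<in> {0..L}" by (rule partition_range[OF p j])
      have "yh (X j) = y (X j) \<and> zh (X j) = y1 (X j) \<and> bh (X j) = b (X j)"
      proof (cases "j < N")
        case True
        then have "X j \<in> {X j..X (Suc j)}" using mesh(3)[OF True] by simp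
        from glue_eq[where F=F0, OF p match(1) True this] glue_eq[where F=F1, OF p match(2) True this]
          glue_eq[where F=G0, OF p match(3) True this]
        show ?thesis by (simp add: yh_def zh_def bh_def ends)
      next
        case False
        \<comment> \<open>The last node has no element on its right and is read off as the right end
          of the last element.\<close>
        obtain k where k: "j = Suc k" "k < N" using False j p by (cases j) (auto simp: partition_with_mesh_def)
        then have "X j \<in> {X k..X (Suc k)}" using mesh(3)[OF k(2)] by simp
        from glue_eq[where F=F0, OF p match(1) k(2) this] glue_eq[where F=F1, OF p match(2) k(2) this]
          glue_eq[where F=G0, OF p match(3) k(2) this]
        show ?thesis using k by (simp add: yh_def zh_def bh_def ends')
      qed
      then show ?thesis using Yh(2)[OF xj] Yp(2)[OF xj] by simp
    qed
    moreover have "norm (yh x - y x) \<le> K * h \<and> norm (cderiv L yh x - cderiv L y x) \<le> K * h \<and> norm (bh x - b x) \<le> K * h"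
      if "x \<in> {0..L}" for x
      using gerr[OF that] Yh(2)[OF that] Yp(2)[OF that] by simp
    moreover have "AE x in Om L. norm (wderiv L (cderiv L yh) x - wderiv L (cderiv L y) x) \<le> K * h
        \<and> norm (wderiv L bh x - wderiv L b x) \<le> K * h"
      using Yh(3) Yp(3) Bh(2) Bp(2) inO by eventually_elim (simp add: gerr)
    ultimately show "\<exists>yh bh. spline_interpolant (K * h) N X y b yh bh"
      unfolding spline_interpolant_def by blast
  qed
qed

end

section \<open>Recovery sequences\<close>

text \<open>For each h the largest attainable level k \<le> 1/h is taken. The cap keeps the set of
  levels finite and recedes as h tends to 0; monotonicity passes from the largest level down to any
  fixed one.\<close>

lemma diagonal_choice:
  fixes good :: "nat \<Rightarrow> real \<Rightarrow> 'b \<Rightarrow> bool"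
  assumes H: "H \<subseteq> {0<..}"
    and ex: "\<And>k. \<forall>\<^sub>F h in at 0 within H. \<exists>w. good k h w"
    and mono: "\<And>j k h w. k \<le> j \<Longrightarrow> good j h w \<Longrightarrow> good k h w"
    and A: "a \<in> A" "\<And>k h w. good k h w \<Longrightarrow> w \<in> A"
  shows "\<exists>U. (\<forall>h. U h \<in> A) \<and> (\<forall>k. \<forall>\<^sub>F h in at 0 within H. good k h (U h))"
proof -
  define ks where "ks h = {k. real k \<le> 1 / h \<and> (\<exists>w. good k h w)}" for h
  \<comment> \<open>The default \<open>a\<close> serves those h where no level is attainable, so
    that \<open>U\<close> has values in \<open>A\<close> throughout.\<close>
  define U where "U h = (if ks h = {} then a else (SOME w. good (Max (ks h)) h w))" for h
  have fin: "finite (ks h)" for h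
  proof (rule finite_subset)
    show "ks h \<subseteq> {..nat \<lceil>1 / h\<rceil>}"
    proof
      fix k assume "k \<in> ks h"
      then have "real k \<le> 1 / h" by (simp add: ks_def)
      then have "real k \<le> real_of_int \<lceil>1 / h\<rceil>" by linarith
      then show "k \<in> {..nat \<lceil>1 / h\<rceil>}" by (simp add: le_nat_iff)
    qed
  qed simp
  have gU: "good (Max (ks h)) h (U h)" if "ks h \<noteq> {}" for h
  proof -
    have "Max (ks h) \<in> ks h" using fin that by (rule Max_in)
    then have "\<exists>w. good (Max (ks h)) h w" by (simp add: ks_def)
    from someI_ex[OF this] show ?thesis using that by (simp add: U_def)
  qed
  show ?thesis
  proof (intro exI[of _ U] conjI allI)
    show "U h \<in> A" for h
    proof (cases "ks h = {}")
      case False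
      then show ?thesis using A(2)[OF gU] by blast
    qed (simp add: U_def A(1))
    show "\<forall>\<^sub>F h in at 0 within H. good k h (U h)" for k
    proof -
      have "\<forall>\<^sub>F h in at 0 within H. h < 1 / (real k + 1)"
        by (rule order_tendstoD(2)[OF tendsto_ident_at]) simp
      moreover have "\<forall>\<^sub>F h in at 0 within H. 0 < h"
        unfolding eventually_at_filter by (rule always_eventually) (use H in auto)
      ultimately show ?thesis
        using ex[of k]
      proof eventually_elim
        case (elim h)
        have "h * (real k + 1) < 1" using elim(1) by (simp add: field_simps)
        then have "real k * h \<le> 1" using elim(2) by (simp add: algebra_simps)
        then have "real k \<le> 1 / h" using elim(2) by (simp add: field_simps)
        then have k: "k \<in> ks h" using elim(3) by (simp add: ks_def)
        then have "good (Max (ks h)) h (U h)" using gU by blast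
        moreover have "k \<le> Max (ks h)" using fin k by (rule Max_ge)
        ultimately show ?case using mono by blast
      qed
    qed
  qed
qed

context bounded_interval
begin

section \<open>Stability of the limit energy and recovery for smooth pairs\<close>

lemma H1_diff:
  assumes "u \<in> H1 L" "v \<in> H1 L"
  shows "(\<lambda>x. u x - v x) \<in> H1 L"
    "AE x in Om L. wderiv L (\<lambda>x. u x - v x) x = wderiv L u x - wderiv L v x"
proof -
  note s = H1_scaleR[OF assms(2), of "-1"]
  note a = H1_add[OF assms(1) s(1)]
  show "(\<lambda>x. u x - v x) \<in> H1 L" using a(1) by simp
  show "AE x in Om L. wderiv L (\<lambda>x. u x - v x) x = wderiv L u x - wderiv L v x"
    using a(2) s(2) by eventually_elim simp
qed

lemma H2_diff:
  assumes "u \<in> H2 L" "v \<in> H2 L"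
  shows "(\<lambda>x. u x - v x) \<in> H2 L"
    "\<And>x. x \<in> {0..L} \<Longrightarrow> cderiv L (\<lambda>x. u x - v x) x = cderiv L u x - cderiv L v x"
    "AE x in Om L. wderiv L (cderiv L (\<lambda>x. u x - v x)) x = wderiv L (cderiv L u) x - wderiv L (cderiv L v) x"
proof -
  note s = H2_scaleR[OF assms(2), where r="-1"]
  note a = H2_add[OF assms(1) s(1)]
  show "(\<lambda>x. u x - v x) \<in> H2 L" using a(1) by simp
  show "cderiv L (\<lambda>x. u x - v x) x = cderiv L u x - cderiv L v x" if "x \<in> {0..L}" for x
    using a(2)[OF that] s(2)[OF that] by simp
  show "AE x in Om L. wderiv L (cderiv L (\<lambda>x. u x - v x)) x = wderiv L (cderiv L u) x - wderiv L (cderiv L v) x"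
    using a(3) s(3) by eventually_elim simp
qed

lemma V_norm_diff_bounds:
  assumes "(y, b) \<in> V L" "(z, c) \<in> V L" "V_norm L (\<lambda>x. y x - z x, \<lambda>x. b x - c x) \<le> s"
  shows "L2_norm L (\<lambda>x. wderiv L (cderiv L y) x - wderiv L (cderiv L z) x) \<le> s"
    "L2_norm L (\<lambda>x. wderiv L b x - wderiv L c x) \<le> s"
proof -
  have H: "y \<in> H2 L" "z \<in> H2 L" "b \<in> H1 L" "c \<in> H1 L" using assms by (auto simp: V_iff)
  note d2 = H2_diff[OF H(1,2)] and d1 = H1_diff[OF H(3,4)]
  have n: "H2_norm L (\<lambda>x. y x - z x) \<le> s" "H1_norm L (\<lambda>x. b x - c x) \<le> s"
    using assms(3) H1_norm_nonneg[of "\<lambda>x. b x - c x"] H2_norm_nonneg[of "\<lambda>x. y x - z x"]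
    unfolding V_norm_pair by linarith+
  have "L2_norm L (\<lambda>x. wderiv L (cderiv L y) x - wderiv L (cderiv L z) x)
      = L2_norm L (wderiv L (cderiv L (\<lambda>x. y x - z x)))"
    using d2(3) by (intro L2_norm_cong_AE L2_diff wderiv_H1(1) H2_cderiv(1) H d2) auto
  also have "\<dots> \<le> s" using L2_le_H2_norm(3) n(1) by (rule order_trans)
  finally show "L2_norm L (\<lambda>x. wderiv L (cderiv L y) x - wderiv L (cderiv L z) x) \<le> s" .
  have "L2_norm L (\<lambda>x. wderiv L b x - wderiv L c x) = L2_norm L (wderiv L (\<lambda>x. b x - c x))"
    using d1(2) by (intro L2_norm_cong_AE L2_diff wderiv_H1(1) H d1) auto
  also have "\<dots> \<le> s" using L2_le_H1_norm(2) n(2) by (rule order_trans)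
  finally show "L2_norm L (\<lambda>x. wderiv L b x - wderiv L c x) \<le> s" .
qed

text \<open>Bounding |p'| by |p| + |p' - p| splits off squares of the increments, and
  \<open>s \<le> 1\<close> turns these into multiples of s; thus 10 = 2 + 8.\<close>

lemma Qbar_integral_diff:
  fixes p p' :: "real \<Rightarrow> 'a::euclidean_space" and q q' :: "real \<Rightarrow> 'b::euclidean_space"
  assumes L2: "p \<in> L2 L" "p' \<in> L2 L" "q \<in> L2 L" "q' \<in> L2 L"
    and s: "L2_norm L (\<lambda>x. p' x - p x) \<le> s" "L2_norm L (\<lambda>x. q' x - q x) \<le> s" "s \<le> 1"
  shows "\<bar>(LINT x|Om L. Qbar (norm (p' x)) (norm (q' x))) - (LINT x|Om L. Qbar (norm (p x)) (norm (q x)))\<bar>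
    \<le> (4 * L2_norm L p + 16 * L2_norm L q + 10) * s"
proof -
  define d where "d x = p' x - p x" for x
  define e where "e x = q' x - q x" for x
  have de: "d \<in> L2 L" "e \<in> L2 L" unfolding d_def[abs_def] e_def[abs_def] by (intro L2_diff L2)+
  have s': "L2_norm L d \<le> s" "L2_norm L e \<le> s" using s by (simp_all add: d_def[abs_def] e_def[abs_def])
  have s0: "0 \<le> s" using s'(1) L2_norm_nonneg[of d] by linarith
  let ?B = "\<lambda>x. 4 * (norm (p x) * norm (d x)) + 2 * (norm (d x))\<^sup>2 + (16 * (norm (q x) * norm (e x)) + 8 * (norm (e x))\<^sup>2)"
  note I = Qbar_integrable[OF L2(2,4)] Qbar_integrable[OF L2(1,3)]
  have pw: "\<bar>Qbar (norm (p' x)) (norm (q' x)) - Qbar (norm (p x)) (norm (q x))\<bar> \<le> ?B x" for x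
  proof -
    have p': "norm (p' x) \<le> norm (p x) + norm (d x)" "norm (q' x) \<le> norm (q x) + norm (e x)"
      using norm_triangle_sub[of "p' x" "p x"] norm_triangle_sub[of "q' x" "q x"] by (simp_all add: d_def e_def)
    have "norm (p' x) * norm (d x) \<le> (norm (p x) + norm (d x)) * norm (d x)"
      "norm (q' x) * norm (e x) \<le> (norm (q x) + norm (e x)) * norm (e x)"
      by (intro mult_right_mono p' norm_ge_zero)+
    then have m: "norm (p' x) * norm (d x) \<le> norm (p x) * norm (d x) + (norm (d x))\<^sup>2"
      "norm (q' x) * norm (e x) \<le> norm (q x) * norm (e x) + (norm (e x))\<^sup>2"
      by (simp_all add: algebra_simps power2_eq_square)
    have n: "norm (p' x - p x) = norm (d x)" "norm (q' x - q x) = norm (e x)"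
      "norm (p x - p' x) = norm (d x)" "norm (q x - q' x) = norm (e x)"
      by (simp_all add: d_def e_def norm_minus_commute)
    have nn: "0 \<le> norm (p x) * norm (d x)" "0 \<le> norm (q x) * norm (e x)" "0 \<le> (norm (d x))\<^sup>2" "0 \<le> (norm (e x))\<^sup>2"
      by auto
    show ?thesis
      using Qbar_diff_le[of "p' x" "q' x" "p x" "q x"] Qbar_diff_le[of "p x" "q x" "p' x" "q' x"] m nn
      unfolding n by linarith
  qed
  have Bi: "integrable (Om L) ?B"
    by (intro Bochner_Integration.integrable_add integrable_mult_right L2_norm_product_integrable
        L2_integrable_square L2 de)
  have "\<bar>(LINT x|Om L. Qbar (norm (p' x)) (norm (q' x))) - (LINT x|Om L. Qbar (norm (p x)) (norm (q x)))\<bar>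
      = \<bar>LINT x|Om L. Qbar (norm (p' x)) (norm (q' x)) - Qbar (norm (p x)) (norm (q x))\<bar>"
    using I by simp
  also have "\<dots> \<le> (LINT x|Om L. \<bar>Qbar (norm (p' x)) (norm (q' x)) - Qbar (norm (p x)) (norm (q x))\<bar>)"
    by (rule integral_abs_bound)
  also have "\<dots> \<le> (LINT x|Om L. ?B x)"
    by (intro integral_mono Bi pw integrable_abs Bochner_Integration.integrable_diff I)
  also have "\<dots> = 4 * (LINT x|Om L. norm (p x) * norm (d x)) + 2 * (L2_norm L d)\<^sup>2
      + (16 * (LINT x|Om L. norm (q x) * norm (e x)) + 8 * (L2_norm L e)\<^sup>2)"
    using L2_norm_product_integrable[OF L2(1) de(1)] L2_norm_product_integrable[OF L2(3) de(2)]
      L2_integrable_square[OF de(1)] L2_integrable_square[OF de(2)]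
    by (simp add: L2_norm_power2)
  also have "\<dots> \<le> 4 * (L2_norm L p * s) + 2 * s + (16 * (L2_norm L q * s) + 8 * s)"
  proof -
    have sq: "(L2_norm L k)\<^sup>2 \<le> s" if "L2_norm L k \<le> s" for k :: "real \<Rightarrow> 'c::euclidean_space"
    proof -
      have "(L2_norm L k)\<^sup>2 \<le> s * 1"
        unfolding power2_eq_square using that s(3) s0 by (intro mult_mono) auto
      then show ?thesis by simp
    qed
    have "(LINT x|Om L. norm (p x) * norm (d x)) \<le> L2_norm L p * s"
      using L2_Cauchy_Schwarz_norm[OF L2(1) de(1)] mult_left_mono[OF s'(1) L2_norm_nonneg[of p]] by linarith
    moreover have "(LINT x|Om L. norm (q x) * norm (e x)) \<le> L2_norm L q * s"
      using L2_Cauchy_Schwarz_norm[OF L2(3) de(2)] mult_left_mono[OF s'(2) L2_norm_nonneg[of q]] by linarith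
    ultimately show ?thesis using sq[OF s'(1)] sq[OF s'(2)] by linarith
  qed
  also have "\<dots> = (4 * L2_norm L p + 16 * L2_norm L q + 10) * s" by (simp add: algebra_simps)
  finally show ?thesis .
qed

text \<open>The frame condition is imposed almost everywhere, while the nodes form a null set;
  continuity of y' and b extends it to every point.\<close>

lemma frame_pointwise:
  assumes f: "(y, b) \<in> A_frame L T lbc" and x: "x \<in> {0..L}"
  shows "norm (cderiv L y x) = 1" "norm (b x) = 1" "cderiv L y x \<bullet> b x = 0"
proof -
  have V: "y \<in> H2 L" "b \<in> H1 L" using f by (auto simp: A_frame_def V_iff)
  have ae: "AE x in Om L. norm (cderiv L y x) = 1 \<and> norm (b x) = 1 \<and> cderiv L y x \<bullet> b x = 0"
    using f by (simp add: A_frame_def rotation_frame_matrix_iff)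
  note c = H1_continuous[OF H2_cderiv(1)[OF V(1)]] H1_continuous[OF V(2)]
  show "norm (cderiv L y x) = 1"
    by (rule AE_eq_imp_continuous_eq[OF _ _ _ x]) (use ae c in \<open>auto intro!: continuous_intros\<close>)
  show "norm (b x) = 1"
    by (rule AE_eq_imp_continuous_eq[OF _ _ _ x]) (use ae c in \<open>auto intro!: continuous_intros\<close>)
  show "cderiv L y x \<bullet> b x = 0"
    by (rule AE_eq_imp_continuous_eq[OF _ _ _ x]) (use ae c in \<open>auto intro!: continuous_intros\<close>)
qed

text \<open>The pointwise error of order h is squared before the division by \<epsilon>, which
  explains the coupling between h and the penalty parameters.\<close>

lemma penalty_bound:
  assumes i: "integrable (Om L) (\<lambda>x. (f x)\<^sup>2)" and le: "AE x in Om L. \<bar>f x\<bar> \<le> k * h" and "\<epsilon> > 0"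
  shows "(1 / (2 * \<epsilon>)) * (LINT x|Om L. (f x)\<^sup>2) \<le> (L * k\<^sup>2 / 2) * (h\<^sup>2 / \<epsilon>)"
proof -
  have "(LINT x|Om L. (f x)\<^sup>2) \<le> (LINT x|Om L. (k * h)\<^sup>2)"
  proof (rule integral_mono_AE[OF i L2_integrable[OF L2_const]])
    show "AE x in Om L. (f x)\<^sup>2 \<le> (k * h)\<^sup>2"
      using le
    proof eventually_elim
      case (elim x)
      then have "\<bar>f x\<bar>\<^sup>2 \<le> (k * h)\<^sup>2" by (intro power_mono) auto
      then show ?case by simp
    qed
  qed
  also have "\<dots> = L * (k * h)\<^sup>2" using measure_Om by simp
  finally have "(1 / (2 * \<epsilon>)) * (LINT x|Om L. (f x)\<^sup>2) \<le> (1 / (2 * \<epsilon>)) * (L * (k * h)\<^sup>2)"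
    using \<open>\<epsilon> > 0\<close> by (intro mult_left_mono) auto
  then show ?thesis by (simp add: power_mult_distrib mult_ac)
qed

text \<open>All errors are collected in one rate \<open>R\<close>. The restriction
  \<open>R h \<le> 1\<close> enters because the comparison of limit energies requires derivatives at
  L2 distance at most 1.\<close>

lemma smooth_recovery:
  fixes T :: "curve \<times> curve \<Rightarrow> 'w::real_normed_vector" and y b :: curve
  assumes dep: "depends_only_on_boundary_values L T"
    and m: "regularized_modulus c0 c1 c2 cuni m" and cuni: "cuni > 0"
    and H: "H \<subseteq> {0<..}" and part: "\<And>h. h \<in> H \<Longrightarrow> partition_with_mesh L h (N h) (X h)"
    and pos: "\<And>h. h \<in> H \<Longrightarrow> \<delta> h > 0 \<and> \<epsilon>1 h > 0 \<and> \<epsilon>2 h > 0"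
    and lim: "(\<delta> \<longlongrightarrow> 0) (at 0 within H)" "((\<lambda>h. h\<^sup>2 / \<epsilon>1 h + h\<^sup>2 / \<epsilon>2 h) \<longlongrightarrow> 0) (at 0 within H)"
    and smooth: "y \<in> Cinf L" "b \<in> Cinf L" and frame: "(y, b) \<in> A_frame L T lbc"
    and twist: "\<And>x. x \<in> {0<..<L} \<Longrightarrow> cderiv L y x \<bullet> cderiv L b x = 0"
  obtains R where "(R \<longlongrightarrow> 0) (at 0 within H)"
    "\<And>h. h \<in> H \<Longrightarrow> R h \<le> 1 \<Longrightarrow> \<exists>yh bh e. (yh, bh) \<in> V L \<and>
      V_norm L (\<lambda>x. yh x - y x, \<lambda>x. bh x - b x) \<le> R h \<and> 0 \<le> e \<and>
      E_disc L T lbc m (\<delta> h) (\<epsilon>1 h) (\<epsilon>2 h) (N h) (X h) (yh, bh) = ennreal e \<and>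
      \<bar>e - (LINT x|Om L. Qbar (norm (wderiv L (cderiv L y) x)) (norm (wderiv L b x)))\<bar> \<le> R h"
proof -
  obtain K where K: "K \<ge> 0" "(y, b) \<in> V L" "AE x in Om L. wderiv L b x = cderiv L b x"
      "continuous_on {0..L} (cderiv L b)"
    and interp: "\<And>h N X. partition_with_mesh L h N X \<Longrightarrow> \<exists>yh bh. spline_interpolant (K * h) N X y b yh bh"
    using spline_interpolation[OF smooth] by blast
  obtain M where M: "M \<ge> 0" "\<And>x. x \<in> {0..L} \<Longrightarrow> norm (cderiv L b x) \<le> M" using continuous_bound[OF K(4)] by blast
  have VH: "y \<in> H2 L" "b \<in> H1 L" using K(2) by (auto simp: V_iff)
  note p = wderiv_H1(1)[OF H2_cderiv(1)[OF VH(1)]] and q = wderiv_H1(1)[OF VH(2)]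
  define A where "A = 4 * L2_norm L (wderiv L (cderiv L y)) + 16 * L2_norm L (wderiv L b) + 10"
  \<comment> \<open>Covers both penalties: \<open>K * (1 + K * L) + K\<close> for y' . b and
    \<open>K * (M + K * L) + K\<close> for y' . b'.\<close>
  define k where "k = K * (M + K * L + 2)"
  \<comment> \<open>The factor is 3 + 2, from the norm bounds in \<open>H2\<close> and
    \<open>H1\<close>.\<close>
  define S where "S h = 5 * (K * h) * sqrt L" for h
  \<comment> \<open>The summands stand for the distance in \<open>V\<close>, the change of the limit
    energy, the regularisation and the two penalties.\<close>
  define R where "R h = S h + A * S h + 5 / 2 * (cuni * \<delta> h) * L + (L * k\<^sup>2 / 2) * (h\<^sup>2 / \<epsilon>1 h + h\<^sup>2 / \<epsilon>2 h)" for h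
  have A0: "0 \<le> A" by (simp add: A_def)
  show thesis
  proof (rule that[of R])
    have "(S \<longlongrightarrow> 5 * (K * 0) * sqrt L) (at 0 within H)"
      unfolding S_def by (intro tendsto_intros)
    then have S0: "(S \<longlongrightarrow> 0) (at 0 within H)" by simp
    have "(R \<longlongrightarrow> 0 + A * 0 + 5 / 2 * (cuni * 0) * L + (L * k\<^sup>2 / 2) * 0) (at 0 within H)"
      unfolding R_def by (intro tendsto_add tendsto_mult tendsto_const S0 lim)
    then show "(R \<longlongrightarrow> 0) (at 0 within H)" by simp
    fix h assume h: "h \<in> H" and R1: "R h \<le> 1"
    note ps = pos[OF h] and mb = mesh_bounds[OF part[OF h]]
    have h0: "0 < h" using H h by auto
    obtain yh bh where Vd: "(yh, bh) \<in> V_discrete L (N h) (X h)" and Vh: "(yh, bh) \<in> V L"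
      and nodes: "\<And>j. j \<le> N h \<Longrightarrow> yh (X h j) = y (X h j) \<and> cderiv L yh (X h j) = cderiv L y (X h j) \<and> bh (X h j) = b (X h j)"
      and err: "\<And>x. x \<in> {0..L} \<Longrightarrow> norm (yh x - y x) \<le> K * h \<and> norm (cderiv L yh x - cderiv L y x) \<le> K * h
        \<and> norm (bh x - b x) \<le> K * h"
      and errd: "AE x in Om L. norm (wderiv L (cderiv L yh) x - wderiv L (cderiv L y) x) \<le> K * h
        \<and> norm (wderiv L bh x - wderiv L b x) \<le> K * h"
      using interp[OF part[OF h]] unfolding spline_interpolant_def by blast
    have VHh: "yh \<in> H2 L" "bh \<in> H1 L" using Vh by (auto simp: V_iff)
    note ph = wderiv_H1(1)[OF H2_cderiv(1)[OF VHh(1)]] and qh = wderiv_H1(1)[OF VHh(2)]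
    have Kh: "0 \<le> K * h" using K(1) h0 by simp
    have KhL: "K * h \<le> K * L" using mb(2) K(1) by (intro mult_left_mono)
    have adm: "(yh, bh) \<in> discrete_admissible L T lbc (N h) (X h)"
    proof -
      \<comment> \<open>As 0 and L are nodes, exact nodal values reproduce the boundary data and
        hence the value of \<open>T\<close>.\<close>
      have X: "X h 0 = 0" "X h (N h) = L" using part[OF h] by (auto simp: partition_with_mesh_def)
      have "\<forall>x\<in>{0, L}. yh x = y x \<and> cderiv L yh x = cderiv L y x \<and> bh x = b x"
        using nodes[of 0] nodes[of "N h"] X by simp
      then have "T (yh, bh) = T (y, b)"
        using dep Vh K(2) unfolding depends_only_on_boundary_values_def by blast
      then have "T (yh, bh) = lbc" using frame by (simp add: A_frame_def)
      moreover have "norm (cderiv L yh (X h j)) = 1 \<and> norm (bh (X h j)) = 1" if "j \<le> N h" for j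
        using nodes[OF that] frame_pointwise[OF frame partition_range[OF part[OF h] that]] by simp
      ultimately show ?thesis using Vd by (simp add: discrete_admissible_def)
    qed
    have Vn: "V_norm L (\<lambda>x. yh x - y x, \<lambda>x. bh x - b x) \<le> S h"
    proof -
      note d2 = H2_diff[OF VHh(1) VH(1)] and d1 = H1_diff[OF VHh(2) VH(2)]
      have "H2_norm L (\<lambda>x. yh x - y x) \<le> 3 * (K * h) * sqrt L"
      proof (rule H2_norm_bound[OF d2(1) Kh])
        show "AE x in Om L. norm (wderiv L (cderiv L (\<lambda>x. yh x - y x)) x) \<le> K * h"
          using errd d2(3) by eventually_elim simp
      qed (use err d2(2) in auto)
      moreover have "H1_norm L (\<lambda>x. bh x - b x) \<le> 2 * (K * h) * sqrt L"
      proof (rule H1_norm_bound[OF d1(1) Kh])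
        show "AE x in Om L. norm (wderiv L (\<lambda>x. bh x - b x) x) \<le> K * h"
          using errd d1(2) by eventually_elim simp
      qed (use err in auto)
      ultimately show ?thesis by (simp add: V_norm_pair S_def)
    qed
    define Q where "Q = (LINT x|Om L. Qbar (norm (wderiv L (cderiv L y) x)) (norm (wderiv L b x)))"
    define Qh where "Qh = (LINT x|Om L. Qbar (norm (wderiv L (cderiv L yh) x)) (norm (wderiv L bh x)))"
    define Ib where "Ib = (LINT x|Om L. bending m (\<delta> h) (wderiv L (cderiv L yh) x) (wderiv L bh x))"
    define J1 where "J1 = (1 / (2 * \<epsilon>1 h)) * (LINT x|Om L. (cderiv L yh x \<bullet> bh x)\<^sup>2)"
    define J2 where "J2 = (1 / (2 * \<epsilon>2 h)) * (LINT x|Om L. (cderiv L yh x \<bullet> wderiv L bh x)\<^sup>2)"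
    have S0: "0 \<le> S h" using Kh L_pos by (simp add: S_def)
    have r: "0 \<le> (L * k\<^sup>2 / 2) * (h\<^sup>2 / \<epsilon>1 h)" "0 \<le> (L * k\<^sup>2 / 2) * (h\<^sup>2 / \<epsilon>2 h)" "0 \<le> 5 / 2 * (cuni * \<delta> h) * L"
      using ps L_pos cuni by auto
    have R_split: "R h = S h + A * S h + 5 / 2 * (cuni * \<delta> h) * L + (L * k\<^sup>2 / 2) * (h\<^sup>2 / \<epsilon>1 h) + (L * k\<^sup>2 / 2) * (h\<^sup>2 / \<epsilon>2 h)"
      by (simp add: R_def algebra_simps)
    have AS: "0 \<le> A * S h" using A0 S0 by simp
    have SR: "S h \<le> R h" using r AS unfolding R_split by linarith
    have d1: "\<bar>Qh - Q\<bar> \<le> A * S h"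
      unfolding Qh_def Q_def A_def
      by (rule Qbar_integral_diff[OF p ph q qh]) (use V_norm_diff_bounds[OF Vh K(2) Vn] SR R1 in auto)
    have d2: "\<bar>(1 / 2) * Ib - Qh\<bar> \<le> 5 / 2 * (cuni * \<delta> h) * L"
    proof -
      note bi = bending_integrable[OF m conjunct1[OF ps] ph qh] and qi = Qbar_integrable[OF ph qh]
      let ?f = "\<lambda>x. bending m (\<delta> h) (wderiv L (cderiv L yh) x) (wderiv L bh x)
          - 2 * Qbar (norm (wderiv L (cderiv L yh) x)) (norm (wderiv L bh x))"
      have "\<bar>Ib - 2 * Qh\<bar> = \<bar>LINT x|Om L. ?f x\<bar>"
        unfolding Ib_def Qh_def using bi qi by simp
      also have "\<dots> \<le> (LINT x|Om L. \<bar>?f x\<bar>)" by (rule integral_abs_bound)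
      also have "\<dots> \<le> (LINT x|Om L. 5 * (cuni * \<delta> h))"
        by (intro integral_mono integrable_abs Bochner_Integration.integrable_diff bi integrable_mult_right qi
            L2_integrable[OF L2_const] bending_props(2)[OF m conjunct1[OF ps]])
      also have "\<dots> = 5 * (cuni * \<delta> h) * L" using measure_Om by simp
      finally show ?thesis by linarith
    qed
    have inO: "AE x in Om L. x \<in> {0<..<L}" by (rule AE_Om_I) auto
    have zc: "continuous_on {0..L} (cderiv L yh)" by (rule H1_continuous[OF H2_cderiv(1)[OF VHh(1)]])
    have J1: "J1 \<le> (L * k\<^sup>2 / 2) * (h\<^sup>2 / \<epsilon>1 h)"
      unfolding J1_def
    proof (rule penalty_bound)
      show "integrable (Om L) (\<lambda>x. (cderiv L yh x \<bullet> bh x)\<^sup>2)"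
        by (rule square_inner_integrable(1)[OF zc L2_continuous[OF H1_continuous[OF VHh(2)]]])
      show "AE x in Om L. \<bar>cderiv L yh x \<bullet> bh x\<bar> \<le> k * h"
      proof (rule AE_Om_I)
        fix x assume "x \<in> {0<..<L}"
        then have x: "x \<in> {0..L}" by simp
        note fp = frame_pointwise[OF frame x] and er = err[OF x]
        \<comment> \<open>Subtracting y' . b = 0 leaves two terms, each with one factor of order
          h.\<close>
        have "cderiv L yh x \<bullet> bh x = (cderiv L yh x - cderiv L y x) \<bullet> bh x + cderiv L y x \<bullet> (bh x - b x)"
          using fp(3) by (simp add: inner_diff_left inner_diff_right)
        then have "\<bar>cderiv L yh x \<bullet> bh x\<bar> \<le> norm (cderiv L yh x - cderiv L y x) * norm (bh x)
            + norm (cderiv L y x) * norm (bh x - b x)"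
          using Cauchy_Schwarz_ineq2[of "cderiv L yh x - cderiv L y x" "bh x"]
            Cauchy_Schwarz_ineq2[of "cderiv L y x" "bh x - b x"] by linarith
        also have "\<dots> \<le> (K * h) * (1 + K * L) + 1 * (K * h)"
        proof (intro add_mono mult_mono)
          show "norm (bh x) \<le> 1 + K * L" using norm_triangle_sub[of "bh x" "b x"] fp(2) er KhL by linarith
        qed (use er fp Kh in auto)
        also have "\<dots> \<le> (K * h) * (M + K * L + 2)"
          using mult_nonneg_nonneg[OF Kh M(1)] by (simp add: algebra_simps)
        also have "\<dots> = k * h" by (simp add: k_def)
        finally show "\<bar>cderiv L yh x \<bullet> bh x\<bar> \<le> k * h" .
      qed
    qed (use ps in simp)
    have J2: "J2 \<le> (L * k\<^sup>2 / 2) * (h\<^sup>2 / \<epsilon>2 h)"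
      unfolding J2_def
    proof (rule penalty_bound)
      show "integrable (Om L) (\<lambda>x. (cderiv L yh x \<bullet> wderiv L bh x)\<^sup>2)"
        by (rule square_inner_integrable(1)[OF zc qh])
      show "AE x in Om L. \<bar>cderiv L yh x \<bullet> wderiv L bh x\<bar> \<le> k * h"
        using inO errd K(3)
      proof eventually_elim
        case (elim x)
        then have x: "x \<in> {0..L}" by simp
        note fp = frame_pointwise[OF frame x] and er = err[OF x]
        \<comment> \<open>At almost every point \<open>wderiv L b\<close> coincides with the
          continuous derivative of b, for which the twist condition is given.\<close>
        have tw: "cderiv L y x \<bullet> wderiv L b x = 0" using twist[of x] elim by simp
        have qM: "norm (wderiv L b x) \<le> M" using M(2)[OF x] elim by simp
        have "cderiv L yh x \<bullet> wderiv L bh x = (cderiv L yh x - cderiv L y x) \<bullet> wderiv L bh x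
            + cderiv L y x \<bullet> (wderiv L bh x - wderiv L b x)"
          using tw by (simp add: inner_diff_left inner_diff_right)
        then have "\<bar>cderiv L yh x \<bullet> wderiv L bh x\<bar> \<le> norm (cderiv L yh x - cderiv L y x) * norm (wderiv L bh x)
            + norm (cderiv L y x) * norm (wderiv L bh x - wderiv L b x)"
          using Cauchy_Schwarz_ineq2[of "cderiv L yh x - cderiv L y x" "wderiv L bh x"]
            Cauchy_Schwarz_ineq2[of "cderiv L y x" "wderiv L bh x - wderiv L b x"] by linarith
        also have "\<dots> \<le> (K * h) * (M + K * L) + 1 * (K * h)"
        proof (intro add_mono mult_mono)
          show "norm (wderiv L bh x) \<le> M + K * L"
            using norm_triangle_sub[of "wderiv L bh x" "wderiv L b x"] qM elim(2) KhL by linarith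
        qed (use er fp Kh elim in auto)
        also have "\<dots> \<le> (K * h) * (M + K * L + 2)" using Kh by (simp add: algebra_simps)
        also have "\<dots> = k * h" by (simp add: k_def)
        finally show ?case .
      qed
    qed (use ps in simp)
    have Jpos: "0 \<le> J1" "0 \<le> J2" using ps by (simp_all add: J1_def J2_def)
    have Ib0: "0 \<le> Ib" unfolding Ib_def using bending_props(3)[OF m conjunct1[OF ps]] by simp
    define e where "e = (1 / 2) * Ib + J1 + J2"
    have "E_disc L T lbc m (\<delta> h) (\<epsilon>1 h) (\<epsilon>2 h) (N h) (X h) (yh, bh) = ennreal e"
      using E_disc_eq[OF m _ _ _ Vh adm, of "\<delta> h" "\<epsilon>1 h" "\<epsilon>2 h"] ps by (simp add: e_def Ib_def J1_def J2_def)
    moreover have "\<bar>e - Q\<bar> \<le> R h"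
      using d1 d2 J1 J2 Jpos S0 unfolding e_def R_split by linarith
    moreover have "0 \<le> e" using Ib0 Jpos by (simp add: e_def)
    moreover have "V_norm L (\<lambda>x. yh x - y x, \<lambda>x. bh x - b x) \<le> R h" using Vn SR by linarith
    ultimately show "\<exists>yh bh e. (yh, bh) \<in> V L \<and>
      V_norm L (\<lambda>x. yh x - y x, \<lambda>x. bh x - b x) \<le> R h \<and> 0 \<le> e \<and>
      E_disc L T lbc m (\<delta> h) (\<epsilon>1 h) (\<epsilon>2 h) (N h) (X h) (yh, bh) = ennreal e \<and>
      \<bar>e - (LINT x|Om L. Qbar (norm (wderiv L (cderiv L y) x)) (norm (wderiv L b x)))\<bar> \<le> R h"
      using Vh unfolding Q_def by blast
  qed
qed


section \<open>The liminf inequality along the filter and the diagonal recovery sequence\<close>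

lemma E_cont_eq:
  assumes f: "(y, b) \<in> A_frame L T lbc" "AE x in Om L. cderiv L y x \<bullet> wderiv L b x = 0"
  shows "E_cont L T lbc (y, b) = ennreal (LINT x|Om L. Qbar (norm (wderiv L (cderiv L y) x)) (norm (wderiv L b x)))"
proof -
  have V: "y \<in> H2 L" "b \<in> H1 L" using f(1) by (auto simp: A_frame_def V_iff)
  show ?thesis
    using f nn_integral_eq_integral[OF Qbar_integrable[OF wderiv_H1(1)[OF H2_cderiv(1)[OF V(1)]] wderiv_H1(1)[OF V(2)]]]
    by (simp add: E_cont_def Qbar_nonneg)
qed

lemma E_cont_infinite:
  assumes "\<not> ((y, b) \<in> A_frame L T lbc \<and> (AE x in Om L. cderiv L y x \<bullet> wderiv L b x = 0))"
  shows "E_cont L T lbc (y, b) = \<infinity>"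
  using assms unfolding E_cont_def prod.case by (rule if_not_P)

text \<open>If the inequality fails, the energies are frequently at most some c below the limit
  energy, hence along a sequence of mesh sizes tending to 0. Such a c is finite, and the sequential
  form contradicts it.\<close>

lemma liminf_inequality:
  fixes T :: "curve \<times> curve \<Rightarrow> 'w::real_normed_vector" and U :: "real \<Rightarrow> curve \<times> curve"
  assumes T: "bounded_linear_on_V L T" and dep: "depends_only_on_boundary_values L T"
    and m: "regularized_modulus c0 c1 c2 cuni m"
    and H: "H \<subseteq> {0<..}" and part: "\<And>h. h \<in> H \<Longrightarrow> partition_with_mesh L h (N h) (X h)"
    and pos: "\<And>h. h \<in> H \<Longrightarrow> \<delta> h > 0 \<and> \<epsilon>1 h > 0 \<and> \<epsilon>2 h > 0"
    and lim: "(\<delta> \<longlongrightarrow> 0) (at 0 within H)" "(\<epsilon>1 \<longlongrightarrow> 0) (at 0 within H)" "(\<epsilon>2 \<longlongrightarrow> 0) (at 0 within H)"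
    and u: "u \<in> V L" and U: "\<And>h. h \<in> H \<Longrightarrow> U h \<in> V L"
    and weak: "weakly_converges L U u (at 0 within H)"
  shows "E_cont L T lbc u \<le> Liminf (at 0 within H)
    (\<lambda>h. E_disc L T lbc m (\<delta> h) (\<epsilon>1 h) (\<epsilon>2 h) (N h) (X h) (U h))"
  unfolding le_Liminf_iff
proof (intro allI impI)
  let ?E = "\<lambda>h. E_disc L T lbc m (\<delta> h) (\<epsilon>1 h) (\<epsilon>2 h) (N h) (X h)"
  fix c assume c: "c < E_cont L T lbc u"
  show "\<forall>\<^sub>F h in at 0 within H. c < ?E h (U h)"
  proof (rule ccontr)
    assume "\<not> ?thesis"
    then have fr: "\<exists>\<^sub>F h in at 0 within H. ?E h (U h) \<le> c"
      by (simp add: not_eventually not_less)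
    have "\<exists>h\<in>H. h < 1 / real (Suc n) \<and> ?E h (U h) \<le> c" for n
    proof -
      have "\<forall>\<^sub>F h in at 0 within H. h < 1 / real (Suc n)"
        by (rule order_tendstoD(2)[OF tendsto_ident_at]) simp
      moreover have "\<forall>\<^sub>F h in at 0 within H. h \<in> H"
        unfolding eventually_at_filter by (rule always_eventually) simp
      ultimately have "\<forall>\<^sub>F h in at 0 within H. h \<in> H \<and> h < 1 / real (Suc n)"
        by eventually_elim simp
      with fr have "\<exists>\<^sub>F h in at 0 within H. ?E h (U h) \<le> c \<and> (h \<in> H \<and> h < 1 / real (Suc n))"
        by (rule frequently_eventually_frequently)
      then show ?thesis by (blast dest: frequently_ex)
    qed
    then obtain s where s: "\<And>n. s n \<in> H" "\<And>n. s n < 1 / real (Suc n)" "\<And>n. ?E (s n) (U (s n)) \<le> c"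
      by metis
    have s0: "s \<longlonglongrightarrow> 0"
    proof (rule tendsto_sandwich[OF _ _ tendsto_const])
      show "(\<lambda>n. 1 / real (Suc n)) \<longlonglongrightarrow> 0" using LIMSEQ_inverse_real_of_nat by (simp add: inverse_eq_divide)
      show "\<forall>\<^sub>F n in sequentially. 0 \<le> s n"
        by (rule always_eventually) (use s(1) H in \<open>auto intro: less_imp_le\<close>)
      show "\<forall>\<^sub>F n in sequentially. s n \<le> 1 / real (Suc n)"
        by (rule always_eventually) (use s(2) in \<open>auto intro: less_imp_le\<close>)
    qed
    have fs: "filterlim s (at 0 within H) sequentially"
      unfolding filterlim_at
    proof (intro conjI s0 always_eventually allI)
      show "s n \<noteq> 0" for n using s(1)[of n] H by auto
    qed (rule s(1))
    have "c \<noteq> \<infinity>" using c by auto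
    then obtain C where C: "c = ennreal C" "0 \<le> C" by (cases c) auto
    define Y B where "Y n = fst (U (s n))" and "B n = snd (U (s n))" for n
    have YB: "(Y n, B n) = U (s n)" for n by (simp add: Y_def B_def)
    have uu: "(fst u, snd u) = u" by simp
    have "E_cont L T lbc (fst u, snd u) \<le> ennreal C"
    proof (rule liminf_sequence[OF T dep m, where Y=Y and B=B and h=s and N="\<lambda>n. N (s n)" and X="\<lambda>n. X (s n)"
          and d="\<lambda>n. \<delta> (s n)" and ?e1.0="\<lambda>n. \<epsilon>1 (s n)" and ?e2.0="\<lambda>n. \<epsilon>2 (s n)"])
      show "weakly_converges L (\<lambda>n. (Y n, B n)) (fst u, snd u) sequentially"
        using weak filterlim_compose[OF _ fs] unfolding weakly_converges_def YB uu by blast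
      show "E_disc L T lbc m (\<delta> (s n)) (\<epsilon>1 (s n)) (\<epsilon>2 (s n)) (N (s n)) (X (s n)) (Y n, B n) \<le> ennreal C" for n
        using s(3)[of n] by (simp add: YB C)
    qed (use U u s pos part C s0 filterlim_compose[OF _ fs] lim in \<open>auto simp: YB\<close>)
    then show False using c C by simp
  qed
qed

lemma near_in_V_functional_close:
  fixes f :: "curve \<times> curve \<Rightarrow> real"
  assumes f: "bounded_linear_on_V L f" and C: "\<And>u. u \<in> V L \<Longrightarrow> norm (f u) \<le> C * V_norm L u"
    and V: "(y, b) \<in> V L" "(z, c) \<in> V L"
  shows "\<bar>f (y, b) - f (z, c)\<bar> \<le> C * V_norm L (\<lambda>x. y x - z x, \<lambda>x. b x - c x)"
  using C[OF bounded_linear_on_V_diff(1)[OF f V]] bounded_linear_on_V_diff(2)[OF f V] by simp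

text \<open>Closeness of position and energy is measured at levels 1/(k+1), so both limits follow
  once each level is eventually attained along a single family \<open>U\<close>.\<close>

lemma recovery_sequence:
  fixes T :: "curve \<times> curve \<Rightarrow> 'w::real_normed_vector" and y b :: curve
  assumes dep: "depends_only_on_boundary_values L T"
    and m: "regularized_modulus c0 c1 c2 cuni m" and cuni: "cuni > 0"
    and H: "H \<subseteq> {0<..}" and part: "\<And>h. h \<in> H \<Longrightarrow> partition_with_mesh L h (N h) (X h)"
    and pos: "\<And>h. h \<in> H \<Longrightarrow> \<delta> h > 0 \<and> \<epsilon>1 h > 0 \<and> \<epsilon>2 h > 0"
    and lim: "(\<delta> \<longlongrightarrow> 0) (at 0 within H)" "((\<lambda>h. h\<^sup>2 / \<epsilon>1 h + h\<^sup>2 / \<epsilon>2 h) \<longlongrightarrow> 0) (at 0 within H)"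
    and frame: "(y, b) \<in> A_frame L T lbc" and twist: "AE x in Om L. cderiv L y x \<bullet> wderiv L b x = 0"
    and density: "\<And>\<sigma>. \<sigma> > 0 \<Longrightarrow>
        \<exists>y\<sigma> b\<sigma>. y\<sigma> \<in> Cinf L \<and> b\<sigma> \<in> Cinf L \<and> (y\<sigma>, b\<sigma>) \<in> A_frame L T lbc \<and>
          H2_norm L (\<lambda>x. y x - y\<sigma> x) + H1_norm L (\<lambda>x. b x - b\<sigma> x) \<le> \<sigma> \<and>
          (\<forall>x\<in>{0<..<L}. cderiv L y\<sigma> x \<bullet> cderiv L b\<sigma> x = 0)"
  obtains U where "\<And>h. U h \<in> V L" "weakly_converges L U (y, b) (at 0 within H)"
    "((\<lambda>h. E_disc L T lbc m (\<delta> h) (\<epsilon>1 h) (\<epsilon>2 h) (N h) (X h) (U h)) \<longlongrightarrow> E_cont L T lbc (y, b)) (at 0 within H)"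
proof -
  let ?E = "\<lambda>h. E_disc L T lbc m (\<delta> h) (\<epsilon>1 h) (\<epsilon>2 h) (N h) (X h)"
  have V0: "(y, b) \<in> V L" using frame by (simp add: A_frame_def)
  then have VH: "y \<in> H2 L" "b \<in> H1 L" by (auto simp: V_iff)
  note p = wderiv_H1(1)[OF H2_cderiv(1)[OF VH(1)]] and q = wderiv_H1(1)[OF VH(2)]
  define Q where "Q = (LINT x|Om L. Qbar (norm (wderiv L (cderiv L y) x)) (norm (wderiv L b x)))"
  have Q0: "0 \<le> Q" unfolding Q_def by (simp add: Qbar_nonneg)
  define A where "A = 4 * L2_norm L (wderiv L (cderiv L y)) + 16 * L2_norm L (wderiv L b) + 10"
  have A0: "10 \<le> A" by (simp add: A_def)
  \<comment> \<open>Closeness to (y, b) is recorded through an intermediate pair in \<open>V\<close>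
    with both distances; under a bounded functional only the triangle inequality for real numbers is
    then used.\<close>
  define near where "near \<eta> yh bh \<longleftrightarrow> (\<exists>z c. (z, c) \<in> V L \<and>
    V_norm L (\<lambda>x. yh x - z x, \<lambda>x. bh x - c x) + V_norm L (\<lambda>x. y x - z x, \<lambda>x. b x - c x) \<le> \<eta>)"
    for \<eta> yh bh
  define good where "good k h w \<longleftrightarrow> w \<in> V L \<and> near (1 / (real k + 1)) (fst w) (snd w) \<and>
    (\<exists>e\<ge>0. ?E h w = ennreal e \<and> \<bar>e - Q\<bar> \<le> 1 / (real k + 1))" for k h w
  have ex: "\<forall>\<^sub>F h in at 0 within H. \<exists>w. good k h w" for k
  proof -
    define \<eta> where "\<eta> = 1 / (real k + 1)"
    have \<eta>: "0 < \<eta>" "\<eta> \<le> 1" by (simp_all add: \<eta>_def)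
    \<comment> \<open>Half of \<eta> is the budget of the smooth approximation: the energy moves by
      at most A \<sigma> = \<eta>/2, and A \<ge> 10 keeps \<sigma> itself below \<eta>/2. The other
      half is left to the interpolation.\<close>
    define \<sigma> where "\<sigma> = \<eta> / (2 * A)"
    have \<sigma>: "0 < \<sigma>" "\<sigma> \<le> \<eta> / 2" "A * \<sigma> = \<eta> / 2" "\<sigma> \<le> 1"
    proof -
      show "0 < \<sigma>" using \<eta> A0 by (simp add: \<sigma>_def)
      show s: "A * \<sigma> = \<eta> / 2" using A0 by (simp add: \<sigma>_def)
      have "1 * \<sigma> \<le> A * \<sigma>" using A0 \<open>0 < \<sigma>\<close> by (intro mult_right_mono) auto
      then show "\<sigma> \<le> \<eta> / 2" using s by simp
      then show "\<sigma> \<le> 1" using \<eta> by simp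
    qed
    obtain z c where zc: "z \<in> Cinf L" "c \<in> Cinf L" "(z, c) \<in> A_frame L T lbc"
      and dist: "H2_norm L (\<lambda>x. y x - z x) + H1_norm L (\<lambda>x. b x - c x) \<le> \<sigma>"
      and orth: "\<And>x. x \<in> {0<..<L} \<Longrightarrow> cderiv L z x \<bullet> cderiv L c x = 0"
      using density[OF \<sigma>(1)] by blast
    have Vzc: "(z, c) \<in> V L" using zc(3) by (simp add: A_frame_def)
    then have VHz: "z \<in> H2 L" "c \<in> H1 L" by (auto simp: V_iff)
    note pz = wderiv_H1(1)[OF H2_cderiv(1)[OF VHz(1)]] and qz = wderiv_H1(1)[OF VHz(2)]
    have Vd: "V_norm L (\<lambda>x. y x - z x, \<lambda>x. b x - c x) \<le> \<sigma>" using dist by (simp add: V_norm_pair)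
    have flip: "L2_norm L (\<lambda>x. f x - g x) = L2_norm L (\<lambda>x. g x - f x)" for f g :: curve
      by (simp add: L2_norm_def norm_minus_commute)
    define Qz where "Qz = (LINT x|Om L. Qbar (norm (wderiv L (cderiv L z) x)) (norm (wderiv L c x)))"
    have "\<bar>Qz - Q\<bar> \<le> A * \<sigma>"
      unfolding Qz_def Q_def A_def
      by (rule Qbar_integral_diff[OF p pz q qz])
         (use V_norm_diff_bounds[OF V0 Vzc Vd] \<sigma>(4) in \<open>simp_all add: flip[of "wderiv L (cderiv L z)"] flip[of "wderiv L c"]\<close>)
    then have Qd: "\<bar>Qz - Q\<bar> \<le> \<eta> / 2" by (simp add: \<sigma>)
    obtain R where R: "(R \<longlongrightarrow> 0) (at 0 within H)"
      and rec: "\<And>h. h \<in> H \<Longrightarrow> R h \<le> 1 \<Longrightarrow> \<exists>yh bh e. (yh, bh) \<in> V L \<and>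
        V_norm L (\<lambda>x. yh x - z x, \<lambda>x. bh x - c x) \<le> R h \<and> 0 \<le> e \<and>
        ?E h (yh, bh) = ennreal e \<and> \<bar>e - Qz\<bar> \<le> R h"
      using smooth_recovery[OF dep m cuni H part pos lim zc(1,2,3) orth] unfolding Qz_def by blast
    have "\<forall>\<^sub>F h in at 0 within H. R h < \<eta> / 2"
      by (rule order_tendstoD(2)[OF R]) (use \<eta> in simp)
    moreover have "\<forall>\<^sub>F h in at 0 within H. h \<in> H"
      unfolding eventually_at_filter by (rule always_eventually) simp
    ultimately show ?thesis
    proof eventually_elim
      case (elim h)
      then have "R h \<le> 1" using \<eta> by linarith
      from rec[OF elim(2) this] obtain yh bh e where w: "(yh, bh) \<in> V L"
        "V_norm L (\<lambda>x. yh x - z x, \<lambda>x. bh x - c x) \<le> R h" "0 \<le> e" "?E h (yh, bh) = ennreal e" "\<bar>e - Qz\<bar> \<le> R h"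
        by blast
      have "V_norm L (\<lambda>x. yh x - z x, \<lambda>x. bh x - c x) + V_norm L (\<lambda>x. y x - z x, \<lambda>x. b x - c x) \<le> \<eta>"
        using w(2) Vd \<sigma>(2) elim(1) by linarith
      then have "near \<eta> yh bh" unfolding near_def using Vzc by blast
      moreover have "\<bar>e - Q\<bar> \<le> \<eta>" using w(5) Qd elim(1) by linarith
      ultimately have "good k h (yh, bh)" using w unfolding good_def \<eta>_def by auto
      then show ?case by blast
    qed
  qed
  have near_mono: "near \<eta> yh bh \<Longrightarrow> \<eta> \<le> \<eta>' \<Longrightarrow> near \<eta>' yh bh" for \<eta> \<eta>' yh bh
    unfolding near_def by (blast intro: order_trans)
  have mono: "good k h w" if "k \<le> j" "good j h w" for j k h w
  proof -
    have le: "1 / (real j + 1) \<le> 1 / (real k + 1)" using that(1) by (simp add: field_simps)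
    then show ?thesis using that(2) near_mono[OF _ le] order_trans[OF _ le] unfolding good_def by blast
  qed
  have in_V: "w \<in> V L" if "good k h w" for k h w using that by (simp add: good_def)
  have "\<exists>U. (\<forall>h. U h \<in> V L) \<and> (\<forall>k. \<forall>\<^sub>F h in at 0 within H. good k h (U h))"
    by (rule diagonal_choice[of H good "(y, b)"]; (rule H ex V0 | erule (1) mono | erule in_V))
  then obtain U where U: "\<And>h. U h \<in> V L" "\<And>k. \<forall>\<^sub>F h in at 0 within H. good k h (U h)" by blast
  have small: "\<exists>k. 1 / (real k + 1) < r" if "0 < r" for r :: real
    using reals_Archimedean[OF that] by (auto simp: inverse_eq_divide add.commute)
  show thesis
  proof (rule that[of U, OF U(1)])
    show "weakly_converges L U (y, b) (at 0 within H)"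
      unfolding weakly_converges_def
    proof (intro allI impI)
      fix f :: "curve \<times> curve \<Rightarrow> real" assume f: "bounded_linear_on_V L f"
      obtain C where C: "C \<ge> 0" "\<And>u. u \<in> V L \<Longrightarrow> norm (f u) \<le> C * V_norm L u"
        using bounded_linear_on_V_bound[OF f] by blast
      show "((\<lambda>h. f (U h)) \<longlongrightarrow> f (y, b)) (at 0 within H)"
      proof (rule tendstoI)
        fix r :: real assume r: "0 < r"
        \<comment> \<open>\<open>C + 1\<close> in place of \<open>C\<close>, since \<open>C\<close>
          may be 0.\<close>
        then obtain k where k: "1 / (real k + 1) < r / (C + 1)" using small[of "r / (C + 1)"] C by auto
        show "\<forall>\<^sub>F h in at 0 within H. dist (f (U h)) (f (y, b)) < r"
          using U(2)[of k]
        proof eventually_elim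
          case (elim h)
          obtain yh bh where w: "U h = (yh, bh)" by (cases "U h")
          from elim obtain z c where zc: "(z, c) \<in> V L" "(yh, bh) \<in> V L"
            "V_norm L (\<lambda>x. yh x - z x, \<lambda>x. bh x - c x) + V_norm L (\<lambda>x. y x - z x, \<lambda>x. b x - c x) \<le> 1 / (real k + 1)"
            by (auto simp: good_def near_def w)
          have "\<bar>f (yh, bh) - f (y, b)\<bar> \<le> \<bar>f (yh, bh) - f (z, c)\<bar> + \<bar>f (y, b) - f (z, c)\<bar>" by linarith
          also have "\<dots> \<le> C * V_norm L (\<lambda>x. yh x - z x, \<lambda>x. bh x - c x) + C * V_norm L (\<lambda>x. y x - z x, \<lambda>x. b x - c x)"
            by (intro add_mono near_in_V_functional_close[OF f C(2)] zc V0)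
          also have "\<dots> \<le> C * (1 / (real k + 1))"
            unfolding distrib_left[symmetric] by (intro mult_left_mono zc C)
          also have "\<dots> \<le> (C + 1) * (1 / (real k + 1))" by (intro mult_right_mono) auto
          also have "\<dots> < (C + 1) * (r / (C + 1))" using k C by (intro mult_strict_left_mono) auto
          also have "\<dots> = r" using C by simp
          finally show ?case by (simp add: w dist_real_def)
        qed
      qed
    qed
    \<comment> \<open>\<open>good\<close> supplies a real energy only eventually;
      \<open>enn2real\<close> names one for every h.\<close>
    define e where "e h = enn2real (?E h (U h))" for h
    have eh: "\<forall>\<^sub>F h in at 0 within H. ?E h (U h) = ennreal (e h) \<and> \<bar>e h - Q\<bar> \<le> 1 / (real k + 1)" for k
      using U(2)[of k] by eventually_elim (auto simp: good_def e_def)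
    have "(e \<longlongrightarrow> Q) (at 0 within H)"
    proof (rule tendstoI)
      fix r :: real assume "0 < r"
      then obtain k where k: "1 / (real k + 1) < r" using small by blast
      show "\<forall>\<^sub>F h in at 0 within H. dist (e h) Q < r"
        using eh[of k] by eventually_elim (use k in \<open>simp add: dist_real_def\<close>)
    qed
    then have "((\<lambda>h. ennreal (e h)) \<longlongrightarrow> ennreal Q) (at 0 within H)" by (rule tendsto_ennrealI)
    moreover have "\<forall>\<^sub>F h in at 0 within H. ennreal (e h) = ?E h (U h)"
      using eh[of 0] by eventually_elim simp
    ultimately have "((\<lambda>h. ?E h (U h)) \<longlongrightarrow> ennreal Q) (at 0 within H)"
      by (rule Lim_transform_eventually)
    then show "((\<lambda>h. ?E h (U h)) \<longlongrightarrow> E_cont L T lbc (y, b)) (at 0 within H)"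
      by (simp add: E_cont_eq[OF frame twist] Q_def)
  qed
qed

end

theorem corollary4p4:
  fixes L :: real
    and Lbc :: "curve \<times> curve \<Rightarrow> 'w::real_normed_vector" and lbc :: 'w
    and m :: "real \<Rightarrow> real \<Rightarrow> real" and c0 c1 c2 cuni :: real
    and H :: "real set" and N :: "real \<Rightarrow> nat" and X :: "real \<Rightarrow> nat \<Rightarrow> real"
    and \<delta> \<epsilon>1 \<epsilon>2 :: "real \<Rightarrow> real"
  assumes "L > 0"
    and "bounded_linear_on_V L Lbc" and "depends_only_on_boundary_values L Lbc"
    and "c0 > 0" "c1 > 0" "c2 > 0" "cuni > 0" and "regularized_modulus c0 c1 c2 cuni m"
    and "H \<subseteq> {0<..}" and "0 islimpt H" and "quasiuniform_family L H N X"
    and density: "\<And>y b \<sigma>. (y, b) \<in> A_frame L Lbc lbc \<Longrightarrow>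
        (AE x in Om L. cderiv L y x \<bullet> wderiv L b x = 0) \<Longrightarrow> \<sigma> > 0 \<Longrightarrow>
        \<exists>y\<sigma> b\<sigma>. y\<sigma> \<in> Cinf L \<and> b\<sigma> \<in> Cinf L \<and> (y\<sigma>, b\<sigma>) \<in> A_frame L Lbc lbc \<and>
          H2_norm L (\<lambda>x. y x - y\<sigma> x) + H1_norm L (\<lambda>x. b x - b\<sigma> x) \<le> \<sigma> \<and>
          (\<forall>x\<in>{0<..<L}. cderiv L y\<sigma> x \<bullet> cderiv L b\<sigma> x = 0)"
    and "\<And>h. h \<in> H \<Longrightarrow> \<delta> h > 0 \<and> \<epsilon>1 h > 0 \<and> \<epsilon>2 h > 0"
    and "(\<delta> \<longlongrightarrow> 0) (at 0 within H)"
    and "(\<epsilon>1 \<longlongrightarrow> 0) (at 0 within H)" and "(\<epsilon>2 \<longlongrightarrow> 0) (at 0 within H)"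
    and "((\<lambda>h. h\<^sup>2 / \<epsilon>1 h + h\<^sup>2 / \<epsilon>2 h) \<longlongrightarrow> 0) (at 0 within H)"
  shows "Gamma_converges L H (\<lambda>h. E_disc L Lbc lbc m (\<delta> h) (\<epsilon>1 h) (\<epsilon>2 h) (N h) (X h))
           (E_cont L Lbc lbc)"
proof -
  interpret bounded_interval L by standard (rule \<open>L > 0\<close>)
  let ?E = "\<lambda>h. E_disc L Lbc lbc m (\<delta> h) (\<epsilon>1 h) (\<epsilon>2 h) (N h) (X h)"
  have part: "partition_with_mesh L h (N h) (X h)" if "h \<in> H" for h
    using \<open>quasiuniform_family L H N X\<close> that by (simp add: quasiuniform_family_def)
  have pos: "\<delta> h > 0 \<and> \<epsilon>1 h > 0 \<and> \<epsilon>2 h > 0" if "h \<in> H" for h by (rule assms(13)[OF that])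
  note lsc = liminf_inequality[OF assms(2,3,8,9) part pos assms(14,15,16)]
  show ?thesis
    unfolding Gamma_converges_def
  proof (intro conjI ballI allI impI)
    fix u U assume u: "u \<in> V L" and U: "\<forall>h\<in>H. U h \<in> V L" and w: "weakly_converges L U u (at 0 within H)"
    show "E_cont L Lbc lbc u \<le> Liminf (at 0 within H) (\<lambda>h. ?E h (U h))"
      by (rule lsc[OF _ _ u _ w]) (use U in auto)
  next
    fix u assume u: "u \<in> V L"
    obtain y b where yb: "u = (y, b)" by (cases u)
    show "\<exists>U. (\<forall>h\<in>H. U h \<in> V L) \<and> weakly_converges L U u (at 0 within H) \<and>
        ((\<lambda>h. ?E h (U h)) \<longlongrightarrow> E_cont L Lbc lbc u) (at 0 within H)"
    proof (cases "(y, b) \<in> A_frame L Lbc lbc \<and> (AE x in Om L. cderiv L y x \<bullet> wderiv L b x = 0)")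
      case True
      obtain U where "\<And>h. U h \<in> V L" "weakly_converges L U (y, b) (at 0 within H)"
        "((\<lambda>h. ?E h (U h)) \<longlongrightarrow> E_cont L Lbc lbc (y, b)) (at 0 within H)"
        using recovery_sequence[OF assms(3,8,7,9) part pos assms(14,17) conjunct1[OF True] conjunct2[OF True]
            density[OF conjunct1[OF True] conjunct2[OF True]]] by blast
      then show ?thesis unfolding yb by blast
    next
      case False
      have inf: "E_cont L Lbc lbc u = \<infinity>" unfolding yb by (rule E_cont_infinite[OF False])
      have w: "weakly_converges L (\<lambda>_. u) u (at 0 within H)" by (simp add: weakly_converges_def)
      have "E_cont L Lbc lbc u \<le> Liminf (at 0 within H) (\<lambda>h. ?E h u)"
        by (rule lsc[OF _ _ u _ w]) (use u in auto)
      then have li: "Liminf (at 0 within H) (\<lambda>h. ?E h u) = \<infinity>" by (simp add: inf top_unique)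
      \<comment> \<open>A lower limit equal to the top element is already a limit.\<close>
      have "((\<lambda>h. ?E h u) \<longlongrightarrow> \<infinity>) (at 0 within H)"
      proof (rule order_tendstoI)
        fix c :: ennreal assume "c < \<infinity>"
        then show "\<forall>\<^sub>F h in at 0 within H. c < ?E h u"
          using li le_Liminf_iff[of "\<infinity>" "at 0 within H" "\<lambda>h. ?E h u"] by simp
      qed simp
      then show ?thesis using u w inf by (intro exI[of _ "\<lambda>_. u"]) auto
    qed
  qed
qed

end
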